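(* Consider a Markov decision process with Borel state space $\mathbb X$, countable discrete action space $\mathbb A$, Borel measurable control constraint graph $\Gamma$ and Borel measurable one-stage cost $c\ge0$. Assume: (G) For some policy $\pi\in\Pi$ and state $x\in\mathbb X$, $J(\pi,x)<\infty$. (SU) There exist two increasing sequences of compact sets $\{K_n\}$, $\{A_n\}$ with $K_n\subset\mathbb X$, $A_n\subset\mathbb A$ such that $\lim_{n\to\infty}\inf_{(x,a)\notin K_n\times A_n}c(x,a)=+\infty$. (M) For each set $K\in\{K_n\}$ there exist an open set $O\supset K$ and a finite measure $\nu$ on $\mathcal B(\mathbb X)$ such that $$q\big((O\setminus D)\cap B\mid x,a\big)\le\nu(B),\qquad\forall\,B\in\mathcal B(\mathbb X),\ (x,a)\in\Gamma,$$ where $D\subset\mathbb X$ is some closed set (possibly empty) such that, restricted to $D\times\mathbb A$, the state transition stochastic kernel $q(dy\mid x,a)$ is continuous and $c$ is lower semicontinuous. Then there exists a minimum pair $(\bar\mu,\bar p)$, i.e., $(\bar\mu,\bar p)\in\Pi\times\mathcal P(\mathbb X)$ with $$J(\bar\mu,\bar p)=\inf_{p\in\mathcal P(\mathbb X)}\inf_{\pi\in\Pi}J(\pi,p),$$ where $\bar\mu$ is a stationary policy and $\bar p$ is an invariant probability measure of the Markov chain on $\mathbb X$ induced by $\bar\mu$.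
   Context: **MDP.** The state space $\mathbb X$ is a Borel space (homeomorphic to a Borel subset of a Polish space); the action space $\mathbb A$ is countable with the discrete topology. For each $x$, $A(x)\subset\mathbb A$ is a nonempty set of admissible actions and $\Gamma=\{(x,a):x\in\mathbb X,a\in A(x)\}$ is a Borel subset of $\mathbb X\times\mathbb A$. The one-stage cost $c:\Gamma\to[0,\infty]$ is Borel measurable and is extended to $\mathbb X\times\mathbb A$ by $c(x,a)=+\infty$ for $a\notin A(x)$ (lower semicontinuity on $D\times\mathbb A$ refers to this extension). The state transitions are governed by a Borel measurable stochastic kernel $q(dy\mid x,a)$ on $\mathbb X$ given $\mathbb X\times\mathbb A$, i.e., $q(\cdot\mid x,a)\in\mathcal P(\mathbb X)$ (Borel probability measures on $\mathbb X$, with the topology of weak convergence) and $q(B\mid\cdot)$ is Borel measurable for each $B\in\mathcal B(\mathbb X)$. The kernel is continuous on a set if $(x,a)\mapsto q(\cdot\mid x,a)\in\mathcal P(\mathbb X)$ is continuous there. **Policies.** $\Pi$ is the set of Borel measurable policies: sequences $\pi=(\mu_0,\mu_1,\dots)$ where $\mu_k(da_k\mid x_0,a_0,\dots,a_{k-1},x_k)$ is a Borel measurable stochastic kernel on $\mathbb A$ given $(\mathbb X\times\mathbb A)^k\times\mathbb X$ with $\mu_k(A(x_k)\mid x_0,\dots,x_k)=1$ for all histories. A policy is stationary if $\mu_k(\cdot\mid x_0,\dots,x_k)=\mu(\cdot\mid x_k)$ for all $k$ and one kernel $\mu$ (possibly randomized), and it is then denoted $\mu$. For $\pi\in\Pi$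 and an initial distribution $p\in\mathcal P(\mathbb X)$, $J(\pi,p)=\limsup_{n\to\infty}\frac1n\mathbb E^\pi_p[\sum_{k=0}^{n-1}c(x_k,a_k)]$, where $\mathbb E^\pi_p$ is expectation when $x_0\sim p$ and $\pi$ is used; $J(\pi,x)=J(\pi,\delta_x)$. A probability measure $\bar p$ is invariant for the Markov chain on $\mathbb X$ induced by a stationary policy $\bar\mu$ if $\bar p(B)=\int_{\mathbb X}\int_{\mathbb A}q(B\mid x,a)\,\bar\mu(da\mid x)\,\bar p(dx)$ for all $B\in\mathcal B(\mathbb X)$. *)

theory Defs
  imports "HOL-Probability.Probability"
begin

text \<open>
  The state space is a type \<open>'x\<close> with its topology; that it is a Borel space is assumed in the
  theorem, as a homeomorphism from \<open>UNIV\<close> onto a Borel subset of a Polish space. The action space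
  is a type of class \<open>countable\<close> and \<open>discrete_topology\<close>. On state-action pairs, \<open>borel\<close> is the Borel
  sigma-algebra of the product topology; it is also the product of the two Borel sigma-algebras:
\<close>

lemma sets_borel_state_action:
  "sets (borel :: ('x::topological_space \<times> 'a::{countable,discrete_topology}) measure) = sets (borel \<Otimes>\<^sub>M borel)"
proof
  have "W \<in> sets (borel \<Otimes>\<^sub>M borel)" if "open W" for W :: "('x \<times> 'a) set"
  proof -
    have "open ((\<lambda>x. (x, a)) -` W)" for a
      using that by (intro open_vimage continuous_intros)
    then have "(\<Union>a. ((\<lambda>x. (x, a)) -` W) \<times> {a}) \<in> sets (borel \<Otimes>\<^sub>M borel)"
      by (intro sets.countable_UN' pair_measureI) (auto intro: borel_open open_discrete)
    also have "(\<Union>a. ((\<lambda>x. (x, a)) -` W) \<times> {a}) = W"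
      by auto
    finally show ?thesis .
  qed
  then show "sets (borel :: ('x \<times> 'a) measure) \<subseteq> sets (borel \<Otimes>\<^sub>M borel)"
    using sets.sigma_sets_subset[of "Collect open" "borel \<Otimes>\<^sub>M (borel :: 'a measure)"]
    by (auto simp: borel_def space_pair_measure)
  have "(fst :: 'x \<times> 'a \<Rightarrow> 'x) \<in> borel_measurable borel"
       "(snd :: 'x \<times> 'a \<Rightarrow> 'a) \<in> borel_measurable borel"
    by (auto intro!: borel_measurable_continuous_onI continuous_on_fst continuous_on_snd
          continuous_on_id)
  then have "(\<lambda>z. (fst z, snd z)) \<in> (borel :: ('x \<times> 'a) measure) \<rightarrow>\<^sub>M borel \<Otimes>\<^sub>M borel"
    by (rule measurable_Pair)
  from measurable_sets[OF this]
  show "sets (borel \<Otimes>\<^sub>M borel) \<subseteq> sets (borel :: ('x \<times> 'a) measure)"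
    by (auto simp: subset_iff)
qed

definition prob_measures :: "'x::topological_space measure set" where
  "prob_measures = space (prob_algebra borel)"

definition weak_conv_topology :: "'x::topological_space measure topology" where
  "weak_conv_topology = topology_generated_by
     {{p \<in> prob_measures. (\<integral>x. f x \<partial>p) \<in> U} | (f :: 'x \<Rightarrow> real) U.
        continuous_on UNIV f \<and> bounded (range f) \<and> open U}"

definition lsc_on :: "'z::topological_space set \<Rightarrow> ('z \<Rightarrow> ennreal) \<Rightarrow> bool" where
  "lsc_on S f \<longleftrightarrow> (\<forall>z\<in>S. f z \<le> Liminf (at z within S) f)"

definition graph :: "('x \<Rightarrow> 'a set) \<Rightarrow> ('x \<times> 'a) set" where
  "graph A = {(x, a). a \<in> A x}"

text \<open>The one-stage cost is a function on the graph of \<open>A\<close>; its values elsewhere are never used.\<close>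

definition ext_cost :: "('x \<Rightarrow> 'a set) \<Rightarrow> ('x \<times> 'a \<Rightarrow> ennreal) \<Rightarrow> 'x \<times> 'a \<Rightarrow> ennreal" where
  "ext_cost A c z = (if z \<in> graph A then c z else \<infinity>)"

text \<open>
  \<open>\<pi> k h x\<close> is the conditional distribution of the action at time \<open>k\<close>, where \<open>h i\<close>, for \<open>i < k\<close>, is
  the state-action pair at time \<open>i\<close>, and \<open>x\<close> is the state at time \<open>k\<close>.
\<close>

type_synonym ('x, 'a) policy = "nat \<Rightarrow> (nat \<Rightarrow> 'x \<times> 'a) \<Rightarrow> 'x \<Rightarrow> 'a measure"

definition histories :: "nat \<Rightarrow> (nat \<Rightarrow> 'x::topological_space \<times> 'a::topological_space) measure" where
  "histories k = PiM {0..<k} (\<lambda>_. borel)"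

definition policies ::
  "('x::topological_space \<Rightarrow> 'a::{countable,discrete_topology} set) \<Rightarrow> ('x, 'a) policy set" where
  "policies A = {\<pi>. \<forall>k.
     (\<lambda>(h, x). \<pi> k h x) \<in> histories k \<Otimes>\<^sub>M borel \<rightarrow>\<^sub>M prob_algebra borel \<and>
     (\<forall>h\<in>space (histories k). \<forall>x. emeasure (\<pi> k h x) (A x) = 1)}"

definition stationary :: "('x \<Rightarrow> 'a measure) \<Rightarrow> ('x, 'a) policy" where
  "stationary \<mu> = (\<lambda>k h x. \<mu> x)"

definition next_pair ::
  "('x::topological_space \<times> 'a::topological_space \<Rightarrow> 'x measure) \<Rightarrow> ('x, 'a) policy \<Rightarrow> 'x measure
    \<Rightarrow> nat \<Rightarrow> (nat \<Rightarrow> 'x \<times> 'a) \<Rightarrow> ('x \<times> 'a) measure" where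
  "next_pair q \<pi> p k h =
     (if k = 0 then p else q (h (k - 1))) \<bind> (\<lambda>x. distr (\<pi> k h x) borel (Pair x))"

text \<open>The law of the state-action process \<open>((x\<^sub>0, a\<^sub>0), (x\<^sub>1, a\<^sub>1), \<dots>)\<close>, by the Ionescu-Tulcea theorem:\<close>

definition process ::
  "('x::topological_space \<times> 'a::topological_space \<Rightarrow> 'x measure) \<Rightarrow> ('x, 'a) policy \<Rightarrow> 'x measure
    \<Rightarrow> (nat \<Rightarrow> 'x \<times> 'a) measure" where
  "process q \<pi> p = projective_family.lim UNIV
     (Ionescu_Tulcea.CI (next_pair q \<pi> p) (\<lambda>_. borel)) (\<lambda>_. borel)"

lemma Ionescu_Tulcea_next_pair:
  fixes A :: "'x::topological_space \<Rightarrow> 'a::{countable,discrete_topology} set"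
  assumes q: "q \<in> borel \<rightarrow>\<^sub>M prob_algebra borel" and \<pi>: "\<pi> \<in> policies A" and p: "p \<in> prob_measures"
  shows "Ionescu_Tulcea (next_pair q \<pi> p) (\<lambda>_. borel)"
proof -
  have [measurable]: "(\<lambda>(h, x). \<pi> k h x) \<in> histories k \<Otimes>\<^sub>M borel \<rightarrow>\<^sub>M prob_algebra borel" for k
    using \<pi> by (simp add: policies_def)
  have 1: "(\<lambda>h. if k = 0 then p else q (h (k - 1))) \<in> histories k \<rightarrow>\<^sub>M prob_algebra borel" for k
  proof (cases "k = 0")
    case False
    then have "(\<lambda>h. h (k - 1)) \<in> histories k \<rightarrow>\<^sub>M (borel :: ('x \<times> 'a) measure)"
      unfolding histories_def by (intro measurable_component_singleton) auto
    from measurable_compose[OF this q] False show ?thesis by simp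
  qed (use p in \<open>simp add: prob_measures_def\<close>)
  have 2: "(\<lambda>(h, x). distr (\<pi> k h x) borel (Pair x))
      \<in> histories k \<Otimes>\<^sub>M borel \<rightarrow>\<^sub>M prob_algebra (borel :: ('x \<times> 'a) measure)" for k
    unfolding case_prod_beta
    by (rule measurable_distr_prob_space2[where M = borel])
       (simp_all add: measurable_cong_sets[OF refl sets_borel_state_action] case_prod_beta)
  have *: "next_pair q \<pi> p k \<in> histories k \<rightarrow>\<^sub>M prob_algebra borel" for k
    unfolding next_pair_def[abs_def]
    by (rule measurable_bind_prob_space2[OF 1 2])
  show ?thesis
  proof (rule Ionescu_Tulcea.intro)
    show "next_pair q \<pi> p i \<in> PiM {0..<i} (\<lambda>_. borel) \<rightarrow>\<^sub>M subprob_algebra borel" for i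
      using measurable_prob_algebraD[OF *] by (simp add: histories_def)
    show "prob_space (next_pair q \<pi> p i x)" if "x \<in> space (PiM {0..<i} (\<lambda>_. borel))" for i x
      using measurable_space[OF *, of x i] that by (simp add: histories_def space_prob_algebra)
  qed
qed

text \<open>The term for \<open>n = 0\<close> is \<open>0 / 0\<close>, which does not affect the upper limit.\<close>

definition avg_cost ::
  "('x::topological_space \<Rightarrow> 'a::{countable,discrete_topology} set) \<Rightarrow> ('x \<times> 'a \<Rightarrow> ennreal)
    \<Rightarrow> ('x \<times> 'a \<Rightarrow> 'x measure) \<Rightarrow> ('x, 'a) policy \<Rightarrow> 'x measure \<Rightarrow> ennreal" where
  "avg_cost A c q \<pi> p =
     limsup (\<lambda>n. (\<integral>\<^sup>+\<omega>. (\<Sum>k<n. ext_cost A c (\<omega> k)) \<partial>process q \<pi> p) / of_nat n)"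

definition invariant_measure ::
  "('x::topological_space \<times> 'a \<Rightarrow> 'x measure) \<Rightarrow> ('x \<Rightarrow> 'a measure) \<Rightarrow> 'x measure \<Rightarrow> bool" where
  "invariant_measure q \<mu> p \<longleftrightarrow> p \<in> prob_measures \<and>
     (\<forall>B\<in>sets borel. emeasure p B = (\<integral>\<^sup>+x. \<integral>\<^sup>+a. emeasure (q (x, a)) B \<partial>\<mu> x \<partial>p))"

end

theory Submission
  imports Defs
begin

text \<open>
  Take nearly optimal policies and their occupation measures over the times \<open>1, \<dots>, n\<close>. By (SU) these
  are tight on state-action pairs, so a subsequence converges weakly. On \<open>O - D\<close> the majorization
  makes the measures uniformly countably additive, hence they converge setwise there; on \<open>D\<close> the data
  are semicontinuous. Splitting the integrals accordingly shows that the limit has cost at most the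
  infimum and that its state marginal is reproduced by \<open>q\<close>. Disintegrating the limit into its state
  marginal and a kernel gives the minimum pair.
\<close>

section \<open>Weak and setwise convergence\<close>

text \<open>One inequality carries both halves of the argument: for a nonnegative Borel function
  \<open>h\<close> that is lower semicontinuous on each \<open>D \<times> UNIV\<close>, the integral
  of \<open>h\<close> under the limit is at most the lower limit of its integrals along the
  sequence. With the cost as \<open>h\<close> it gives optimality. With bounded test functions that
  are continuous on these sets, and with their complements to a constant, it becomes convergence and
  gives invariance.

  Three obstacles shape the proof. Condition (M) bounds states only, while countable additivity is
  needed for state-action pairs; compact subsets of a discrete space are finite, so finitely many
  slices, each bounded by the majorizing measure, suffice. The types of states and actions carry no
  metric, so compactness is established in a Polish space containing a homeomorphic Borel copy of
  the pairs; the limit is carried by images of compact sets, hence by the copy, and can be pulled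
  back. Finally the graph of admissible pairs is only Borel and may lose mass in a weak limit; the
  value infinity of the extended cost outside it prevents this.\<close>

lemma abs_integral_le:
  fixes f g :: "'b \<Rightarrow> real"
  assumes "integrable M f" "integrable M g" "\<And>x. x \<in> space M \<Longrightarrow> \<bar>f x\<bar> \<le> g x"
  shows "\<bar>\<integral>x. f x \<partial>M\<bar> \<le> (\<integral>x. g x \<partial>M)"
  using assms by (intro order_trans[OF integral_abs_bound integral_mono]) auto

text \<open>Multiples of the distance to the complement, truncated at 1; \<open>U = UNIV\<close> is
  separate because \<open>infdist\<close> to the empty set is 0. Since the value 1 is attained and
  not only approached, the parts of \<open>U\<close> where \<open>f k\<close> is below 1 shrink to
  the empty set, which \<open>measure_open_tendsto\<close> exploits.\<close>

lemma open_indicator_approx: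
  fixes U :: "'w::metric_space set"
  assumes "open U"
  obtains f :: "nat \<Rightarrow> 'w \<Rightarrow> real" where
    "\<And>k. continuous_on UNIV (f k)" "\<And>k x. 0 \<le> f k x" "\<And>k x. f k x \<le> indicator U x"
    "\<And>x. incseq (\<lambda>k. f k x)" "\<And>x. x \<in> U \<Longrightarrow> \<exists>k. f k x = 1"
proof (cases "U = UNIV")
  case True
  show ?thesis
    by (rule that[of "\<lambda>_ _. 1"]) (auto simp: True mono_def)
next
  case False
  let ?f = "\<lambda>k x. min 1 (real k * infdist x (- U))"
  have 1: "?f k x = 0" if "x \<notin> U" for k x
    using that by simp
  have 2: "\<exists>k. ?f k x = 1" if "x \<in> U" for x
  proof -
    have "0 < infdist x (- U)"
      using that assms False infdist_pos_not_in_closed[of "- U" x] by auto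
    then obtain k where "1 < real k * infdist x (- U)"
      using reals_Archimedean3 by blast
    then show ?thesis by (intro exI[of _ k]) simp
  qed
  show ?thesis
  proof (rule that[of ?f])
    show "continuous_on UNIV (?f k)" for k
      by (intro continuous_intros)
    show "incseq (\<lambda>k. ?f k x)" for x
      by (intro monoI min.mono order_refl mult_right_mono) (auto simp: infdist_nonneg)
    show "?f k x \<le> indicator U x" for k x
      using 1[of x k] by (auto split: split_indicator)
  qed (use 2 in \<open>auto simp: infdist_nonneg\<close>)
qed

lemma incseq_eventually_1_tendsto:
  fixes f :: "nat \<Rightarrow> 'w \<Rightarrow> real"
  assumes "\<And>k. 0 \<le> f k x" "\<And>k. f k x \<le> indicator U x" "incseq (\<lambda>k. f k x)" "x \<in> U \<Longrightarrow> \<exists>k. f k x = 1"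
  shows "(\<lambda>k. f k x) \<longlonglongrightarrow> indicator U x"
proof (cases "x \<in> U")
  case True
  with assms(4) obtain k where k: "f k x = 1" by auto
  have "f n x = 1" if "n \<ge> k" for n
    using incseqD[OF assms(3) that] assms(2)[of n] True k by simp
  then show ?thesis
    using True by (intro tendsto_eventually eventually_sequentiallyI[of k]) auto
next
  case False
  then have "f k x = 0" for k
    using assms(1,2)[of k] by simp
  then show ?thesis using False by simp
qed

locale weak_limit =
  fixes M :: "nat \<Rightarrow> 'w::metric_space measure" and N :: "'w measure"
  assumes prob_M: "\<And>n. prob_space (M n)" and sets_M[measurable_cong]: "\<And>n. sets (M n) = sets borel"
    and prob_N: "prob_space N" and sets_N[measurable_cong]: "sets N = sets borel"
    and weak: "\<And>f :: 'w \<Rightarrow> real. continuous_on UNIV f \<Longrightarrow> bounded (range f) \<Longrightarrow>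
      (\<lambda>n. \<integral>x. f x \<partial>M n) \<longlonglongrightarrow> (\<integral>x. f x \<partial>N)"
begin

sublocale M: prob_space "M n" for n by (rule prob_M)
sublocale N: prob_space N by (rule prob_N)

lemma space_M[simp]: "space (M n) = UNIV" and space_N[simp]: "space N = UNIV"
  using sets_eq_imp_space_eq[OF sets_M[of n]] sets_eq_imp_space_eq[OF sets_N] by auto

lemma weak': "continuous_on UNIV f \<Longrightarrow> (\<And>x. \<bar>f x\<bar> \<le> B) \<Longrightarrow> (\<lambda>n. \<integral>x. f x \<partial>M n) \<longlonglongrightarrow> (\<integral>x. f x \<partial>N)"
  for f :: "'w \<Rightarrow> real"
  by (rule weak) (auto simp: bounded_iff)

lemma integrable_bounded:
  fixes f :: "'w \<Rightarrow> real"
  assumes "f \<in> borel_measurable borel" "\<And>x. \<bar>f x\<bar> \<le> B"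
  shows "integrable (M n) f" "integrable N f"
  using assms by (auto intro!: M.integrable_const_bound[where B = B] N.integrable_const_bound[where B = B])

text \<open>Open half of the portmanteau theorem: a continuous function below the indicator of
  \<open>U\<close> already has \<open>N\<close>-integral above \<open>c\<close>.\<close>

lemma eventually_less_measure_open:
  assumes "open U" "c < measure N U"
  shows "\<forall>\<^sub>F n in sequentially. c < measure (M n) U"
proof -
  obtain f :: "nat \<Rightarrow> 'w \<Rightarrow> real" where f: "\<And>k. continuous_on UNIV (f k)" "\<And>k x. 0 \<le> f k x"
    "\<And>k x. f k x \<le> indicator U x" "\<And>x. incseq (\<lambda>k. f k x)" "\<And>x. x \<in> U \<Longrightarrow> \<exists>k. f k x = 1"
    using open_indicator_approx[OF assms(1)] by metis
  have [measurable]: "f k \<in> borel_measurable borel" for k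
    using f(1) by (rule borel_measurable_continuous_onI)
  have [measurable]: "U \<in> sets borel" using assms(1) by simp
  have le1: "\<bar>f k x\<bar> \<le> 1" for k x
    using f(2)[of k x] f(3)[of k x] by (auto split: split_indicator_asm)
  have "(\<lambda>k. \<integral>x. f k x \<partial>N) \<longlonglongrightarrow> (\<integral>x. indicator U x \<partial>N)"
    by (rule integral_dominated_convergence[where w = "\<lambda>_. 1"])
      (use le1 in \<open>auto intro!: incseq_eventually_1_tendsto f\<close>)
  then have "\<forall>\<^sub>F k in sequentially. c < (\<integral>x. f k x \<partial>N)"
    using assms(2) by (intro order_tendstoD(1)) auto
  then obtain k where k: "c < (\<integral>x. f k x \<partial>N)"
    by (auto simp: eventually_sequentially)
  have "(\<integral>x. f k x \<partial>M n) \<le> measure (M n) U" for n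
  proof -
    have "(\<integral>x. f k x \<partial>M n) \<le> (\<integral>x. indicator U x \<partial>M n)"
      by (intro integral_mono integrable_bounded[where B = 1]) (use le1 f(3) in auto)
    then show ?thesis by simp
  qed
  with order_tendstoD(1)[OF weak'[OF f(1) le1] k] show ?thesis
    by (auto elim!: eventually_mono intro: less_le_trans)
qed

section \<open>From weak to setwise convergence inside an open set, by uniform countable
  additivity\<close>

context
  fixes G :: "'w set"
  assumes open_G: "open G"
    and uniformly_small: "\<And>E e. range E \<subseteq> sets borel \<Longrightarrow> decseq E \<Longrightarrow> (\<Inter>i. E i) = {} \<Longrightarrow> 0 < e \<Longrightarrow>
      \<exists>k::nat. \<forall>n. measure (M n) (G \<inter> E k) \<le> e"
begin

text \<open>The lower bound is the portmanteau theorem. For the upper bound, a continuous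
  \<open>f k\<close> differs from the indicator of \<open>G \<inter> E\<close> only on a set
  \<open>F k\<close> whose mass is small under all \<open>M n\<close> at once.\<close>

lemma measure_open_tendsto:
  assumes "open E"
  shows "(\<lambda>n. measure (M n) (G \<inter> E)) \<longlonglongrightarrow> measure N (G \<inter> E)"
proof (rule order_tendstoI)
  show "\<forall>\<^sub>F n in sequentially. c < measure (M n) (G \<inter> E)" if "c < measure N (G \<inter> E)" for c
    using open_G assms that by (intro eventually_less_measure_open) auto
next
  fix c assume c: "measure N (G \<inter> E) < c"
  let ?U = "G \<inter> E"
  have U: "open ?U" using open_G assms by auto
  obtain f :: "nat \<Rightarrow> 'w \<Rightarrow> real" where f: "\<And>k. continuous_on UNIV (f k)" "\<And>k x. 0 \<le> f k x"
    "\<And>k x. f k x \<le> indicator ?U x" "\<And>x. incseq (\<lambda>k. f k x)" "\<And>x. x \<in> ?U \<Longrightarrow> \<exists>k. f k x = 1"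
    using open_indicator_approx[OF U] by metis
  have [measurable]: "f k \<in> borel_measurable borel" for k
    using f(1) by (rule borel_measurable_continuous_onI)
  have [measurable]: "?U \<in> sets borel" "G \<in> sets borel" using U open_G by auto
  have le1: "\<bar>f k x\<bar> \<le> 1" for k x
    using f(2)[of k x] f(3)[of k x] by (auto split: split_indicator_asm)
  define F where "F k = {x\<in>?U. f k x < 1}" for k
  have [measurable]: "F k \<in> sets borel" for k
    unfolding F_def by measurable
  \<comment> \<open>Half of the gap absorbs the error in the weak limit, the other half the mass of
    \<open>F k\<close>.\<close>
  define e where "e = (c - measure N ?U) / 2"
  have "0 < e" using c by (simp add: e_def)
  moreover have "decseq F"
    unfolding F_def decseq_def using f(4) by (auto simp: incseq_def intro: le_less_trans)
  moreover have "(\<Inter>k. F k) = {}"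
    unfolding F_def using f(5) by (fastforce simp: less_le)
  moreover have "range F \<subseteq> sets borel" by auto
  ultimately obtain k where k: "\<And>n. measure (M n) (G \<inter> F k) \<le> e"
    using uniformly_small[of F e] by blast
  have "(\<integral>x. f k x \<partial>N) \<le> (\<integral>x. indicator ?U x \<partial>N)"
    by (intro integral_mono integrable_bounded[where B = 1]) (use le1 f(3) in auto)
  then have "(\<integral>x. f k x \<partial>N) < measure N ?U + e"
    using \<open>0 < e\<close> by simp
  from order_tendstoD(2)[OF weak'[OF f(1) le1] this]
  show "\<forall>\<^sub>F n in sequentially. measure (M n) ?U < c"
  proof eventually_elim
    case (elim n)
    have "measure (M n) ?U = (\<integral>x. indicator ?U x \<partial>M n)"
      by simp
    also have "\<dots> \<le> (\<integral>x. f k x + indicator (G \<inter> F k) x \<partial>M n)"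
    proof (intro integral_mono Bochner_Integration.integrable_add)
      show "indicator ?U x \<le> f k x + indicator (G \<inter> F k) x" for x
        using f(2)[of k x] f(3)[of k x] by (auto simp: F_def split: split_indicator)
    qed (use le1 in \<open>auto intro!: integrable_bounded[where B = 1]\<close>)
    also have "\<dots> = (\<integral>x. f k x \<partial>M n) + measure (M n) (G \<inter> F k)"
      by (subst Bochner_Integration.integral_add) (use le1 in \<open>auto intro!: integrable_bounded[where B = 1]\<close>)
    also have "\<dots> < c"
      using elim k[of n] by (simp add: e_def field_simps)
    finally show ?case .
  qed
qed

text \<open>The sets with this convergence form a Dynkin system containing the open sets.
  Complements are taken relative to \<open>G\<close>; closure under disjoint unions is where the
  uniformity in \<open>n\<close> is indispensable.\<close>

lemma measure_borel_tendsto: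
  assumes "E \<in> sets borel"
  shows "(\<lambda>n. measure (M n) (G \<inter> E)) \<longlonglongrightarrow> measure N (G \<inter> E)"
proof -
  have [measurable]: "G \<in> sets borel" using open_G by simp
  have "Int_stable {S::'w set. open S}" "{S::'w set. open S} \<subseteq> Pow UNIV" "E \<in> sigma_sets UNIV {S. open S}"
    using assms by (auto simp: Int_stable_def sets_borel)
  then show ?thesis
  proof (induct E rule: sigma_sets_induct_disjoint)
    case (basic A)
    then show ?case by (simp add: measure_open_tendsto)
  next
    case empty
    then show ?case by simp
  next
    case (compl A)
    then have [measurable]: "A \<in> sets borel" by (simp add: sets_borel)
    have *: "G \<inter> (UNIV - A) = G - (G \<inter> A)" by auto
    have "measure (M n) (G \<inter> (UNIV - A)) = measure (M n) (G \<inter> UNIV) - measure (M n) (G \<inter> A)"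
      "measure N (G \<inter> (UNIV - A)) = measure N (G \<inter> UNIV) - measure N (G \<inter> A)" for n
      unfolding * by (auto intro!: M.finite_measure_Diff N.finite_measure_Diff)
    then show ?case
      using tendsto_diff[OF measure_open_tendsto[OF open_UNIV] compl(2)] by simp
  next
    case (union A)
    then have A[measurable]: "A i \<in> sets borel" for i by (auto simp: sets_borel)
    \<comment> \<open>Tails of the union. By disjointness they decrease to the empty set, so
      \<open>uniformly_small\<close> applies to them.\<close>
    define F where "F k = (\<Union>i\<in>{k..}. A i)" for k
    have [measurable]: "F k \<in> sets borel" for k
      unfolding F_def by measurable
    have F: "decseq F" "(\<Inter>k. F k) = {}"
    proof -
      show "decseq F"
        unfolding decseq_def F_def by fastforce
      show "(\<Inter>k. F k) = {}"
      proof safe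
        fix x assume x: "x \<in> (\<Inter>k. F k)"
        then obtain i where i: "x \<in> A i" by (auto simp: F_def)
        from x have "x \<in> F (Suc i)" by auto
        then obtain j where "j > i" "x \<in> A j" by (auto simp: F_def Suc_le_eq)
        with i disjoint_family_onD[OF union(1), of i j] show "x \<in> {}" by auto
      qed
    qed
    have split: "measure Q (G \<inter> (\<Union>i. A i)) = (\<Sum>i<k. measure Q (G \<inter> A i)) + measure Q (G \<inter> F k)"
      if "finite_measure Q" and Q[measurable_cong]: "sets Q = sets borel" for Q k
    proof -
      interpret Q: finite_measure Q by fact
      have "(\<Union>i. A i) = (\<Union>i\<in>{..<k} \<union> {k..}. A i)"
        by (intro SUP_cong) auto
      then have "G \<inter> (\<Union>i. A i) = (\<Union>i<k. G \<inter> A i) \<union> (G \<inter> F k)"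
        unfolding F_def UN_Un by blast
      moreover have "A i \<inter> F k = {}" if "i < k" for i
      proof -
        have "A i \<inter> A j = {}" if "k \<le> j" for j
          using that \<open>i < k\<close> by (intro disjoint_family_onD[OF union(1)]) auto
        then show ?thesis unfolding F_def by blast
      qed
      then have "(\<Union>i<k. G \<inter> A i) \<inter> (G \<inter> F k) = {}"
        by blast
      ultimately have "measure Q (G \<inter> (\<Union>i. A i)) = measure Q (\<Union>i<k. G \<inter> A i) + measure Q (G \<inter> F k)"
        by (simp add: Q.finite_measure_Union)
      also have "measure Q (\<Union>i<k. G \<inter> A i) = (\<Sum>i<k. measure Q (G \<inter> A i))"
        using union(1) by (intro Q.finite_measure_finite_Union) (auto simp: disjoint_family_on_def)
      finally show ?thesis .
    qed
    show ?case
    proof (rule LIMSEQ_I)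
      \<comment> \<open>The error is shared out as \<open>e / 4\<close> for the tail under
        \<open>M n\<close>, \<open>e / 4\<close> for the tail under \<open>N\<close>, and
        \<open>e / 2\<close> for the finite sum of the first \<open>k\<close> sets.\<close>
      fix e :: real assume "0 < e"
      then obtain k1 where k1: "\<And>n. measure (M n) (G \<inter> F k1) \<le> e / 4"
        using uniformly_small[of F "e / 4"] F by (metis (mono_tags, lifting) \<open>\<And>k. F k \<in> sets borel\<close> divide_pos_pos image_subset_iff zero_less_numeral)
      have "decseq (\<lambda>k. G \<inter> F k)" "(\<Inter>k. G \<inter> F k) = {}"
        using F by (auto simp: decseq_def)
      then have "(\<lambda>k. measure N (G \<inter> F k)) \<longlonglongrightarrow> 0"
        using N.finite_Lim_measure_decseq[of "\<lambda>k. G \<inter> F k"] by (simp add: image_subset_iff)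
      from order_tendstoD(2)[OF this, of "e / 4"] \<open>0 < e\<close>
      obtain k2 where k2: "\<And>k. k \<ge> k2 \<Longrightarrow> measure N (G \<inter> F k) < e / 4"
        by (auto simp: eventually_sequentially)
      define k where "k = max k1 k2"
      have a: "measure (M n) (G \<inter> F k) \<le> e / 4" for n
      proof -
        have "measure (M n) (G \<inter> F k) \<le> measure (M n) (G \<inter> F k1)"
          using decseqD[OF F(1), of k1 k] by (intro M.finite_measure_mono) (auto simp: k_def)
        with k1[of n] show ?thesis by simp
      qed
      have b: "measure N (G \<inter> F k) < e / 4"
        using k2[of k] by (simp add: k_def)
      have "(\<lambda>n. \<Sum>i<k. measure (M n) (G \<inter> A i)) \<longlonglongrightarrow> (\<Sum>i<k. measure N (G \<inter> A i))"
        by (intro tendsto_sum union(3))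
      from LIMSEQ_D[OF this, of "e / 2"] \<open>0 < e\<close> obtain n0 where
        n0: "\<And>n. n \<ge> n0 \<Longrightarrow> norm ((\<Sum>i<k. measure (M n) (G \<inter> A i)) - (\<Sum>i<k. measure N (G \<inter> A i))) < e / 2"
        by auto
      show "\<exists>n0. \<forall>n\<ge>n0. norm (measure (M n) (G \<inter> (\<Union>i. A i)) - measure N (G \<inter> (\<Union>i. A i))) < e"
      proof (intro exI[of _ n0] allI impI)
        fix n assume "n \<ge> n0"
        from n0[OF this] a[of n] b measure_nonneg[of "M n" "G \<inter> F k"] measure_nonneg[of N "G \<inter> F k"]
        show "norm (measure (M n) (G \<inter> (\<Union>i. A i)) - measure N (G \<inter> (\<Union>i. A i))) < e"
          unfolding split[OF M.finite_measure_axioms sets_M, of n k] split[OF N.finite_measure_axioms sets_N, of k] real_norm_def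
          by linarith
      qed
    qed
  qed
qed

text \<open>Rounding \<open>u\<close> down to multiples of \<open>d\<close> gives a uniform
  approximation with finitely many level sets, as \<open>u\<close> is bounded; on the level sets
  setwise convergence applies.\<close>

lemma integral_tendsto:
  fixes u :: "'w \<Rightarrow> real"
  assumes u[measurable]: "u \<in> borel_measurable borel" and B: "\<And>x. \<bar>u x\<bar> \<le> B"
  shows "(\<lambda>n. \<integral>x. indicator G x * u x \<partial>M n) \<longlonglongrightarrow> (\<integral>x. indicator G x * u x \<partial>N)"
proof (rule LIMSEQ_I)
  fix e :: real assume e: "0 < e"
  have [measurable]: "G \<in> sets borel" using open_G by simp
  \<comment> \<open>Three errors of size at most \<open>d\<close> add up below: rounding under
    \<open>M n\<close>, rounding under \<open>N\<close>, and convergence of the finite sum.\<close>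
  define d where "d = e / 4"
  have d: "0 < d" using e by (simp add: d_def)
  define I where "I = {\<lfloor>- B / d\<rfloor>..\<lfloor>B / d\<rfloor>}"
  have I: "\<lfloor>u x / d\<rfloor> \<in> I" for x
    unfolding I_def atLeastAtMost_iff using B[of x] d by (intro conjI floor_mono divide_right_mono) auto
  define E where "E k = {x. \<lfloor>u x / d\<rfloor> = k}" for k
  have [measurable]: "E k \<in> sets borel" for k
    unfolding E_def by measurable
  define v where "v x = (\<Sum>k\<in>I. (d * of_int k) * indicator (G \<inter> E k) x)" for x
  have v: "v x = indicator G x * (d * of_int \<lfloor>u x / d\<rfloor>)" for x
  proof -
    have "v x = (\<Sum>k\<in>I. if \<lfloor>u x / d\<rfloor> = k then indicator G x * (d * of_int \<lfloor>u x / d\<rfloor>) else 0)"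
      unfolding v_def by (intro sum.cong refl) (auto simp: E_def split: split_indicator)
    also have "\<dots> = indicator G x * (d * of_int \<lfloor>u x / d\<rfloor>)"
      using I[of x] by (simp add: I_def)
    finally show ?thesis .
  qed
  have uv: "\<bar>indicator G x * u x - v x\<bar> \<le> d" for x
  proof -
    have "of_int \<lfloor>u x / d\<rfloor> \<le> u x / d" "u x / d < of_int \<lfloor>u x / d\<rfloor> + 1" by linarith+
    then have "of_int \<lfloor>u x / d\<rfloor> * d \<le> u x" "u x < (of_int \<lfloor>u x / d\<rfloor> + 1) * d"
      using d by (simp_all only: pos_le_divide_eq pos_divide_less_eq)
    then show ?thesis
      unfolding v using d by (auto simp: algebra_simps split: split_indicator)
  qed
  have close: "\<bar>(\<integral>x. indicator G x * u x \<partial>Q) - (\<Sum>k\<in>I. d * of_int k * measure Q (G \<inter> E k))\<bar> \<le> d"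
    if "prob_space Q" and Q[measurable_cong]: "sets Q = sets borel" for Q
  proof -
    interpret Q: prob_space Q by fact
    have i1: "integrable Q (\<lambda>x. indicator G x * u x)"
    proof (rule Q.integrable_const_bound[where B = B])
      show "AE x in Q. norm (indicator G x * u x) \<le> B"
        using B by (auto simp: abs_mult intro!: AE_I2 split: split_indicator intro: order_trans[OF abs_ge_zero B])
    qed simp
    have i2: "integrable Q v"
      unfolding v_def by (intro Bochner_Integration.integrable_sum integrable_mult_right) (auto simp: Q.emeasure_eq_measure)
    have "(\<integral>x. v x \<partial>Q) = (\<Sum>k\<in>I. d * of_int k * measure Q (G \<inter> E k))"
      unfolding v_def using sets_eq_imp_space_eq[OF Q]
      by (subst Bochner_Integration.integral_sum) (auto simp: Q.emeasure_eq_measure intro!: integrable_mult_right)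
    then have "(\<integral>x. indicator G x * u x \<partial>Q) - (\<Sum>k\<in>I. d * of_int k * measure Q (G \<inter> E k))
        = (\<integral>x. indicator G x * u x - v x \<partial>Q)"
      using i1 i2 by simp
    also have "norm \<dots> \<le> (\<integral>x. d \<partial>Q)"
      using i1 i2 uv unfolding real_norm_def by (intro abs_integral_le) auto
    finally show ?thesis by (simp add: Q.prob_space)
  qed
  have "(\<lambda>n. \<Sum>k\<in>I. d * of_int k * measure (M n) (G \<inter> E k)) \<longlonglongrightarrow> (\<Sum>k\<in>I. d * of_int k * measure N (G \<inter> E k))"
    by (intro tendsto_intros measure_borel_tendsto) auto
  from LIMSEQ_D[OF this d] obtain n0 where n0: "\<And>n. n \<ge> n0 \<Longrightarrow> norm ((\<Sum>k\<in>I. d * of_int k * measure (M n) (G \<inter> E k))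
      - (\<Sum>k\<in>I. d * of_int k * measure N (G \<inter> E k))) < d" by auto
  show "\<exists>n0. \<forall>n\<ge>n0. norm ((\<integral>x. indicator G x * u x \<partial>M n) - (\<integral>x. indicator G x * u x \<partial>N)) < e"
  proof (intro exI[of _ n0] allI impI)
    fix n assume "n \<ge> n0"
    from n0[OF this] close[OF prob_M sets_M, of n] close[OF prob_N sets_N]
    have "\<bar>(\<integral>x. indicator G x * u x \<partial>M n) - (\<integral>x. indicator G x * u x \<partial>N)\<bar> < 3 * d"
      unfolding real_norm_def by linarith
    then show "norm ((\<integral>x. indicator G x * u x \<partial>M n) - (\<integral>x. indicator G x * u x \<partial>N)) < e"
      using e by (simp add: d_def)
  qed
qed

end

end

section \<open>Weak compactness of tight sequences\<close>

text \<open>At the first index \<open>j\<close> where the memberships differ, the codes differ by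
  \<open>(1/3) ^ j\<close> up to the later terms, which sum to at most half of that. In base 2 the
  later terms could cancel the leading difference completely.\<close>

lemma ternary_code_digit:
  fixes b :: "nat \<Rightarrow> 'w set"
  defines "s \<equiv> \<lambda>x. \<Sum>i. indicator (b i) x * (1/3::real) ^ i"
  assumes close: "\<bar>s x - s y\<bar> < (1/3) ^ i / 2"
  shows "x \<in> b i \<longleftrightarrow> y \<in> b i"
proof (rule ccontr)
  let ?P = "\<lambda>j. \<not> (x \<in> b j \<longleftrightarrow> y \<in> b j)"
  assume i: "?P i"
  define j where "j = (LEAST j. ?P j)"
  have j: "?P j" and ji: "j \<le> i" using LeastI[of ?P i] Least_le[of ?P i] i by (simp_all add: j_def)
  have less_j: "x \<in> b k \<longleftrightarrow> y \<in> b k" if "k < j" for k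
    using not_less_Least[of k ?P] that unfolding j_def by blast
  define d :: "nat \<Rightarrow> real" where "d k = (indicator (b k) x - indicator (b k) y) * (1/3) ^ k" for k
  have geo: "summable (\<lambda>k. (1/3::real) ^ k)" by (rule summable_geometric) simp
  have sm: "summable (\<lambda>k. indicator (b k) z * (1/3::real) ^ k)" for z
    by (rule summable_comparison_test'[OF geo]) (auto split: split_indicator)
  have d_le: "\<bar>d k\<bar> \<le> (1/3) ^ k" for k
    by (auto simp: d_def split: split_indicator)
  have sd: "summable d"
    by (rule summable_comparison_test'[OF geo]) (use d_le in auto)
  have "s x - s y = suminf d"
    unfolding s_def d_def by (subst suminf_diff[OF sm sm]) (simp add: algebra_simps)
  also have "\<dots> = (\<Sum>k. d (k + Suc j)) + (\<Sum>k<Suc j. d k)"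
    by (rule suminf_split_initial_segment[OF sd])
  also have "(\<Sum>k<Suc j. d k) = d j"
    using less_j by (simp add: d_def indicator_def)
  finally have eq: "s x - s y = (\<Sum>k. d (k + Suc j)) + d j" .
  have "\<bar>\<Sum>k. d (k + Suc j)\<bar> \<le> (\<Sum>k. (1/3) ^ (k + Suc j))"
  proof -
    have geo': "summable (\<lambda>k. (1/3::real) ^ (k + Suc j))"
      using geo summable_iff_shift[of "\<lambda>k. (1/3::real) ^ k" "Suc j"] by simp
    have abs: "summable (\<lambda>k. \<bar>d (k + Suc j)\<bar>)"
      by (rule summable_comparison_test'[OF geo']) (use d_le[of "_ + Suc j"] in auto)
    show ?thesis
      using summable_rabs[OF abs] suminf_le[OF d_le[of "_ + Suc j"] abs geo'] by linarith
  qed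
  also have "\<dots> = (1/3) ^ Suc j * (\<Sum>k. (1/3::real) ^ k)"
    by (subst suminf_mult[OF geo, symmetric]) (simp add: power_add mult_ac)
  also have "\<dots> = (1/3) ^ j / 2"
    by (simp add: suminf_geometric)
  finally have "\<bar>\<Sum>k. d (k + Suc j)\<bar> \<le> (1/3) ^ j / 2" .
  moreover have "\<bar>d j\<bar> = (1/3) ^ j"
    using j by (auto simp: d_def split: split_indicator)
  ultimately have "(1/3) ^ j / 2 \<le> \<bar>s x - s y\<bar>"
    unfolding eq by linarith
  moreover have "(1/3::real) ^ i \<le> (1/3) ^ j"
    using ji by (intro power_decreasing) auto
  ultimately show False using close by simp
qed

text \<open>
  Coding points by the basic open sets containing them gives an injective Borel map into the reals
  whose inverse is uniformly continuous on the image of each compact set. Prokhorov's theorem thus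
  reduces to Helly's selection theorem.
\<close>

lemma real_code:
  obtains s :: "'w::{metric_space,second_countable_topology} \<Rightarrow> real" where
    "s \<in> borel_measurable borel" "\<And>x. 0 \<le> s x" "\<And>x. s x < 2" "inj s"
    "\<And>K. compact K \<Longrightarrow> uniformly_continuous_on (s ` K) (inv s)"
proof -
  obtain \<B> :: "'w set set" where \<B>: "countable \<B>" "topological_basis \<B>"
    using ex_countable_basis by auto
  have "\<B> \<noteq> {}"
    using topological_basisE[OF \<B>(2) open_UNIV UNIV_I] by blast
  define b where "b = from_nat_into \<B>"
  have b: "range b = \<B>"
    unfolding b_def using \<B>(1) \<open>\<B> \<noteq> {}\<close> by simp
  have open_b: "open (b i)" for i
    using b \<B>(2) topological_basis_open by blast
  have [measurable]: "b i \<in> sets borel" for i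
    using open_b by simp
  have basis: "\<exists>i. x \<in> b i \<and> b i \<subseteq> U" if "open U" "x \<in> U" for x U
    using topological_basisE[OF \<B>(2) that] b by (metis imageE)
  define s where "s = (\<lambda>x. \<Sum>i. indicator (b i) x * (1/3::real) ^ i)"
  have geo: "summable (\<lambda>k. (1/3::real) ^ k)" by (rule summable_geometric) simp
  have sm: "summable (\<lambda>k. indicator (b k) z * (1/3::real) ^ k)" for z
    by (rule summable_comparison_test'[OF geo]) (auto split: split_indicator)
  have digit: "x \<in> b i \<longleftrightarrow> y \<in> b i" if "\<bar>s x - s y\<bar> < (1/3) ^ i / 2" for x y i
    using that unfolding s_def by (rule ternary_code_digit)
  show thesis
  proof (rule that)
    show "s \<in> borel_measurable borel"
      unfolding s_def by measurable
    show "0 \<le> s x" for x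
      unfolding s_def by (intro suminf_nonneg sm) auto
    show "s x < 2" for x
    proof -
      have "s x \<le> (\<Sum>k. (1/3) ^ k)"
        unfolding s_def by (intro suminf_le sm geo) (auto split: split_indicator)
      then show ?thesis by (simp add: suminf_geometric)
    qed
    show inj: "inj s"
    proof (rule injI)
      fix x y assume "s x = s y"
      then have "x \<in> b i \<longleftrightarrow> y \<in> b i" for i
        using digit[of x y i] by simp
      then show "x = y"
        using basis by (metis hausdorff disjoint_iff subsetD)
    qed
    show "uniformly_continuous_on (s ` K) (inv s)" if K: "compact K" for K
      unfolding uniformly_continuous_on_def
    proof (intro allI impI)
      fix e :: real assume "0 < e"
      \<comment> \<open>Finitely many small basic sets cover \<open>K\<close>. If \<open>n\<close>
        is the largest of their indices, codes closer than \<open>(1/3) ^ n / 2\<close> agree on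
        membership in each of these sets, so the two points lie in a common one.\<close>
      then have "\<forall>a. \<exists>i. a \<in> b i \<and> b i \<subseteq> ball a (e / 2)"
        by (intro allI basis) auto
      then obtain i where i: "\<And>a. a \<in> b (i a)" "\<And>a. b (i a) \<subseteq> ball a (e / 2)"
        by metis
      obtain F where F: "F \<subseteq> K" "finite F" "K \<subseteq> (\<Union>a\<in>F. b (i a))"
        using compactE_image[OF K, of K "\<lambda>a. b (i a)"] open_b i(1) by blast
      define n where "n = Max (insert 0 (i ` F))"
      have n: "i a \<le> n" if "a \<in> F" for a
        using that F(2) by (simp add: n_def)
      show "\<exists>d>0. \<forall>x\<in>s ` K. \<forall>x'\<in>s ` K. dist x' x < d \<longrightarrow> dist (inv s x') (inv s x) < e"
      proof (intro exI[of _ "(1/3) ^ n / 2"] conjI ballI impI)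
        fix t t' assume t: "t \<in> s ` K" "t' \<in> s ` K" "dist t' t < (1/3) ^ n / 2"
        then obtain x y where xy: "t = s x" "t' = s y" "x \<in> K" "y \<in> K" by auto
        then obtain a where a: "a \<in> F" "x \<in> b (i a)" using F(3) by auto
        have "(1/3::real) ^ n \<le> (1/3) ^ i a"
          using n[OF a(1)] by (intro power_decreasing) auto
        with t(3) xy have "\<bar>s x - s y\<bar> < (1/3) ^ i a / 2"
          unfolding dist_real_def by (simp only: abs_minus_commute[of "s y"])
        with digit[OF this] a(2) have "y \<in> b (i a)" by simp
        with a(2) i(2)[of a] have "dist a x < e / 2" "dist a y < e / 2" by (auto simp: subset_iff)
        then have "dist y x < e"
          using dist_triangle2[of y x a] dist_commute[of a] by (metis dist_triangle_half_r dist_commute)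
        then show "dist (inv s t') (inv s t) < e"
          by (simp add: xy inv_f_f[OF inj])
      qed simp
    qed
  qed
qed

text \<open>The danger is that the limit \<open>Q\<close> of the code distributions charges numbers
  that code no point. Tightness excludes it: \<open>Q\<close> has nearly all its mass on the
  closures \<open>C m\<close> of the coded compact sets, and the decoder extends continuously to
  \<open>C m\<close> with values still in \<open>K m\<close>.\<close>

lemma tight_convergent_subsequence:
  fixes M :: "nat \<Rightarrow> 'w::{complete_space,second_countable_topology} measure"
  assumes prob: "\<And>n. prob_space (M n)" and sets[measurable_cong]: "\<And>n. sets (M n) = sets borel"
    and K: "incseq K" "\<And>m. compact (K m)"
    and tight: "\<And>e. 0 < e \<Longrightarrow> \<exists>m. \<forall>n. 1 - e \<le> measure (M n) (K m)"
  obtains r N where "strict_mono r" "weak_limit (M \<circ> r) N" "measure N (\<Union>m. K m) = 1"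
proof -
  obtain s :: "'w \<Rightarrow> real" where s[measurable]: "s \<in> borel_measurable borel"
    and s_bnd: "\<And>x. 0 \<le> s x" "\<And>x. s x < 2" and inj: "inj s"
    and uc: "\<And>K. compact K \<Longrightarrow> uniformly_continuous_on (s ` K) (inv s)"
    using real_code by metis
  interpret M: prob_space "M n" for n by (rule prob)
  have [simp]: "space (M n) = UNIV" for n
    using sets_eq_imp_space_eq[OF sets[of n]] by simp
  have K_closed: "closed (K m)" for m
    using K(2) by (rule compact_imp_closed)
  then have [measurable]: "K m \<in> sets borel" for m by simp
  define C where "C m = closure (s ` K m)" for m
  have C_closed: "closed (C m)" for m by (simp add: C_def)
  then have [measurable]: "C m \<in> sets borel" for m by simp
  have C_mono: "C m \<subseteq> C n" if "m \<le> n" for m n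
    unfolding C_def using incseqD[OF K(1) that] by (intro closure_mono image_mono)
  have sK: "s x \<in> C m" if "x \<in> K m" for x m
    unfolding C_def using that by (intro subsetD[OF closure_subset] imageI)
  \<comment> \<open>\<open>P m g\<close> says that \<open>g\<close> is the continuous extension of
    the decoder to \<open>C m\<close>. Its uniqueness is recorded because it makes the extensions
    for different \<open>m\<close> agree.\<close>
  define P where "P m g \<longleftrightarrow> continuous_on (C m) g \<and> (\<forall>x\<in>s ` K m. inv s x = g x) \<and>
      (\<forall>h. continuous_on (C m) h \<longrightarrow> (\<forall>x\<in>s ` K m. inv s x = h x) \<longrightarrow> (\<forall>x\<in>C m. h x = g x))" for m g
  have "\<exists>g. P m g" for m
  proof (rule uniformly_continuous_on_extension_on_closure[OF uc[OF K(2)[of m]]])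
    fix g assume g: "uniformly_continuous_on (closure (s ` K m)) g" "\<And>x. x \<in> s ` K m \<Longrightarrow> inv s x = g x"
      "\<And>Y h x. s ` K m \<subseteq> Y \<Longrightarrow> Y \<subseteq> closure (s ` K m) \<Longrightarrow> continuous_on Y h \<Longrightarrow>
        (\<And>x. x \<in> s ` K m \<Longrightarrow> inv s x = h x) \<Longrightarrow> x \<in> Y \<Longrightarrow> h x = g x"
    have "P m g"
      unfolding P_def C_def
    proof (intro conjI ballI allI impI)
      show "continuous_on (closure (s ` K m)) g"
        by (rule uniformly_continuous_imp_continuous[OF g(1)])
    next
      fix h x assume h: "continuous_on (closure (s ` K m)) h" "\<forall>x\<in>s ` K m. inv s x = h x" "x \<in> closure (s ` K m)"
      show "h x = g x"
        using h(2) by (intro g(3)[OF closure_subset order_refl h(1) _ h(3)]) auto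
    qed (rule g(2))
    then show ?thesis by (rule exI[of _ g])
  qed
  then obtain g where g: "\<And>m. P m (g m)" by metis
  have g_cont: "continuous_on (C m) (g m)" for m
    using g[of m] unfolding P_def by blast
  have g_s: "inv s x = g m x" if "x \<in> s ` K m" for m x
    using g[of m] that unfolding P_def by blast
  have g_uniq: "h x = g m x" if "continuous_on (C m) h" "\<And>x. x \<in> s ` K m \<Longrightarrow> inv s x = h x" "x \<in> C m" for m h x
    using g[of m] that unfolding P_def by blast
  have g_eq: "g n x = g m x" if "m \<le> n" "x \<in> C m" for m n x
  proof (rule g_uniq)
    show "inv s x = g n x" if "x \<in> s ` K m" for x
      using incseqD[OF K(1) \<open>m \<le> n\<close>] that by (intro g_s) auto
  qed (use that continuous_on_subset[OF g_cont[of n] C_mono] in auto)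
  have g_K: "g m ` C m \<subseteq> K m" for m
    unfolding C_def
  proof (rule image_closure_subset)
    show "g m ` s ` K m \<subseteq> K m"
    proof safe
      fix x assume "x \<in> K m"
      then show "g m (s x) \<in> K m"
        using g_s[of "s x" m] inv_f_f[OF inj, of x] by auto
    qed
  qed (use g_cont K_closed in \<open>auto simp: C_def\<close>)
  \<comment> \<open>The extensions glued together; by \<open>g_eq\<close> the choice of
    \<open>m\<close> is immaterial. By \<open>Q_C\<close> and tightness, \<open>Q\<close> gives no
    mass to the set where the value is \<open>undefined\<close>.\<close>
  define \<psi> where "\<psi> t = (if \<exists>m. t \<in> C m then g (LEAST m. t \<in> C m) t else undefined)" for t
  have \<psi>_eq: "\<psi> t = g m t" if "t \<in> C m" for t m
    using g_eq[of "LEAST m. t \<in> C m" m t] LeastI[of "\<lambda>m. t \<in> C m", OF that] Least_le[of "\<lambda>m. t \<in> C m", OF that] that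
    by (auto simp: \<psi>_def)
  have \<psi>_s: "\<psi> (s x) = x" if "x \<in> K m" for x m
    using \<psi>_eq[OF sK[OF that]] g_s[of "s x" m] that by (simp add: inv_f_f[OF inj])
  have [measurable]: "\<psi> \<in> borel_measurable borel"
  proof (rule measurable_piecewise_restrict)
    show "countable (insert (- (\<Union>m. C m)) (range C))" by simp
    show "\<psi> \<in> restrict_space borel \<Omega> \<rightarrow>\<^sub>M borel" if "\<Omega> \<in> insert (- (\<Union>m. C m)) (range C)" for \<Omega>
    proof -
      consider m where "\<Omega> = C m" | "\<Omega> = - (\<Union>m. C m)"
        using \<open>\<Omega> \<in> insert (- (\<Union>m. C m)) (range C)\<close> by blast
      then show ?thesis
      proof cases
        case 1
        show ?thesis
          unfolding 1
          by (rule measurable_cong[THEN iffD1, OF _ borel_measurable_continuous_on_restrict[OF g_cont[of m]]])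
            (simp add: space_restrict_space \<psi>_eq)
      next
        case 2
        show ?thesis
          unfolding 2
          by (rule measurable_cong[THEN iffD1, OF _ measurable_const[of undefined]])
            (auto simp: space_restrict_space \<psi>_def)
      qed
    qed
  qed auto
  define \<mu> where "\<mu> n = distr (M n) borel s" for n
  have \<mu>_prob: "prob_space (\<mu> n)" for n
    unfolding \<mu>_def by (intro M.prob_space_distr) simp
  have \<mu>_sets[measurable_cong]: "sets (\<mu> n) = sets borel" for n
    by (simp add: \<mu>_def)
  have rd: "real_distribution (\<mu> n)" for n
    unfolding \<mu>_def by (intro M.real_distribution_distr) simp
  \<comment> \<open>Codes lie in a bounded interval, so tightness on the line is automatic.
    Tightness of \<open>M\<close> enters only when the limit is carried back.\<close>
  have "tight \<mu>"
    unfolding tight_def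
  proof (intro conjI allI impI rd exI)
    fix \<epsilon> :: real assume "0 < \<epsilon>"
    show "(-1::real) < 2" by simp
    fix n
    have "s -` {- 1<..2} = UNIV"
    proof -
      have "- 1 < s x \<and> s x \<le> 2" for x
        using s_bnd(1)[of x] s_bnd(2)[of x] by linarith
      then show ?thesis by auto
    qed
    then have "measure (\<mu> n) {-1<..2} = 1"
      using M.prob_space[of n] by (simp add: \<mu>_def measure_distr)
    with \<open>0 < \<epsilon>\<close> show "1 - \<epsilon> < measure (\<mu> n) {-1<..2}" by simp
  qed
  from tight_imp_convergent_subsubsequence[OF this strict_mono_id]
  obtain r Q where r: "strict_mono r" and Q: "real_distribution Q" and conv: "weak_conv_m (\<mu> \<circ> id \<circ> r) Q"
    by auto
  interpret Q: real_distribution Q by (rule Q)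
  interpret \<mu>: weak_limit "\<mu> \<circ> r" Q
  proof (rule weak_limit.intro)
    fix f :: "real \<Rightarrow> real" assume f: "continuous_on UNIV f" "bounded (range f)"
    then obtain B where B: "\<And>x. norm (f x) \<le> B" by (auto simp: bounded_iff)
    show "(\<lambda>n. \<integral>x. f x \<partial>(\<mu> \<circ> r) n) \<longlonglongrightarrow> (\<integral>x. f x \<partial>Q)"
    proof (rule weak_conv_imp_integral_bdd_continuous_conv[OF _ Q])
      show "isCont f x" for x
        using f(1) by (simp add: continuous_on_eq_continuous_at)
      show "norm (f x) \<le> B" for x by (rule B)
      show "weak_conv_m (\<mu> \<circ> r) Q" using conv by simp
      show "real_distribution ((\<mu> \<circ> r) n)" for n using rd by simp
    qed
  qed (simp_all only: comp_def \<mu>_prob \<mu>_sets Q.prob_space_axioms Q.events_eq_borel)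
  have \<mu>_C: "measure (M n) (K m) \<le> measure (\<mu> n) (C m)" for n m
  proof -
    have "measure (M n) (K m) \<le> measure (M n) (s -` C m \<inter> space (M n))"
    proof (rule M.finite_measure_mono)
      show "s -` C m \<inter> space (M n) \<in> sets (M n)" by measurable
    qed (use sK in auto)
    then show ?thesis by (simp add: \<mu>_def measure_distr)
  qed
  \<comment> \<open>Portmanteau for the open complement of \<open>C m\<close>: if \<open>Q\<close>
    gave it more than \<open>e\<close>, so would some \<open>\<mu> (r n)\<close>, although
    \<open>s\<close> maps \<open>K m\<close> into \<open>C m\<close>.\<close>
  have Q_C: "1 - e \<le> measure Q (C m)" if "\<And>n. 1 - e \<le> measure (M n) (K m)" for e m
  proof (rule ccontr)
    assume "\<not> 1 - e \<le> measure Q (C m)"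
    then have "e < measure Q (- C m)"
      using Q.prob_compl[of "C m"] by (simp add: Compl_eq_Diff_UNIV)
    from \<mu>.eventually_less_measure_open[OF _ this] C_closed[of m]
    obtain n where "e < measure (\<mu> (r n)) (- C m)"
      by (auto simp: eventually_sequentially open_Compl)
    then show False
      using \<mu>.M.prob_compl[of "C m" n] \<mu>_C[of "r n" m] that[of "r n"]
        sets_eq_imp_space_eq[OF \<mu>_sets[of "r n"]] by (simp add: Compl_eq_Diff_UNIV)
  qed
  define N where "N = distr Q borel \<psi>"
  have N_prob: "prob_space N" unfolding N_def by (intro Q.prob_space_distr) simp
  interpret N: prob_space N by (rule N_prob)
  have N_sets[measurable_cong]: "sets N = sets borel" by (simp add: N_def)
  have N_K: "measure Q (C m) \<le> measure N (K m)" for m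
  proof -
    have "measure Q (C m) \<le> measure Q (\<psi> -` K m \<inter> space Q)"
    proof (rule Q.finite_measure_mono)
      show "\<psi> -` K m \<inter> space Q \<in> sets Q" by measurable
    qed (use g_K[of m] \<psi>_eq[of _ m] in auto)
    then show ?thesis by (simp add: N_def measure_distr)
  qed
  show thesis
  proof (rule that[OF r])
    show "weak_limit (M \<circ> r) N"
    proof (rule weak_limit.intro)
      fix f :: "'w \<Rightarrow> real" assume f: "continuous_on UNIV f" "bounded (range f)"
      have [measurable]: "f \<in> borel_measurable borel"
        using f(1) by (rule borel_measurable_continuous_onI)
      obtain B0 where B0: "\<And>x. \<bar>f x\<bar> \<le> B0" using f(2) by (auto simp: bounded_iff)
      define B where "B = max 1 B0"
      have B: "\<bar>f x\<bar> \<le> B" "0 < B" for x using B0[of x] by (auto simp: B_def)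
      show "(\<lambda>n. \<integral>x. f x \<partial>(M \<circ> r) n) \<longlonglongrightarrow> (\<integral>x. f x \<partial>N)"
      proof (rule LIMSEQ_I)
        fix e :: real assume "0 < e"
        \<comment> \<open>Replacing \<open>f\<close> by \<open>F\<close> changes a function bounded
          by \<open>B\<close> on a set of mass at most \<open>d\<close>, which costs
          \<open>2 * B * d = e / 4\<close>. This happens once under \<open>M\<close> and once under
          \<open>N\<close>; the other \<open>e / 2\<close> is for the limit on the line.\<close>
        define d where "d = e / (8 * B)"
        have d: "0 < d" using \<open>0 < e\<close> B(2) by (simp add: d_def)
        then obtain m where m: "\<And>n. 1 - d \<le> measure (M n) (K m)" using tight by metis
        \<comment> \<open>The decoded test function is continuous only on \<open>C m\<close>;
          Tietze's theorem makes of it a bounded continuous function on the whole line, to which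
          convergence to \<open>Q\<close> applies.\<close>
        have "continuous_on (C m) (\<lambda>t. f (g m t))"
          by (rule continuous_on_compose2[OF f(1) g_cont]) auto
        then obtain F :: "real \<Rightarrow> real" where F: "continuous_on UNIV F" "\<And>t. t \<in> C m \<Longrightarrow> F t = f (g m t)" "\<And>t. norm (F t) \<le> B"
          using Tietze[of "C m" "\<lambda>t. f (g m t)" UNIV B] C_closed[of m] B by (auto simp: less_imp_le)
        have [measurable]: "F \<in> borel_measurable borel"
          using F(1) by (rule borel_measurable_continuous_onI)
        have Fs: "F (s x) = f x" if "x \<in> K m" for x
          using F(2)[OF sK[OF that]] \<psi>_s[OF that] \<psi>_eq[OF sK[OF that]] by simp
        have near: "\<bar>(\<integral>x. u x \<partial>P) - (\<integral>x. v x \<partial>P)\<bar> \<le> 2 * B * d"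
          if "prob_space P" and [measurable]: "u \<in> borel_measurable P" "v \<in> borel_measurable P" "S \<in> sets P"
            and "\<And>x. x \<in> S \<Longrightarrow> u x = v x" "\<And>x. \<bar>u x\<bar> \<le> B" "\<And>x. \<bar>v x\<bar> \<le> B" "1 - d \<le> measure P S"
          for P :: "'z measure" and u v :: "'z \<Rightarrow> real" and S
        proof -
          interpret P: prob_space P by fact
          have i: "integrable P u" "integrable P v"
            using that by (auto intro!: P.integrable_const_bound[where B = B])
          have "\<bar>\<integral>x. u x - v x \<partial>P\<bar> \<le> (\<integral>x. 2 * B * indicator (space P - S) x \<partial>P)"
          proof (rule abs_integral_le)
            show "\<bar>u x - v x\<bar> \<le> 2 * B * indicator (space P - S) x" if "x \<in> space P" for x
              using \<open>x \<in> S \<Longrightarrow> u x = v x\<close> \<open>\<bar>u x\<bar> \<le> B\<close> \<open>\<bar>v x\<bar> \<le> B\<close> that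
              by (auto split: split_indicator)
          qed (use i in \<open>auto simp: P.emeasure_eq_measure\<close>)
          also have "\<dots> = 2 * B * measure P (space P - S)" by simp
          also have "\<dots> \<le> 2 * B * d"
            using that(8) B(2) by (intro mult_left_mono) (auto simp: P.prob_compl)
          finally show ?thesis using i by simp
        qed
        have a: "\<bar>(\<integral>x. f x \<partial>M n) - (\<integral>t. F t \<partial>\<mu> n)\<bar> \<le> 2 * B * d" for n
          unfolding \<mu>_def using near[OF prob[of n], of f "\<lambda>x. F (s x)" "K m"] Fs B(1) F(3) m
          by (simp add: integral_distr)
        have b: "\<bar>(\<integral>x. f x \<partial>N) - (\<integral>t. F t \<partial>Q)\<bar> \<le> 2 * B * d"
          unfolding N_def using near[OF Q.prob_space_axioms, of "\<lambda>t. f (\<psi> t)" F "C m"] F(2,3) B(1) Q_C[OF m]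
          by (simp add: integral_distr \<psi>_eq)
        have "(\<lambda>n. \<integral>t. F t \<partial>\<mu> (r n)) \<longlonglongrightarrow> (\<integral>t. F t \<partial>Q)"
          using \<mu>.weak'[OF F(1), of B] F(3) by simp
        from LIMSEQ_D[OF this, of "e / 2"] \<open>0 < e\<close>
        obtain n0 where n0: "\<And>n. n \<ge> n0 \<Longrightarrow> \<bar>(\<integral>t. F t \<partial>\<mu> (r n)) - (\<integral>t. F t \<partial>Q)\<bar> < e / 2"
          by auto
        have dB: "2 * B * d = e / 4" using B(2) by (simp add: d_def)
        show "\<exists>n0. \<forall>n\<ge>n0. norm ((\<integral>x. f x \<partial>(M \<circ> r) n) - (\<integral>x. f x \<partial>N)) < e"
        proof (intro exI[of _ n0] allI impI)
          fix n assume "n \<ge> n0"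
          from n0[OF this] a[of "r n"] b show "norm ((\<integral>x. f x \<partial>(M \<circ> r) n) - (\<integral>x. f x \<partial>N)) < e"
            unfolding dB real_norm_def comp_def by linarith
        qed
      qed
    qed (use prob sets N_prob N_sets in auto)
    have "1 \<le> measure N (\<Union>m. K m)"
    proof (rule field_le_epsilon)
      fix e :: real assume "0 < e"
      then obtain m where m: "\<And>n. 1 - e \<le> measure (M n) (K m)" using tight by metis
      have "measure N (K m) \<le> measure N (\<Union>m. K m)"
        by (intro N.finite_measure_mono) auto
      then show "1 \<le> measure N (\<Union>m. K m) + e"
        using Q_C[OF m] N_K[of m] by linarith
    qed
    then show "measure N (\<Union>m. K m) = 1"
      using N.prob_le_1[of "\<Union>m. K m"] by linarith
  qed
qed

section \<open>Lower semicontinuous integrands\<close>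

text \<open>Lipschitz regularization: \<open>F i z\<close> is the infimum of
  \<open>g w + real i * dist z w\<close>. Taking it over \<open>w\<close> in \<open>E\<close> only
  suits a \<open>g\<close> that is semicontinuous merely along \<open>E\<close>, and still yields a
  function continuous everywhere; the cap at \<open>B\<close> bounds it away from
  \<open>E\<close>.\<close>

lemma lsc_approx:
  fixes g :: "'w::metric_space \<Rightarrow> real"
  assumes g: "\<And>w. 0 \<le> g w" "\<And>w. g w \<le> B"
    and lsc: "\<And>z c. z \<in> E \<Longrightarrow> c < g z \<Longrightarrow> \<exists>d>0. \<forall>w\<in>E. dist z w < d \<longrightarrow> c < g w"
  obtains H :: "nat \<Rightarrow> 'w \<Rightarrow> real" where
    "\<And>i. continuous_on UNIV (H i)" "\<And>i z. 0 \<le> H i z" "\<And>i z. H i z \<le> B" "\<And>z. incseq (\<lambda>i. H i z)"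
    "\<And>z. z \<in> E \<Longrightarrow> (\<lambda>i. H i z) \<longlonglongrightarrow> g z"
proof (cases "E = {}")
  case True
  then show ?thesis
    using g order_trans[OF g(1) g(2)] by (intro that[of "\<lambda>_ _. 0"]) (auto simp: incseq_def)
next
  case False
  define F where "F i z = (INF w\<in>E. g w + real i * dist z w)" for i z
  have bdd: "bdd_below ((\<lambda>w. g w + real i * dist z w) ` E)" for i z
    by (rule bdd_belowI2[of _ 0]) (use g(1) in auto)
  have F_le: "F i z \<le> g w + real i * dist z w" if "w \<in> E" for i z w
    unfolding F_def by (rule cINF_lower[OF bdd that])
  have F_ge: "c \<le> F i z" if "\<And>w. w \<in> E \<Longrightarrow> c \<le> g w + real i * dist z w" for c i z
    unfolding F_def using False that by (rule cINF_greatest)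
  have F_nonneg: "0 \<le> F i z" for i z
    by (rule F_ge) (use g(1) in auto)
  have F_lip: "F i z \<le> F i z' + real i * dist z z'" for i z z'
  proof -
    have "F i z - real i * dist z z' \<le> F i z'"
    proof (rule F_ge)
      fix w assume w: "w \<in> E"
      have "real i * dist z w \<le> real i * (dist z z' + dist z' w)"
        by (intro mult_left_mono dist_triangle) auto
      with F_le[OF w, of i z] show "F i z - real i * dist z z' \<le> g w + real i * dist z' w"
        by (simp add: algebra_simps)
    qed
    then show ?thesis by simp
  qed
  have F_cont: "continuous_on UNIV (F i)" for i
  proof -
    have "(real i)-lipschitz_on UNIV (F i)"
    proof (rule lipschitz_onI)
      fix z z' show "dist (F i z) (F i z') \<le> real i * dist z z'"
        using F_lip[of i z z'] F_lip[of i z' z] by (auto simp: dist_real_def dist_commute abs_le_iff)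
    qed simp
    then show ?thesis by (rule lipschitz_on_continuous_on)
  qed
  have F_mono: "F i z \<le> F j z" if "i \<le> j" for i j z
  proof (rule F_ge)
    fix w assume w: "w \<in> E"
    have "real i * dist z w \<le> real j * dist z w"
      using that by (intro mult_right_mono) auto
    with F_le[OF w, of i z] show "F i z \<le> g w + real j * dist z w" by simp
  qed
  have B: "0 \<le> B" using g order_trans[OF g(1) g(2)] by blast
  show ?thesis
  proof (rule that[of "\<lambda>i z. min B (F i z)"])
    show "incseq (\<lambda>i. min B (F i z))" for z
      using F_mono by (auto intro!: monoI min.mono)
    show "continuous_on UNIV (\<lambda>z. min B (F i z))" for i
      by (intro continuous_intros F_cont)
    show "(\<lambda>i. min B (F i z)) \<longlonglongrightarrow> g z" if z: "z \<in> E" for z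
    proof (rule order_tendstoI)
      fix c assume c: "c < g z"
      define c' where "c' = (c + g z) / 2"
      have c': "c < c'" "c' < g z" using c by (auto simp: c'_def)
      obtain d where d: "d > 0" "\<And>w. w \<in> E \<Longrightarrow> dist z w < d \<Longrightarrow> c' < g w"
        using lsc[OF z c'(2)] by auto
      obtain n where n: "B < real n * d" using reals_Archimedean3[OF d(1)] by blast
      have "c < min B (F i z)" if i: "n \<le> i" for i
      proof -
        have "c' \<le> F i z"
        proof (rule F_ge)
          fix w assume w: "w \<in> E"
          show "c' \<le> g w + real i * dist z w"
          proof (cases "dist z w < d")
            case True
            have "c' < g w" using d(2)[OF w True] .
            moreover have "0 \<le> real i * dist z w" by simp
            ultimately show ?thesis by linarith
          next
            case False
            have "real n * d \<le> real i * dist z w" using i False d(1) by (intro mult_mono) auto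
            then show ?thesis using n g(1)[of w] g(2)[of z] c' by linarith
          qed
        qed
        then show ?thesis using c' g(2)[of z] by auto
      qed
      then show "\<forall>\<^sub>F i in sequentially. c < min B (F i z)"
        by (auto simp: eventually_sequentially)
    next
      fix c assume "g z < c"
      moreover have "F i z \<le> g z" for i using F_le[OF z, of i z] by simp
      ultimately have "min B (F i z) < c" for i
        by (meson le_less_trans min.cobounded2)
      then show "\<forall>\<^sub>F i in sequentially. min B (F i z) < c" by simp
    qed
  qed (use F_nonneg B in auto)
qed

lemma compact_open_separation:
  fixes K U :: "'w::metric_space set"
  assumes "compact K" "K \<subseteq> U" "open U"
  obtains f :: "'w \<Rightarrow> real" where "continuous_on UNIV f" "\<And>x. 0 \<le> f x" "\<And>x. f x \<le> 1"
    "\<And>x. x \<in> K \<Longrightarrow> f x = 1" "\<And>x. x \<notin> U \<Longrightarrow> f x = 0"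
proof -
  consider "K = {}" | "U = UNIV" | "K \<noteq> {}" "- U \<noteq> {}" by blast
  then show thesis
  proof cases
    case 1
    then show ?thesis by (intro that[of "\<lambda>_. 0"]) auto
  next
    case 2
    then show ?thesis by (intro that[of "\<lambda>_. 1"]) auto
  next
    case 3
    let ?f = "\<lambda>x. infdist x (- U) / (infdist x (- U) + infdist x K)"
    have closed: "closed K" "closed (- U)"
      using assms by (auto simp: compact_imp_closed)
    have pos: "0 < infdist x (- U) + infdist x K" for x
    proof (cases "x \<in> K")
      case True
      with assms(2) have "0 < infdist x (- U)"
        using infdist_pos_not_in_closed[OF closed(2) 3(2)] by auto
      then show ?thesis using infdist_nonneg[of x K] by linarith
    next
      case False
      then have "0 < infdist x K"
        using infdist_pos_not_in_closed[OF closed(1) 3(1)] by auto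
      then show ?thesis using infdist_nonneg[of x "- U"] by linarith
    qed
    show ?thesis
    proof (rule that[of ?f])
      show "continuous_on UNIV ?f"
        by (intro continuous_intros ballI) (use pos in \<open>auto simp: less_le\<close>)
      show "?f x = 1" if "x \<in> K" for x
        using pos[of x] that by simp
      show "?f x \<le> 1" for x
        using infdist_nonneg[of x K] pos[of x] by (simp add: divide_le_eq_1)
    qed (auto simp: infdist_nonneg)
  qed
qed

text \<open>After a continuous cutoff between \<open>K\<close> and \<open>U\<close>, the integrand
  is replaced on \<open>D\<close> by continuous minorants and kept unchanged off \<open>D\<close>.
  The result is a continuous function plus a Borel function supported on the open set
  \<open>U - D\<close>, so weak convergence treats one summand and setwise convergence the other.
  Semicontinuity is known only along \<open>T\<close>, which carries all the measures.\<close>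

lemma (in weak_limit) nn_integral_compact_le_liminf:
  assumes h[measurable]: "h \<in> borel_measurable borel"
    and K: "compact K" "K \<subseteq> U" and U: "open U" and D: "closed D"
    and T[measurable]: "T \<in> sets borel" and T_M: "\<And>n. measure (M n) T = 1" and T_N: "measure N T = 1"
    and lsc: "\<And>z c. z \<in> D \<inter> T \<Longrightarrow> c < h z \<Longrightarrow> \<exists>d>0. \<forall>w\<in>D \<inter> T. dist z w < d \<longrightarrow> c < h w"
    and small: "\<And>E e. range E \<subseteq> sets borel \<Longrightarrow> decseq E \<Longrightarrow> (\<Inter>i. E i) = {} \<Longrightarrow> 0 < e \<Longrightarrow>
      \<exists>k::nat. \<forall>n. measure (M n) ((U - D) \<inter> E k) \<le> e"
  shows "(\<integral>\<^sup>+x. h x * indicator K x \<partial>N) \<le> liminf (\<lambda>n. \<integral>\<^sup>+x. h x \<partial>M n)"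
proof -
  have [measurable]: "U \<in> sets borel" "D \<in> sets borel" "K \<in> sets borel"
    using U D K(1) by (auto simp: compact_imp_closed)
  have G: "open (U - D)" using U D by auto
  obtain \<phi> :: "'w \<Rightarrow> real" where \<phi>: "continuous_on UNIV \<phi>" "\<And>x. 0 \<le> \<phi> x" "\<And>x. \<phi> x \<le> 1"
    "\<And>x. x \<in> K \<Longrightarrow> \<phi> x = 1" "\<And>x. x \<notin> U \<Longrightarrow> \<phi> x = 0"
    using compact_open_separation[OF K U] by metis
  have [measurable]: "\<phi> \<in> borel_measurable borel"
    using \<phi>(1) by (rule borel_measurable_continuous_onI)
  let ?l = "liminf (\<lambda>n. \<integral>\<^sup>+x. h x \<partial>M n)"
  \<comment> \<open>The truncation at \<open>B\<close> permits real-valued integration; monotone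
    convergence in \<open>B\<close> removes it at the end.\<close>
  have bounded_case: "(\<integral>\<^sup>+x. ennreal (\<phi> x) * min (h x) (of_nat B) \<partial>N) \<le> ?l" for B :: nat
  proof -
    define g where "g x = enn2real (min (h x) (of_nat B))" for x
    have g_enn: "ennreal (g x) = min (h x) (of_nat B)" for x
      unfolding g_def by (rule ennreal_enn2real) (auto simp: min_less_iff_disj ennreal_of_nat_eq_real_of_nat)
    have [measurable]: "g \<in> borel_measurable borel" unfolding g_def by measurable
    have g_nonneg: "0 \<le> g x" for x by (simp add: g_def)
    have g_le: "g x \<le> real B" for x
      unfolding g_def by (rule enn2real_leI) (auto simp: ennreal_of_nat_eq_real_of_nat)
    have g_h: "ennreal (g x) \<le> h x" for x by (simp add: g_enn)
    have "\<exists>d>0. \<forall>w\<in>D \<inter> T. dist z w < d \<longrightarrow> c < g w" if z: "z \<in> D \<inter> T" and c: "c < g z" for z c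
    proof (cases "c < 0")
      case True
      then show ?thesis using g_nonneg by (intro exI[of _ 1]) (auto intro: less_le_trans)
    next
      case False
      then have *: "c < g w \<longleftrightarrow> ennreal c < h w \<and> c < real B" for w
        using ennreal_less_iff[of c "g w"] ennreal_less_iff[of c "real B"]
        by (simp add: g_enn ennreal_of_nat_eq_real_of_nat)
      from lsc[OF z, of "ennreal c"] c show ?thesis
        unfolding * by auto
    qed
    from lsc_approx[of g "real B" "D \<inter> T", OF g_nonneg g_le this]
    obtain H where H: "\<And>i. continuous_on UNIV (H i)" "\<And>i z. 0 \<le> H i z" "\<And>i z. H i z \<le> real B"
      "\<And>z. incseq (\<lambda>i. H i z)" "\<And>z. z \<in> D \<inter> T \<Longrightarrow> (\<lambda>i. H i z) \<longlonglongrightarrow> g z"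
      by metis
    have [measurable]: "H i \<in> borel_measurable borel" for i
      using H(1) by (rule borel_measurable_continuous_onI)
    \<comment> \<open>On \<open>D\<close> an approximation from below, off \<open>D\<close> the
      truncated function itself, about which only measurability is known there.\<close>
    define h' where "h' i x = (if x \<in> D then H i x else g x)" for i x
    have [measurable]: "h' i \<in> borel_measurable borel" for i
      unfolding h'_def by measurable
    have h'_bnd: "0 \<le> h' i x" "h' i x \<le> real B" for i x
      using H(2,3) g_nonneg g_le by (auto simp: h'_def)
    have h'_inc: "incseq (\<lambda>i. h' i x)" for x
      using H(4)[of x] by (auto simp: h'_def mono_def)
    have h'_lim: "(\<lambda>i. h' i x) \<longlonglongrightarrow> g x" if "x \<in> T" for x
      using H(5)[of x] that by (cases "x \<in> D") (auto simp: h'_def)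
    have h'_le: "h' i x \<le> g x" if "x \<in> T" for x i
      by (rule incseq_le[OF h'_inc h'_lim[OF that]])
    \<comment> \<open>The correction term lives on \<open>U - D\<close> because
      \<open>\<phi>\<close> vanishes outside \<open>U\<close>.\<close>
    have split: "\<phi> x * h' i x = \<phi> x * H i x + indicator (U - D) x * (\<phi> x * (g x - H i x))" for x i
      using \<phi>(5)[of x] by (auto simp: h'_def algebra_simps split: split_indicator)
    have b1: "\<bar>\<phi> x * H i x\<bar> \<le> real B" for x i
      using mult_mono[OF \<phi>(3) H(3)[of i x] _ H(2), of x] \<phi>(2)[of x] H(2)[of i x] by (simp add: abs_mult)
    have b2: "\<bar>\<phi> x * (g x - H i x)\<bar> \<le> real B" for x i
    proof -
      have "\<bar>g x - H i x\<bar> \<le> real B" using H(2,3)[of i x] g_nonneg[of x] g_le[of x] by auto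
      with mult_mono[OF \<phi>(3) this, of x] show ?thesis using \<phi>(2)[of x] by (simp add: abs_mult)
    qed
    have b3: "\<bar>indicator (U - D) x * (\<phi> x * (g x - H i x))\<bar> \<le> real B" for x i
      using b2[of x i] by (auto split: split_indicator)
    have b4: "\<bar>\<phi> x * h' i x\<bar> \<le> real B" for x i
      using mult_mono[OF \<phi>(3) h'_bnd(2) _ h'_bnd(1), of x] \<phi>(2)[of x] h'_bnd(1)[of i x] by (simp add: abs_mult)
    have conv: "(\<lambda>n. \<integral>x. \<phi> x * h' i x \<partial>M n) \<longlonglongrightarrow> (\<integral>x. \<phi> x * h' i x \<partial>N)" for i
    proof -
      have "(\<lambda>n. (\<integral>x. \<phi> x * H i x \<partial>M n) + (\<integral>x. indicator (U - D) x * (\<phi> x * (g x - H i x)) \<partial>M n))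
        \<longlonglongrightarrow> (\<integral>x. \<phi> x * H i x \<partial>N) + (\<integral>x. indicator (U - D) x * (\<phi> x * (g x - H i x)) \<partial>N)"
        by (intro tendsto_add weak'[OF _ b1] integral_tendsto[OF G small _ b2] continuous_intros \<phi> H) auto
      also have "(\<integral>x. \<phi> x * H i x \<partial>N) + (\<integral>x. indicator (U - D) x * (\<phi> x * (g x - H i x)) \<partial>N) = (\<integral>x. \<phi> x * h' i x \<partial>N)"
        unfolding split by (rule Bochner_Integration.integral_add[symmetric]) (auto intro!: integrable_bounded b1 b3)
      also have "(\<lambda>n. (\<integral>x. \<phi> x * H i x \<partial>M n) + (\<integral>x. indicator (U - D) x * (\<phi> x * (g x - H i x)) \<partial>M n))
        = (\<lambda>n. \<integral>x. \<phi> x * h' i x \<partial>M n)"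
        unfolding split by (intro ext Bochner_Integration.integral_add[symmetric]) (auto intro!: integrable_bounded b1 b3)
      finally show ?thesis .
    qed
    have "ennreal (\<integral>x. \<phi> x * h' i x \<partial>N) \<le> ?l" for i
    proof -
      have "(\<lambda>n. ennreal (\<integral>x. \<phi> x * h' i x \<partial>M n)) \<longlonglongrightarrow> ennreal (\<integral>x. \<phi> x * h' i x \<partial>N)"
        by (intro tendsto_ennrealI conv)
      then have "ennreal (\<integral>x. \<phi> x * h' i x \<partial>N) = liminf (\<lambda>n. ennreal (\<integral>x. \<phi> x * h' i x \<partial>M n))"
        by (simp add: lim_imp_Liminf)
      also have "\<dots> \<le> ?l"
      proof (intro Liminf_mono always_eventually allI)
        fix n
        have "AE x in M n. x \<in> T" using T_M[of n] by (subst (asm) M.prob_eq_1) auto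
        moreover have "ennreal (\<phi> x * h' i x) \<le> h x" if "x \<in> T" for x
        proof -
          have "\<phi> x * h' i x \<le> 1 * g x"
            using \<phi>(2,3)[of x] h'_le[OF that] h'_bnd(1) by (intro mult_mono) auto
          then show ?thesis using g_h[of x] by (auto intro: order_trans[OF ennreal_leI])
        qed
        ultimately have "(\<integral>\<^sup>+x. ennreal (\<phi> x * h' i x) \<partial>M n) \<le> (\<integral>\<^sup>+x. h x \<partial>M n)"
          by (intro nn_integral_mono_AE) auto
        moreover have "(\<integral>\<^sup>+x. ennreal (\<phi> x * h' i x) \<partial>M n) = ennreal (\<integral>x. \<phi> x * h' i x \<partial>M n)"
          using \<phi>(2) h'_bnd(1) b4 by (intro nn_integral_eq_integral integrable_bounded) auto
        ultimately show "ennreal (\<integral>x. \<phi> x * h' i x \<partial>M n) \<le> (\<integral>\<^sup>+x. h x \<partial>M n)" by simp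
      qed
      finally show ?thesis .
    qed
    moreover have "ennreal (\<integral>x. \<phi> x * h' i x \<partial>N) = (\<integral>\<^sup>+x. ennreal (\<phi> x * h' i x) \<partial>N)" for i
      using \<phi>(2) h'_bnd(1) b4 by (intro nn_integral_eq_integral[symmetric] integrable_bounded) auto
    ultimately have le: "(\<integral>\<^sup>+x. ennreal (\<phi> x * h' i x) \<partial>N) \<le> ?l" for i by simp
    have "AE x in N. x \<in> T" using T_N by (subst (asm) N.prob_eq_1) auto
    then have "AE x in N. ennreal (\<phi> x) * min (h x) (of_nat B) = (SUP i. ennreal (\<phi> x * h' i x))"
    proof eventually_elim
      case (elim x)
      have "incseq (\<lambda>i. ennreal (\<phi> x * h' i x))"
        using h'_inc[of x] \<phi>(2)[of x] by (auto simp: mono_def intro!: ennreal_leI mult_left_mono)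
      moreover have "(\<lambda>i. ennreal (\<phi> x * h' i x)) \<longlonglongrightarrow> ennreal (\<phi> x * g x)"
        by (intro tendsto_ennrealI tendsto_intros h'_lim elim)
      ultimately have "(SUP i. ennreal (\<phi> x * h' i x)) = ennreal (\<phi> x * g x)"
        by (metis LIMSEQ_SUP LIMSEQ_unique)
      then show ?case using \<phi>(2)[of x] g_nonneg[of x] by (simp add: ennreal_mult g_enn)
    qed
    then have "(\<integral>\<^sup>+x. ennreal (\<phi> x) * min (h x) (of_nat B) \<partial>N) = (\<integral>\<^sup>+x. (SUP i. ennreal (\<phi> x * h' i x)) \<partial>N)"
      by (rule nn_integral_cong_AE)
    also have "\<dots> = (SUP i. \<integral>\<^sup>+x. ennreal (\<phi> x * h' i x) \<partial>N)"
      using h'_inc \<phi>(2)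
      by (intro nn_integral_monotone_convergence_SUP) (auto simp: mono_def le_fun_def intro!: ennreal_leI mult_left_mono)
    also have "\<dots> \<le> ?l" by (intro SUP_least le)
    finally show ?thesis .
  qed
  have sup_min: "(SUP B::nat. min y (of_nat B)) = y" for y :: ennreal
  proof -
    have "(SUP B::nat. min y (of_nat B)) = min y (SUP B::nat. of_nat B)"
      by (simp add: inf_min[symmetric] inf_SUP)
    then show ?thesis by (simp add: ennreal_SUP_of_nat_eq_top)
  qed
  have "(\<integral>\<^sup>+x. h x * indicator K x \<partial>N) \<le> (\<integral>\<^sup>+x. ennreal (\<phi> x) * h x \<partial>N)"
    using \<phi>(4) by (intro nn_integral_mono) (auto split: split_indicator)
  also have "\<dots> = (\<integral>\<^sup>+x. (SUP B::nat. ennreal (\<phi> x) * min (h x) (of_nat B)) \<partial>N)"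
    by (simp add: SUP_mult_left_ennreal[symmetric] sup_min)
  also have "\<dots> = (SUP B::nat. \<integral>\<^sup>+x. ennreal (\<phi> x) * min (h x) (of_nat B) \<partial>N)"
    by (intro nn_integral_monotone_convergence_SUP) (auto simp: mono_def le_fun_def intro!: mult_left_mono min.mono)
  also have "\<dots> \<le> ?l" by (intro SUP_least bounded_case)
  finally show ?thesis .
qed

lemma nn_integral_incseq_cover:
  assumes [measurable]: "f \<in> borel_measurable M" "\<And>m. K m \<in> sets M"
    and inc: "incseq K" and full: "AE x in M. x \<in> (\<Union>m. K m)"
    and le: "\<And>m::nat. (\<integral>\<^sup>+x. f x * indicator (K m) x \<partial>M) \<le> l"
  shows "(\<integral>\<^sup>+x. f x \<partial>M) \<le> l"
proof -
  have "AE x in M. f x = (SUP m. f x * indicator (K m) x)"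
    using full
  proof eventually_elim
    case (elim x)
    then obtain m where "x \<in> K m" by auto
    then show ?case
      by (intro antisym SUP_upper2[of m] SUP_least) (auto split: split_indicator)
  qed
  then have "(\<integral>\<^sup>+x. f x \<partial>M) = (\<integral>\<^sup>+x. (SUP m. f x * indicator (K m) x) \<partial>M)"
    by (rule nn_integral_cong_AE)
  also have "\<dots> = (SUP m. \<integral>\<^sup>+x. f x * indicator (K m) x \<partial>M)"
    using inc by (intro nn_integral_monotone_convergence_SUP)
      (auto simp: incseq_def le_fun_def split: split_indicator)
  also have "\<dots> \<le> l"
    by (intro SUP_least le)
  finally show ?thesis .
qed

text \<open>\<open>Liminf (at z within S)\<close> looks at punctured neighbourhoods, but the centre
  may be included since \<open>c < f z\<close> holds there anyway.\<close>

lemma lsc_on_iff: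
  "lsc_on S f \<longleftrightarrow> (\<forall>z\<in>S. \<forall>c<f z. \<exists>V. open V \<and> z \<in> V \<and> (\<forall>w\<in>V \<inter> S. c < f w))"
proof -
  have "(\<forall>\<^sub>F x in at z within S. c < f x) \<longleftrightarrow> (\<exists>V. open V \<and> z \<in> V \<and> (\<forall>w\<in>V \<inter> S. c < f w))"
    if c: "c < f z" for c z
  proof -
    have "(\<forall>x\<in>V. x \<noteq> z \<longrightarrow> x \<in> S \<longrightarrow> c < f x) \<longleftrightarrow> (\<forall>w\<in>V \<inter> S. c < f w)" for V
      using c by auto
    then show ?thesis unfolding eventually_at_topological by simp
  qed
  then show ?thesis
    unfolding lsc_on_def le_Liminf_iff by simp
qed

lemma lsc_onD:
  assumes "lsc_on S f" "z \<in> S" "c < f z"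
  obtains V where "open V" "z \<in> V" "\<And>w. w \<in> V \<Longrightarrow> w \<in> S \<Longrightarrow> c < f w"
proof -
  from assms have "\<exists>V. open V \<and> z \<in> V \<and> (\<forall>w\<in>V \<inter> S. c < f w)"
    unfolding lsc_on_iff by simp
  then show thesis using that by auto
qed

lemma tight_subsequence_liminf:
  fixes \<gamma> :: "nat \<Rightarrow> 'z::topological_space measure" and e :: "'z \<Rightarrow> 'w::{complete_space,second_countable_topology}"
  assumes hom: "homeomorphism UNIV T e e'" and T: "T \<in> sets borel"
    and prob: "\<And>n. prob_space (\<gamma> n)" and sets: "\<And>n. sets (\<gamma> n) = sets borel"
    and K: "incseq K" "\<And>m. compact (K m)"
    and tight: "\<And>e. 0 < e \<Longrightarrow> \<exists>m. \<forall>n. 1 - e \<le> measure (\<gamma> n) (K m)"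
    and U: "\<And>m. open (U m)" "\<And>m. K m \<subseteq> U m" and D: "\<And>m. closed (D m)"
    and small: "\<And>m E e. range E \<subseteq> sets borel \<Longrightarrow> decseq E \<Longrightarrow> (\<Inter>i. E i) = {} \<Longrightarrow> 0 < e \<Longrightarrow>
      \<exists>k::nat. \<forall>n. measure (\<gamma> n) ((U m - D m) \<inter> E k) \<le> e"
  obtains r :: "nat \<Rightarrow> nat" and \<gamma>' where "strict_mono r" "prob_space \<gamma>'" "sets \<gamma>' = sets borel"
    "\<And>h. h \<in> borel_measurable borel \<Longrightarrow> (\<And>m. lsc_on (D m) h) \<Longrightarrow>
      (\<integral>\<^sup>+z. h z \<partial>\<gamma>') \<le> liminf (\<lambda>n. \<integral>\<^sup>+z. h z \<partial>\<gamma> (r n))"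
proof -
  have e'e[simp]: "\<And>z. e' (e z) = z" and e_T: "range e = T" and ee': "\<And>y. y \<in> T \<Longrightarrow> e (e' y) = y"
    and e_cont: "continuous_on UNIV e" and e'_cont: "continuous_on T e'"
    using hom by (auto simp: homeomorphism_def)
  have e_in_T[simp]: "e z \<in> T" for z using e_T by auto
  interpret \<gamma>: prob_space "\<gamma> n" for n by (rule prob)
  have sets'[measurable_cong]: "sets (\<gamma> n) = sets borel" for n by (rule sets)
  have space_\<gamma>[simp]: "space (\<gamma> n) = UNIV" for n
    using sets_eq_imp_space_eq[OF sets[of n]] by simp
  have e[measurable]: "e \<in> borel_measurable borel"
    using e_cont by (rule borel_measurable_continuous_onI)
  have T'[measurable]: "T \<in> sets borel" by (rule T)
  define M where "M n = distr (\<gamma> n) borel e" for n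
  have M_prob: "prob_space (M n)" for n
    unfolding M_def by (intro \<gamma>.prob_space_distr) simp
  have M_sets: "sets (M n) = sets borel" for n by (simp add: M_def)
  have M_meas: "measure (M n) B = measure (\<gamma> n) (e -` B)" if "B \<in> sets borel" for B n
    using that by (simp add: M_def measure_distr)
  have eK: "compact (e ` K m)" for m
    using K(2) continuous_on_subset[OF e_cont] by (intro compact_continuous_image) auto
  then have eK_sets[measurable]: "e ` K m \<in> sets borel" for m by (intro borel_closed compact_imp_closed)
  have vim: "e -` (e ` X) = X" for X
    by (metis e'e inj_on_inverseI inj_vimage_image_eq)
  have tight': "\<exists>m. \<forall>n. 1 - \<epsilon> \<le> measure (M n) (e ` K m)" if "0 < \<epsilon>" for \<epsilon>
    using tight[OF that] by (simp add: M_meas eK_sets vim)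
  have inc': "incseq (\<lambda>m. e ` K m)"
    using K(1) by (auto simp: incseq_def)
  obtain r N where r: "strict_mono r" and lim: "weak_limit (M \<circ> r) N" and N_K: "measure N (\<Union>m. e ` K m) = 1"
    using tight_convergent_subsequence[OF M_prob M_sets inc' eK tight'] by metis
  interpret N: weak_limit "M \<circ> r" N by (rule lim)
  have [measurable_cong]: "sets N = sets borel" by (rule N.sets_N)
  have N_K': "AE y in N. y \<in> (\<Union>m. e ` K m)"
    using N_K by (subst (asm) N.N.prob_eq_1) auto
  then have N_T': "AE y in N. y \<in> T" by eventually_elim auto
  then have N_T: "measure N T = 1" by (subst N.N.prob_eq_1) auto
  have M_T: "measure (M n) T = 1" for n
  proof -
    have "e -` T = UNIV" by auto
    then show ?thesis using \<gamma>.prob_space[of n] by (simp add: M_meas)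
  qed
  \<comment> \<open>The inverse of \<open>e\<close>, made total by a constant on the complement of
    \<open>T\<close>, which is null for \<open>N\<close>.\<close>
  define p where "p y = (if y \<in> T then e' y else undefined)" for y
  have p[measurable]: "p \<in> borel_measurable borel"
  proof (rule measurable_piecewise_restrict[of "{T, - T}"])
    show "p \<in> restrict_space borel \<Omega> \<rightarrow>\<^sub>M borel" if "\<Omega> \<in> {T, - T}" for \<Omega>
    proof -
      consider "\<Omega> = T" | "\<Omega> = - T" using \<open>\<Omega> \<in> {T, - T}\<close> by blast
      then show ?thesis
      proof cases
        case 1
        show ?thesis
          unfolding 1
          by (rule measurable_cong[THEN iffD1, OF _ borel_measurable_continuous_on_restrict[OF e'_cont]])
            (simp add: space_restrict_space p_def)
      next
        case 2
        show ?thesis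
          unfolding 2
          by (rule measurable_cong[THEN iffD1, OF _ measurable_const[of undefined]])
            (auto simp: space_restrict_space p_def)
      qed
    qed
  qed auto
  have p_e[simp]: "p (e z) = z" for z by (simp add: p_def)
  have e_p: "e (p y) = y" if "y \<in> T" for y using that by (simp add: p_def ee')
  \<comment> \<open>Images of open sets are open only relative to \<open>T\<close>. Each
    \<open>U m\<close> and \<open>D m\<close> is therefore replaced by an open or closed set of the
    ambient space with the same preimage under \<open>e\<close>.\<close>
  have homeo_open: "\<exists>W. open W \<and> e ` V = W \<inter> T" if "open V" for V
  proof -
    have "openin (top_of_set T) (e ` V)"
      using homeomorphism_imp_open_map[OF hom, of V] that by simp
    then show ?thesis by (auto simp: openin_open Int_commute)
  qed
  have "\<exists>W. open W \<and> e ` U m \<subseteq> W \<and> e -` W = U m" for m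
  proof -
    obtain W where W: "open W" "e ` U m = W \<inter> T" using homeo_open[OF U(1)] by blast
    have "e -` W = e -` (W \<inter> T)" by auto
    then have "e -` W = U m" using vim[of "U m"] W(2) by simp
    then show ?thesis using W by auto
  qed
  then obtain U' where U': "\<And>m. open (U' m)" "\<And>m. e ` U m \<subseteq> U' m" "\<And>m. e -` U' m = U m" by metis
  have "\<exists>W. closed W \<and> e -` W = D m" for m
  proof -
    obtain W where W: "open W" "e ` (- D m) = W \<inter> T" using homeo_open[of "- D m"] D by auto
    have "e -` W = e -` (W \<inter> T)" by auto
    then have "e -` W = - D m" using vim[of "- D m"] W(2) by simp
    then show ?thesis using W(1) by (intro exI[of _ "- W"]) auto
  qed
  then obtain D' where D': "\<And>m. closed (D' m)" "\<And>m. e -` D' m = D m" by metis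
  have small': "\<exists>k. \<forall>n. measure ((M \<circ> r) n) ((U' m - D' m) \<inter> E k) \<le> \<epsilon>"
    if E: "range E \<subseteq> sets borel" "decseq E" "(\<Inter>i. E i) = {}" "0 < \<epsilon>" for m E \<epsilon>
  proof -
    have [measurable]: "E k \<in> sets borel" "U' m \<in> sets borel" "D' m \<in> sets borel" for k
      using E(1) U'(1) D'(1) by auto
    have "range (\<lambda>k. e -` E k) \<subseteq> sets borel"
      using measurable_sets[OF e] by (auto simp: space_borel)
    moreover have "decseq (\<lambda>k. e -` E k)" "(\<Inter>k. e -` E k) = {}"
      using E(2,3) by (auto simp: decseq_def)
    ultimately obtain k where k: "\<And>n. measure (\<gamma> n) ((U m - D m) \<inter> e -` E k) \<le> \<epsilon>"
      using small E(4) by metis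
    have "e -` ((U' m - D' m) \<inter> E k) = (U m - D m) \<inter> e -` E k"
      using U'(3)[of m] D'(2)[of m] by auto
    then show ?thesis using k by (intro exI[of _ k]) (simp add: M_meas)
  qed
  show thesis
  proof (rule that[OF r, of "distr N borel p"])
    show "prob_space (distr N borel p)" by (intro N.N.prob_space_distr) simp
    fix h :: "'z \<Rightarrow> ennreal" assume h[measurable]: "h \<in> borel_measurable borel" and lsc: "\<And>m. lsc_on (D m) h"
    have int: "(\<integral>\<^sup>+y. h (p y) \<partial>(M \<circ> r) n) = (\<integral>\<^sup>+z. h z \<partial>\<gamma> (r n))" for n
      by (simp add: M_def nn_integral_distr)
    have "(\<integral>\<^sup>+z. h z \<partial>distr N borel p) = (\<integral>\<^sup>+y. h (p y) \<partial>N)"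
      by (simp add: nn_integral_distr)
    also have "\<dots> \<le> liminf (\<lambda>n. \<integral>\<^sup>+y. h (p y) \<partial>(M \<circ> r) n)"
    proof (rule nn_integral_incseq_cover[OF _ _ inc' N_K'])
      fix m
      show "(\<integral>\<^sup>+y. h (p y) * indicator (e ` K m) y \<partial>N) \<le> liminf (\<lambda>n. \<integral>\<^sup>+y. h (p y) \<partial>(M \<circ> r) n)"
      proof (rule N.nn_integral_compact_le_liminf[where U = "U' m" and D = "D' m" and T = T])
        show "e ` K m \<subseteq> U' m" using U(2) U'(2) by blast
        show "\<exists>d>0. \<forall>w\<in>D' m \<inter> T. dist z w < d \<longrightarrow> c < h (p w)" if z: "z \<in> D' m \<inter> T" and c: "c < h (p z)" for z c
        proof -
          have in_D: "p w \<in> D m" if "w \<in> D' m \<inter> T" for w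
            using that D'(2)[of m] e_p[of w] by auto
          obtain V where V: "open V" "p z \<in> V" "\<And>w. w \<in> V \<Longrightarrow> w \<in> D m \<Longrightarrow> c < h w"
            using lsc_onD[OF lsc in_D[OF z] c] by metis
          obtain W where W: "open W" "e ` V = W \<inter> T" using homeo_open[OF V(1)] by blast
          have "z \<in> W" using V(2) W(2) e_p[of z] z by (metis IntD1 IntD2 imageI)
          then obtain d where d: "d > 0" "\<And>w. dist z w < d \<Longrightarrow> w \<in> W"
            using W(1) by (auto simp: open_dist dist_commute)
          have "c < h (p w)" if w: "w \<in> D' m \<inter> T" "dist z w < d" for w
          proof -
            have "w \<in> e ` V" using d(2)[OF w(2)] w(1) unfolding W(2) by blast
            then have "p w \<in> V" by (elim imageE) simp
            with in_D[OF w(1)] show ?thesis by (intro V(3))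
          qed
          with d(1) show ?thesis by blast
        qed
        show "measure ((M \<circ> r) n) T = 1" for n by (simp add: M_T)
        show "(\<lambda>y. h (p y)) \<in> borel_measurable borel" by measurable
        show "\<exists>k. \<forall>n. measure ((M \<circ> r) n) ((U' m - D' m) \<inter> E k) \<le> \<epsilon>"
          if "range E \<subseteq> sets borel" "decseq E" "(\<Inter>i. E i) = {}" "0 < \<epsilon>" for E \<epsilon>
          using that by (rule small')
      qed (rule eK U' D' T N_T)+
      show "(\<lambda>y. h (p y)) \<in> borel_measurable N" by measurable
      show "e ` K m \<in> sets N" by measurable
    qed
    finally show "(\<integral>\<^sup>+z. h z \<partial>distr N borel p) \<le> liminf (\<lambda>n. \<integral>\<^sup>+z. h z \<partial>\<gamma> (r n))"
      unfolding int .
  qed simp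
qed

lemma continuous_on_imp_lsc_on:
  fixes u :: "'z::topological_space \<Rightarrow> real"
  assumes "continuous_on S u"
  shows "lsc_on S (\<lambda>z. ennreal (u z))"
  unfolding lsc_on_iff
proof (intro ballI allI impI)
  fix z c assume z: "z \<in> S" "c < ennreal (u z)"
  have "continuous_on S (\<lambda>z. ennreal (u z))"
    using assms by (rule continuous_on_ennreal)
  then obtain V where "open V" "V \<inter> S = (\<lambda>z. ennreal (u z)) -` {c<..} \<inter> S"
    using continuous_on_open_invariant[of S "\<lambda>z. ennreal (u z)"] open_greaterThan by blast
  then show "\<exists>V. open V \<and> z \<in> V \<and> (\<forall>w\<in>V \<inter> S. c < ennreal (u w))"
    using z by (intro exI[of _ V]) auto
qed

text \<open>The one-sided inequality for \<open>u\<close> bounds the integrals from below; the one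
  for \<open>B - u\<close>, which is continuous on the same sets, bounds them from above.\<close>

lemma tendsto_integral_of_liminf:
  fixes \<gamma> :: "nat \<Rightarrow> 'z::topological_space measure" and u :: "'z \<Rightarrow> real"
  assumes prob: "\<And>n. prob_space (\<gamma> n)" "prob_space \<gamma>'"
    and sets[measurable_cong]: "\<And>n. sets (\<gamma> n) = sets borel" "sets \<gamma>' = sets borel"
    and lim: "\<And>h. h \<in> borel_measurable borel \<Longrightarrow> (\<And>m::nat. lsc_on (D m) h) \<Longrightarrow>
      (\<integral>\<^sup>+z. h z \<partial>\<gamma>') \<le> liminf (\<lambda>n. \<integral>\<^sup>+z. h z \<partial>\<gamma> n)"
    and u[measurable]: "u \<in> borel_measurable borel" and bnd: "\<And>z. 0 \<le> u z" "\<And>z. u z \<le> B"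
    and cont: "\<And>m. continuous_on (D m) u"
  shows "(\<lambda>n. \<integral>z. u z \<partial>\<gamma> n) \<longlonglongrightarrow> (\<integral>z. u z \<partial>\<gamma>')"
proof (rule order_tendstoI)
  interpret \<gamma>: prob_space "\<gamma> n" for n by (rule prob)
  interpret \<gamma>': prob_space \<gamma>' by (rule prob)
  have int: "integrable (\<gamma> n) u" "integrable \<gamma>' u" for n
    using bnd by (auto intro!: \<gamma>.integrable_const_bound[where B = B] \<gamma>'.integrable_const_bound[where B = B])
  have ev: "\<forall>\<^sub>F n in sequentially. c < (\<integral>z. v z \<partial>\<gamma> n)"
    if c: "c < (\<integral>z. v z \<partial>\<gamma>')" and [measurable]: "v \<in> borel_measurable borel"
      and v: "\<And>z. 0 \<le> v z" "\<And>n. integrable (\<gamma> n) v" "integrable \<gamma>' v" "\<And>m. continuous_on (D m) v" for v :: "'z \<Rightarrow> real" and c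
  proof (cases "c < 0")
    case True
    then show ?thesis using v(1) by (intro always_eventually allI) (auto intro: less_le_trans)
  next
    case False
    have "ennreal c < ennreal (\<integral>z. v z \<partial>\<gamma>')"
      using c False by (simp add: ennreal_less_iff)
    also have "\<dots> = (\<integral>\<^sup>+z. v z \<partial>\<gamma>')"
      using v by (intro nn_integral_eq_integral[symmetric]) auto
    also have "\<dots> \<le> liminf (\<lambda>n. \<integral>\<^sup>+z. v z \<partial>\<gamma> n)"
      by (rule lim) (auto intro: continuous_on_imp_lsc_on v)
    also have "\<dots> = liminf (\<lambda>n. ennreal (\<integral>z. v z \<partial>\<gamma> n))"
      using v by (simp add: nn_integral_eq_integral)
    finally show ?thesis
      using False by (auto simp: ennreal_less_iff dest!: less_LiminfD elim!: eventually_mono)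
  qed
  show "\<forall>\<^sub>F n in sequentially. c < (\<integral>z. u z \<partial>\<gamma> n)" if "c < (\<integral>z. u z \<partial>\<gamma>')" for c
    using that by (rule ev) (auto intro: int cont bnd)
  show "\<forall>\<^sub>F n in sequentially. (\<integral>z. u z \<partial>\<gamma> n) < c" if "(\<integral>z. u z \<partial>\<gamma>') < c" for c
  proof -
    have "B - c < (\<integral>z. B - u z \<partial>\<gamma>')"
      using that int by (simp add: \<gamma>'.prob_space)
    then have "\<forall>\<^sub>F n in sequentially. B - c < (\<integral>z. B - u z \<partial>\<gamma> n)"
      by (rule ev) (auto intro!: int cont continuous_intros simp: bnd)
    then show ?thesis
      using int by (simp add: \<gamma>.prob_space)
  qed
qed

text \<open>Open sets form a generator stable under intersection, and each is an increasing limit of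
  continuous functions. These are built in the metric space \<open>'y\<close> and pulled back along
  \<open>f\<close>, as \<open>'x\<close> has no metric of its own.\<close>

lemma measure_eqI_continuous:
  fixes M N :: "'x::topological_space measure" and f :: "'x \<Rightarrow> 'y::metric_space"
  assumes hom: "homeomorphism UNIV S f g"
    and sets[measurable_cong]: "sets M = sets borel" "sets N = sets borel" and fin: "finite_measure M"
    and eq: "\<And>u :: 'x \<Rightarrow> real. continuous_on UNIV u \<Longrightarrow> (\<And>x. 0 \<le> u x) \<Longrightarrow> (\<And>x. u x \<le> 1) \<Longrightarrow>
      (\<integral>\<^sup>+x. ennreal (u x) \<partial>M) = (\<integral>\<^sup>+x. ennreal (u x) \<partial>N)"
  shows "M = N"
proof (rule measure_eqI_generator_eq[where \<Omega> = UNIV and E = "{V. open V}" and A = "\<lambda>_. UNIV"])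
  show "sets M = sigma_sets UNIV {V. open V}" "sets N = sigma_sets UNIV {V. open V}"
    by (auto simp: sets sets_borel)
  show "emeasure M UNIV \<noteq> \<infinity>"
    using finite_measure.emeasure_finite[OF fin] by simp
  fix V :: "'x set" assume "V \<in> {V. open V}"
  then have V: "open V" by simp
  have f: "continuous_on UNIV f" "\<And>x. g (f x) = x" using hom by (auto simp: homeomorphism_def)
  have "openin (top_of_set S) (f ` V)"
    using homeomorphism_imp_open_map[OF hom, of V] V by simp
  then obtain W where W: "open W" "f ` V = S \<inter> W" by (auto simp: openin_open)
  have fW: "f x \<in> W \<longleftrightarrow> x \<in> V" for x
  proof
    assume "f x \<in> W"
    moreover have "f x \<in> S" using hom by (auto simp: homeomorphism_def)
    ultimately have "f x \<in> f ` V" unfolding W(2) by simp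
    then show "x \<in> V" using f(2) by (metis imageE)
  next
    assume "x \<in> V"
    then have "f x \<in> f ` V" by simp
    then show "f x \<in> W" unfolding W(2) by simp
  qed
  obtain w :: "nat \<Rightarrow> 'y \<Rightarrow> real" where w: "\<And>k. continuous_on UNIV (w k)" "\<And>k x. 0 \<le> w k x"
    "\<And>k x. w k x \<le> indicator W x" "\<And>x. incseq (\<lambda>k. w k x)" "\<And>x. x \<in> W \<Longrightarrow> \<exists>k. w k x = 1"
    using open_indicator_approx[OF W(1)] by metis
  define u where "u k x = w k (f x)" for k x
  have u_cont: "continuous_on UNIV (u k)" for k
    unfolding u_def by (rule continuous_on_compose2[OF w(1) f(1)]) auto
  have u_le: "u k x \<le> 1" for k x
    using w(3)[of k "f x"] by (auto simp: u_def split: split_indicator_asm)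
  have u_sup: "(SUP k. ennreal (u k x)) = indicator V x" for x
  proof -
    have inc: "incseq (\<lambda>k. ennreal (u k x))"
      using w(4)[of "f x"] by (auto simp: u_def mono_def intro!: ennreal_leI)
    have "(\<lambda>k. ennreal (u k x)) \<longlonglongrightarrow> ennreal (indicator W (f x))"
      unfolding u_def by (intro tendsto_ennrealI incseq_eventually_1_tendsto w)
    then have "(SUP k. ennreal (u k x)) = ennreal (indicator W (f x))"
      using LIMSEQ_SUP[OF inc] LIMSEQ_unique by blast
    then show ?thesis by (simp add: indicator_def fW)
  qed
  have "emeasure Q V = (SUP k. \<integral>\<^sup>+x. u k x \<partial>Q)" if Q[measurable_cong]: "sets Q = sets borel" for Q
  proof -
    have [measurable]: "u k \<in> borel_measurable borel" for k
      using u_cont by (rule borel_measurable_continuous_onI)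
    have "emeasure Q V = (\<integral>\<^sup>+x. indicator V x \<partial>Q)"
      using V Q by simp
    also have "\<dots> = (\<integral>\<^sup>+x. (SUP k. ennreal (u k x)) \<partial>Q)"
      by (simp add: u_sup)
    also have "\<dots> = (SUP k. \<integral>\<^sup>+x. u k x \<partial>Q)"
    proof (rule nn_integral_monotone_convergence_SUP)
      show "incseq (\<lambda>k x. ennreal (u k x))"
        using w(4) by (auto simp: u_def mono_def le_fun_def intro!: ennreal_leI)
    qed measurable
    finally show ?thesis .
  qed
  moreover have "(\<integral>\<^sup>+x. u k x \<partial>M) = (\<integral>\<^sup>+x. u k x \<partial>N)" for k
    by (rule eq[OF u_cont _ u_le]) (simp add: u_def w)
  ultimately show "emeasure M V = emeasure N V"
    using sets by simp
qed (auto simp: Int_stable_def)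

section \<open>Laws of the controlled process\<close>

definition law ::
  "('x::topological_space \<times> 'a::topological_space \<Rightarrow> 'x measure) \<Rightarrow> ('x, 'a) policy \<Rightarrow> 'x measure
    \<Rightarrow> nat \<Rightarrow> ('x \<times> 'a) measure" where
  "law q \<pi> p k = distr (process q \<pi> p) borel (\<lambda>\<omega>. \<omega> k)"

locale controlled_process =
  fixes A :: "'x::topological_space \<Rightarrow> 'a::{countable,discrete_topology} set"
    and q :: "'x \<times> 'a \<Rightarrow> 'x measure" and \<pi> :: "('x, 'a) policy" and p :: "'x measure"
  assumes q[measurable]: "q \<in> borel \<rightarrow>\<^sub>M prob_algebra borel" and \<pi>: "\<pi> \<in> policies A"
    and p: "p \<in> prob_measures" and graph[measurable]: "graph A \<in> sets borel"
begin

sublocale IT: Ionescu_Tulcea "next_pair q \<pi> p" "\<lambda>_. borel"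
  by (rule Ionescu_Tulcea_next_pair[OF q \<pi> p])

lemma sets_process[measurable_cong]: "sets (process q \<pi> p) = sets (PiM UNIV (\<lambda>_. borel))"
  by (simp add: process_def)

lemma space_process[simp]: "space (process q \<pi> p) = UNIV"
  by (simp add: process_def space_PiM)

lemma prob_space_process: "prob_space (process q \<pi> p)"
proof (rule prob_space_distrD)
  \<comment> \<open>Total mass is already visible in the restriction to no coordinate at all, where
    the projective limit is known explicitly.\<close>
  show "(\<lambda>\<omega>. restrict \<omega> {}) \<in> process q \<pi> p \<rightarrow>\<^sub>M PiM {} (\<lambda>_. borel :: ('x \<times> 'a) measure)"
    by (simp add: measurable_restrict_subset sets_process cong: measurable_cong_sets)
  show "prob_space (distr (process q \<pi> p) (PiM {} (\<lambda>_. borel)) (\<lambda>\<omega>. restrict \<omega> {}))"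
    unfolding process_def by (subst IT.distr_lim) (auto intro: IT.PF.prob_space_P)
qed

declare IT.C.simps[simp del]

abbreviation past :: "nat \<Rightarrow> (nat \<Rightarrow> 'x \<times> 'a) measure" where
  "past k \<equiv> IT.C 0 k (\<lambda>x. undefined)"

lemma undefined_in_space: "(\<lambda>x. undefined) \<in> space (PiM {0..<0::nat} (\<lambda>_. borel))"
  by (simp add: space_PiM)

lemma sets_past: "sets (past k) = sets (PiM {0..<k} (\<lambda>_. borel))"
  using IT.sets_C[OF undefined_in_space] by simp

lemma prob_space_past: "prob_space (past k)"
  by (rule IT.prob_space_C[OF undefined_in_space])

text \<open>The infinite process is accessible only through its finite-dimensional distributions;
  evaluation at \<open>k\<close> factors through the coordinates below \<open>Suc k\<close>.\<close>

lemma law_eq_past: "law q \<pi> p k = distr (past (Suc k)) borel (\<lambda>\<omega>. \<omega> k)"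
proof -
  let ?J = "{0..<Suc k}"
  have up: "IT.up_to ?J = Suc k"
    using IT.up_to_less[of ?J k] by (intro antisym) (auto simp: IT.up_to_iff)
  have m: "(\<lambda>\<omega>. \<omega> k) \<in> PiM ?J (\<lambda>_. borel) \<rightarrow>\<^sub>M borel"
    by (intro measurable_component_singleton) simp
  have r: "(\<lambda>\<omega>. restrict \<omega> ?J) \<in> PiM I (\<lambda>_. borel) \<rightarrow>\<^sub>M PiM ?J (\<lambda>_. borel)" if "?J \<subseteq> I" for I
    using that by (intro measurable_restrict_subset)
  have "law q \<pi> p k = distr (distr (process q \<pi> p) (PiM ?J (\<lambda>_. borel)) (\<lambda>\<omega>. restrict \<omega> ?J)) borel (\<lambda>\<omega>. \<omega> k)"
    unfolding law_def by (subst distr_distr[OF m]) (auto simp: sets_process r comp_def cong: measurable_cong_sets)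
  also have "distr (process q \<pi> p) (PiM ?J (\<lambda>_. borel)) (\<lambda>\<omega>. restrict \<omega> ?J) = IT.CI ?J"
    unfolding process_def by (rule IT.distr_lim) simp
  also have "IT.CI ?J = distr (past (Suc k)) (PiM ?J (\<lambda>_. borel)) (\<lambda>\<omega>. restrict \<omega> ?J)"
    unfolding IT.CI_def up ..
  also have "distr \<dots> borel (\<lambda>\<omega>. \<omega> k) = distr (past (Suc k)) borel (\<lambda>\<omega>. \<omega> k)"
    by (subst distr_distr[OF m]) (auto simp: sets_past r comp_def cong: measurable_cong_sets)
  finally show ?thesis .
qed

lemma measurable_next_pair: "next_pair q \<pi> p k \<in> past k \<rightarrow>\<^sub>M subprob_algebra borel"
  using IT.P[of k] by (simp add: sets_past cong: measurable_cong_sets)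

text \<open>The history up to time \<open>k\<close> arises from \<open>past k\<close> by appending
  one draw from \<open>next_pair\<close>; evaluation at \<open>k\<close> returns just that
  draw.\<close>

lemma law_eq_bind: "law q \<pi> p k = past k \<bind> next_pair q \<pi> p k"
proof -
  have m: "(\<lambda>\<omega>. \<omega> k) \<in> PiM {0..<Suc k} (\<lambda>_. borel) \<rightarrow>\<^sub>M borel"
    by (intro measurable_component_singleton) simp
  have eP: "IT.eP k \<in> past k \<rightarrow>\<^sub>M subprob_algebra (PiM {0..<Suc k} (\<lambda>_. borel))"
    using IT.measurable_eP[of k] by (simp add: sets_past cong: measurable_cong_sets)
  have "law q \<pi> p k = past k \<bind> (\<lambda>h. distr (IT.eP k h) borel (\<lambda>\<omega>. \<omega> k))"
    unfolding law_eq_past IT.C.simps add_0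
    by (rule distr_bind[OF eP _ m]) (rule prob_space.not_empty[OF prob_space_past])
  also have "\<dots> = past k \<bind> next_pair q \<pi> p k"
  proof (rule bind_cong[OF refl])
    fix h assume "h \<in> space (past k)"
    then have h: "h \<in> space (PiM {0..<k} (\<lambda>_. borel))"
      using sets_eq_imp_space_eq[OF sets_past] by simp
    have "fun_upd h k \<in> borel \<rightarrow>\<^sub>M PiM {0..<Suc k} (\<lambda>_. borel)"
      using h by (intro measurable_fun_upd[where J = "{0..<k}"]) auto
    then have f: "fun_upd h k \<in> next_pair q \<pi> p k h \<rightarrow>\<^sub>M PiM {0..<Suc k} (\<lambda>_. borel)"
      using IT.sets_P[OF h] by (simp cong: measurable_cong_sets)
    show "distr (IT.eP k h) borel (\<lambda>\<omega>. \<omega> k) = next_pair q \<pi> p k h"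
      unfolding IT.eP_def by (subst distr_distr[OF m f]) (simp add: comp_def distr_id2 IT.sets_P[OF h])
  qed
  finally show ?thesis .
qed

lemma kernel_measurable:
  assumes "h \<in> space (histories k)"
  shows "(\<lambda>x. \<pi> k h x) \<in> borel \<rightarrow>\<^sub>M prob_algebra borel"
proof -
  have m: "(\<lambda>(h, x). \<pi> k h x) \<in> histories k \<Otimes>\<^sub>M borel \<rightarrow>\<^sub>M prob_algebra borel"
    using \<pi> by (simp add: policies_def)
  show ?thesis
    using measurable_compose[OF measurable_Pair1'[OF assms] m] by simp
qed

end

section \<open>Joining a distribution of states with a kernel for actions\<close>

lemma measurable_Pair_action: "Pair x \<in> borel \<rightarrow>\<^sub>M (borel :: ('x::topological_space \<times> 'a::{countable,discrete_topology}) measure)"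
  by (simp add: measurable_cong_sets[OF refl sets_borel_state_action])

lemma measurable_distr_Pair:
  assumes "\<mu> \<in> borel \<rightarrow>\<^sub>M prob_algebra (borel :: 'a::{countable,discrete_topology} measure)"
  shows "(\<lambda>x. distr (\<mu> x) borel (Pair x)) \<in> borel \<rightarrow>\<^sub>M prob_algebra (borel :: ('x::topological_space \<times> 'a) measure)"
  by (rule measurable_distr_prob_space2[OF assms])
    (simp add: measurable_cong_sets[OF refl sets_borel_state_action] case_prod_beta)

lemma nn_integral_bind_distr_Pair:
  assumes \<mu>: "\<mu> \<in> borel \<rightarrow>\<^sub>M prob_algebra (borel :: 'a::{countable,discrete_topology} measure)"
    and r: "sets r = sets borel"
    and f: "f \<in> borel_measurable (borel :: ('x::topological_space \<times> 'a) measure)"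
  shows "(\<integral>\<^sup>+z. f z \<partial>(r \<bind> (\<lambda>x. distr (\<mu> x) borel (Pair x)))) = (\<integral>\<^sup>+x. \<integral>\<^sup>+a. f (x, a) \<partial>\<mu> x \<partial>r)"
proof -
  have "(\<lambda>x. distr (\<mu> x) borel (Pair x)) \<in> r \<rightarrow>\<^sub>M subprob_algebra borel"
    using measurable_prob_algebraD[OF measurable_distr_Pair[OF \<mu>]] r by (simp cong: measurable_cong_sets)
  then have "(\<integral>\<^sup>+z. f z \<partial>(r \<bind> (\<lambda>x. distr (\<mu> x) borel (Pair x)))) = (\<integral>\<^sup>+x. \<integral>\<^sup>+z. f z \<partial>distr (\<mu> x) borel (Pair x) \<partial>r)"
    by (rule nn_integral_bind[OF f])
  also have "\<dots> = (\<integral>\<^sup>+x. \<integral>\<^sup>+a. f (x, a) \<partial>\<mu> x \<partial>r)"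
  proof (rule nn_integral_cong)
    fix x
    have "sets (\<mu> x) = sets borel"
      using measurable_space[OF \<mu>, of x] by (simp add: space_prob_algebra)
    then show "(\<integral>\<^sup>+z. f z \<partial>distr (\<mu> x) borel (Pair x)) = (\<integral>\<^sup>+a. f (x, a) \<partial>\<mu> x)"
      using f by (intro nn_integral_distr) (simp_all add: measurable_Pair_action cong: measurable_cong_sets)
  qed
  finally show ?thesis .
qed

lemma distr_fst_bind_distr_Pair:
  assumes \<mu>: "\<mu> \<in> borel \<rightarrow>\<^sub>M prob_algebra (borel :: 'a::{countable,discrete_topology} measure)"
    and r: "r \<in> space (prob_algebra (borel :: 'x::topological_space measure))"
  shows "distr (r \<bind> (\<lambda>x. distr (\<mu> x) borel (Pair x))) borel fst = r"
proof -
  have sr: "sets r = sets borel" and pr: "prob_space r" using r by (auto simp: space_prob_algebra)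
  let ?F = "\<lambda>x. distr (\<mu> x) (borel :: ('x \<times> 'a) measure) (Pair x)"
  have F: "?F \<in> r \<rightarrow>\<^sub>M subprob_algebra borel"
    using measurable_prob_algebraD[OF measurable_distr_Pair[OF \<mu>]] sr by (simp cong: measurable_cong_sets)
  have fst: "fst \<in> (borel :: ('x \<times> 'a) measure) \<rightarrow>\<^sub>M borel"
    by (intro borel_measurable_continuous_onI continuous_on_fst continuous_on_id)
  show ?thesis
  proof (rule measure_eqI)
    fix B assume "B \<in> sets (distr (r \<bind> ?F) borel fst)"
    then have B[measurable]: "B \<in> sets borel" by simp
    have sB: "sets (r \<bind> ?F) = sets borel"
      by (rule sets_bind[OF sets_kernel[OF F]]) (auto simp: prob_space.not_empty[OF pr])
    have fB: "fst -` B \<in> sets (borel :: ('x \<times> 'a) measure)"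
      using measurable_sets[OF fst B] by simp
    have "emeasure (distr (r \<bind> ?F) borel fst) B = emeasure (r \<bind> ?F) (fst -` B)"
      using sets_eq_imp_space_eq[OF sB] fst sB by (subst emeasure_distr) (auto cong: measurable_cong_sets)
    also have "\<dots> = (\<integral>\<^sup>+z. indicator (fst -` B) z \<partial>(r \<bind> ?F))"
      using fB sB by simp
    also have "\<dots> = (\<integral>\<^sup>+x. \<integral>\<^sup>+a. indicator B x \<partial>\<mu> x \<partial>r)"
      using fB by (subst nn_integral_bind_distr_Pair[OF \<mu> sr]) (auto simp: indicator_def)
    also have "\<dots> = (\<integral>\<^sup>+x. indicator B x \<partial>r)"
    proof (rule nn_integral_cong)
      fix x
      have "prob_space (\<mu> x)" using measurable_space[OF \<mu>, of x] by (simp add: space_prob_algebra)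
      then show "(\<integral>\<^sup>+a. indicator B x \<partial>\<mu> x) = indicator B x"
        by (simp add: prob_space.emeasure_space_1)
    qed
    finally show "emeasure (distr (r \<bind> ?F) borel fst) B = emeasure r B"
      using sr by simp
  qed (simp add: sr)
qed

section \<open>One-step dynamics of the state-action laws\<close>

context controlled_process
begin

lemma p_prob: "p \<in> space (prob_algebra borel)"
  using p by (simp add: prob_measures_def)

lemma next_state_law_prob:
  assumes "h \<in> space (histories k)"
  shows "(if k = 0 then p else q (h (k - 1))) \<in> space (prob_algebra borel)"
  using p_prob measurable_space[OF q, of "h (k - 1)"] by simp

lemma space_past: "space (past k) = space (histories k)"
  using sets_eq_imp_space_eq[OF sets_past] by (simp add: histories_def)

lemma prob_space_law: "prob_space (law q \<pi> p k)"
  unfolding law_def by (intro prob_space.prob_space_distr prob_space_process) measurable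

lemma sets_law[measurable_cong]: "sets (law q \<pi> p k) = sets borel"
  by (simp add: law_def)

lemma law_0: "law q \<pi> p 0 = p \<bind> (\<lambda>x. distr (\<pi> 0 (\<lambda>_. undefined) x) borel (Pair x))"
proof -
  have "law q \<pi> p 0 = next_pair q \<pi> p 0 (\<lambda>_. undefined)"
    unfolding law_eq_bind IT.C.simps
    by (rule bind_return[OF IT.P[of 0]]) (simp add: space_PiM)
  then show ?thesis by (simp add: next_pair_def)
qed

text \<open>Lets transitions be computed from the law of the latest pair, although the policy may
  depend on the entire history.\<close>

lemma bind_past_state:
  assumes N: "N \<in> borel \<rightarrow>\<^sub>M subprob_algebra borel"
  shows "past (Suc k) \<bind> (\<lambda>h. N (h k)) = law q \<pi> p k \<bind> N"
proof -
  have "(\<lambda>\<omega>. \<omega> k) \<in> past (Suc k) \<rightarrow>\<^sub>M borel"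
    using measurable_component_singleton[of k "{0..<Suc k}" "\<lambda>_. borel"] by (simp add: sets_past cong: measurable_cong_sets)
  then show ?thesis
    unfolding law_eq_past by (intro bind_distr[OF _ N, symmetric] prob_space.not_empty[OF prob_space_past])
qed

text \<open>Projection to the state forgets the action drawn at time \<open>Suc k\<close>, and with
  it every trace of how the policy uses the history. Both the majorization and the approximate
  invariance of occupation measures rest on this recursion.\<close>

lemma distr_fst_law_Suc: "distr (law q \<pi> p (Suc k)) borel fst = law q \<pi> p k \<bind> q"
proof -
  have fst: "fst \<in> (borel :: ('x \<times> 'a) measure) \<rightarrow>\<^sub>M borel"
    by (intro borel_measurable_continuous_onI continuous_on_fst continuous_on_id)
  have "distr (law q \<pi> p (Suc k)) borel fst = past (Suc k) \<bind> (\<lambda>h. distr (next_pair q \<pi> p (Suc k) h) borel fst)"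
    unfolding law_eq_bind by (rule distr_bind[OF measurable_next_pair prob_space.not_empty[OF prob_space_past] fst])
  also have "\<dots> = past (Suc k) \<bind> (\<lambda>h. q (h k))"
  proof (rule bind_cong[OF refl])
    fix h assume "h \<in> space (past (Suc k))"
    then have "h \<in> space (histories (Suc k))" by (simp add: space_past)
    from distr_fst_bind_distr_Pair[OF kernel_measurable[OF this] next_state_law_prob[OF this]]
    show "distr (next_pair q \<pi> p (Suc k) h) borel fst = q (h k)"
      by (simp add: next_pair_def)
  qed
  also have "\<dots> = law q \<pi> p k \<bind> q"
    by (rule bind_past_state[OF measurable_prob_algebraD[OF q]])
  finally show ?thesis .
qed

text \<open>Condition (M) bounds \<open>q\<close> at admissible pairs only; this allows the bound to
  be integrated almost everywhere.\<close>

lemma emeasure_law_graph: "emeasure (law q \<pi> p k) (graph A) = 1"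
proof -
  have "emeasure (law q \<pi> p k) (graph A) = (\<integral>\<^sup>+h. emeasure (next_pair q \<pi> p k h) (graph A) \<partial>past k)"
    unfolding law_eq_bind
    by (rule emeasure_bind[OF prob_space.not_empty[OF prob_space_past] measurable_next_pair graph])
  also have "\<dots> = (\<integral>\<^sup>+h. 1 \<partial>past k)"
  proof (rule nn_integral_cong)
    fix h assume "h \<in> space (past k)"
    then have h: "h \<in> space (histories k)" by (simp add: space_past)
    let ?r = "if k = 0 then p else q (h (k - 1))"
    have r: "prob_space ?r" "sets ?r = sets borel"
      using next_state_law_prob[OF h] by (auto simp: space_prob_algebra)
    have \<mu>: "sets (\<pi> k h x) = sets borel" for x
      using measurable_space[OF kernel_measurable[OF h], of x] by (simp add: space_prob_algebra)
    have "emeasure (next_pair q \<pi> p k h) (graph A) = (\<integral>\<^sup>+z. indicator (graph A) z \<partial>next_pair q \<pi> p k h)"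
      using IT.sets_P[of h k] h by (simp add: histories_def)
    also have "\<dots> = (\<integral>\<^sup>+x. \<integral>\<^sup>+a. indicator (graph A) (x, a) \<partial>\<pi> k h x \<partial>?r)"
      unfolding next_pair_def by (rule nn_integral_bind_distr_Pair[OF kernel_measurable[OF h] r(2)]) simp
    also have "\<dots> = (\<integral>\<^sup>+x. 1 \<partial>?r)"
    proof (rule nn_integral_cong)
      fix x
      have "(\<integral>\<^sup>+a. indicator (graph A) (x, a) \<partial>\<pi> k h x) = (\<integral>\<^sup>+a. indicator (A x) a \<partial>\<pi> k h x)"
        by (intro nn_integral_cong) (auto simp: graph_def indicator_def)
      also have "\<dots> = emeasure (\<pi> k h x) (A x)"
        using borel_open[OF discrete_topology_class.open_discrete[of "A x"]] by (intro nn_integral_indicator) (simp add: \<mu>)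
      also have "\<dots> = 1" using \<pi> h by (simp add: policies_def)
      finally show "(\<integral>\<^sup>+a. indicator (graph A) (x, a) \<partial>\<pi> k h x) = 1" .
    qed
    also have "\<dots> = 1" using prob_space.emeasure_space_1[OF r(1)] by simp
    finally show "emeasure (next_pair q \<pi> p k h) (graph A) = 1" .
  qed
  also have "\<dots> = 1" using prob_space.emeasure_space_1[OF prob_space_past] by simp
  finally show ?thesis .
qed

lemma nn_integral_process:
  assumes [measurable]: "f \<in> borel_measurable borel"
  shows "(\<integral>\<^sup>+\<omega>. (\<Sum>k<n. f (\<omega> k)) \<partial>process q \<pi> p) = (\<Sum>k<n. \<integral>\<^sup>+z. f z \<partial>law q \<pi> p k)"
  unfolding law_def by (subst nn_integral_sum) (auto simp: nn_integral_distr)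

end

text \<open>By invariance, \<open>p\<close> joined with \<open>\<mu>\<close> and moved by
  \<open>q\<close> is \<open>p\<close> again (\<open>pq\<close>). Hence the state has distribution
  \<open>p\<close> at every time, and the action is drawn afresh from \<open>\<mu>\<close>.\<close>

lemma stationary_law:
  assumes "controlled_process A q (stationary \<mu>) p" and inv: "invariant_measure q \<mu> p"
  shows "law q (stationary \<mu>) p k = p \<bind> (\<lambda>x. distr (\<mu> x) borel (Pair x))"
proof -
  interpret controlled_process A q "stationary \<mu>" p by fact
  have \<mu>: "\<mu> \<in> borel \<rightarrow>\<^sub>M prob_algebra borel"
    using kernel_measurable[of "\<lambda>_. undefined" 0] by (simp add: stationary_def histories_def space_PiM)
  let ?F = "\<lambda>x. distr (\<mu> x) (borel :: ('a \<times> 'b) measure) (Pair x)"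
  have F: "?F \<in> borel \<rightarrow>\<^sub>M subprob_algebra borel"
    by (rule measurable_prob_algebraD[OF measurable_distr_Pair[OF \<mu>]])
  have q': "q \<in> borel \<rightarrow>\<^sub>M subprob_algebra borel" by (rule measurable_prob_algebraD[OF q])
  have ps: "sets p = sets borel" "prob_space p" using p_prob by (auto simp: space_prob_algebra)
  have pq: "(p \<bind> ?F) \<bind> q = p"
  proof (rule measure_eqI)
    have F': "?F \<in> p \<rightarrow>\<^sub>M subprob_algebra borel" using F ps by (simp cong: measurable_cong_sets)
    have sF: "sets (p \<bind> ?F) = sets borel"
      by (rule sets_bind[OF sets_kernel[OF F']]) (auto simp: prob_space.not_empty[OF ps(2)])
    have ne: "space (p \<bind> ?F) \<noteq> {}" using sets_eq_imp_space_eq[OF sF] by simp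
    have q'': "q \<in> (p \<bind> ?F) \<rightarrow>\<^sub>M subprob_algebra borel" using q' sF by (simp cong: measurable_cong_sets)
    show s: "sets ((p \<bind> ?F) \<bind> q) = sets p"
      unfolding ps(1) by (rule sets_bind[OF sets_kernel[OF q''] ne])
    fix B assume "B \<in> sets ((p \<bind> ?F) \<bind> q)"
    then have B: "B \<in> sets borel" using s ps by simp
    have "emeasure ((p \<bind> ?F) \<bind> q) B = (\<integral>\<^sup>+z. emeasure (q z) B \<partial>(p \<bind> ?F))"
      by (rule emeasure_bind[OF ne q'' B])
    also have "\<dots> = (\<integral>\<^sup>+x. \<integral>\<^sup>+a. emeasure (q (x, a)) B \<partial>\<mu> x \<partial>p)"
      by (rule nn_integral_bind_distr_Pair[OF \<mu> ps(1)])
        (rule measurable_compose[OF q' measurable_emeasure_subprob_algebra[OF B]])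
    also have "\<dots> = emeasure p B" using inv B by (simp add: invariant_measure_def)
    finally show "emeasure ((p \<bind> ?F) \<bind> q) B = emeasure p B" .
  qed
  show ?thesis
  proof (induction k)
    case 0
    then show ?case using law_0 by (simp add: stationary_def)
  next
    case (Suc k)
    have qh: "(\<lambda>h. q (h k)) \<in> past (Suc k) \<rightarrow>\<^sub>M subprob_algebra borel"
      using measurable_compose[OF measurable_component_singleton[of k "{0..<Suc k}" "\<lambda>_. borel"] q']
      by (simp add: sets_past cong: measurable_cong_sets)
    have "law q (stationary \<mu>) p (Suc k) = past (Suc k) \<bind> (\<lambda>h. q (h k) \<bind> ?F)"
      unfolding law_eq_bind by (intro bind_cong refl) (simp add: next_pair_def stationary_def)
    also have "\<dots> = (past (Suc k) \<bind> (\<lambda>h. q (h k))) \<bind> ?F"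
      by (rule bind_assoc[OF qh F, symmetric])
    also have "past (Suc k) \<bind> (\<lambda>h. q (h k)) = (p \<bind> ?F) \<bind> q"
      unfolding bind_past_state[OF q'] Suc.IH ..
    also have "\<dots> = p" by (rule pq)
    finally show ?case .
  qed
qed

section \<open>Occupation measures\<close>

text \<open>Starting at time 1 makes the majorization hold exactly: the law of \<open>x\<^sub>0\<close> is not majorized.\<close>

definition occupation ::
  "('x::topological_space \<times> 'a::topological_space \<Rightarrow> 'x measure) \<Rightarrow> ('x, 'a) policy \<Rightarrow> 'x measure
    \<Rightarrow> nat \<Rightarrow> ('x \<times> 'a) measure" where
  "occupation q \<pi> p n = measure_pmf (pmf_of_set {1..n}) \<bind> law q \<pi> p"

context controlled_process
begin

lemma law_kernel: "law q \<pi> p \<in> measure_pmf P \<rightarrow>\<^sub>M subprob_algebra borel"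
  using prob_space_law by (auto simp: measurable_pmf_measure1 space_subprob_algebra sets_law prob_space_imp_subprob_space)

lemma sets_occupation[measurable_cong]: "sets (occupation q \<pi> p n) = sets borel"
  unfolding occupation_def by (rule sets_bind[OF sets_kernel[OF law_kernel]]) auto

lemma nn_integral_occupation:
  assumes "f \<in> borel_measurable borel" "0 < n"
  shows "(\<integral>\<^sup>+z. f z \<partial>occupation q \<pi> p n) = (\<Sum>k\<in>{1..n}. \<integral>\<^sup>+z. f z \<partial>law q \<pi> p k) / of_nat n"
  unfolding occupation_def nn_integral_bind[OF assms(1) law_kernel]
  using assms(2) by (subst nn_integral_pmf_of_set) auto

lemma nn_integral_occupation_le:
  assumes f: "f \<in> borel_measurable borel" and n: "0 < n" and le: "\<And>k. 0 < k \<Longrightarrow> (\<integral>\<^sup>+z. f z \<partial>law q \<pi> p k) \<le> c"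
  shows "(\<integral>\<^sup>+z. f z \<partial>occupation q \<pi> p n) \<le> c"
proof -
  have "(\<Sum>k\<in>{1..n}. \<integral>\<^sup>+z. f z \<partial>law q \<pi> p k) \<le> (\<Sum>k\<in>{1..n}. c)"
    by (intro sum_mono le) auto
  then have "(\<integral>\<^sup>+z. f z \<partial>occupation q \<pi> p n) \<le> (of_nat n * c) / of_nat n"
    unfolding nn_integral_occupation[OF f n] by (intro divide_right_mono_ennreal) simp
  also have "\<dots> = c" using n by (simp add: mult.commute[of "of_nat n"] ennreal_mult_divide_eq)
  finally show ?thesis .
qed

lemma prob_space_occupation:
  assumes "0 < n"
  shows "prob_space (occupation q \<pi> p n)"
proof (rule prob_spaceI)
  have "emeasure (occupation q \<pi> p n) (space (occupation q \<pi> p n)) = (\<integral>\<^sup>+z. 1 \<partial>occupation q \<pi> p n)"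
    by simp
  also have "\<dots> = (\<Sum>k\<in>{1..n}. 1) / of_nat n"
    using prob_space.emeasure_space_1[OF prob_space_law] by (subst nn_integral_occupation) (auto simp: assms)
  also have "\<dots> = 1" using assms by (simp add: ennreal_of_nat_eq_real_of_nat divide_ennreal)
  finally show "emeasure (occupation q \<pi> p n) (space (occupation q \<pi> p n)) = 1" .
qed

lemma nn_integral_law_Suc_fst:
  assumes f[measurable]: "f \<in> borel_measurable borel"
  shows "(\<integral>\<^sup>+z. f (fst z) \<partial>law q \<pi> p (Suc k)) = (\<integral>\<^sup>+z. \<integral>\<^sup>+y. f y \<partial>q z \<partial>law q \<pi> p k)"
proof -
  have [measurable]: "fst \<in> (borel :: ('x \<times> 'a) measure) \<rightarrow>\<^sub>M borel"
    by (intro borel_measurable_continuous_onI continuous_on_fst continuous_on_id)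
  have q': "q \<in> law q \<pi> p k \<rightarrow>\<^sub>M subprob_algebra borel"
    using measurable_prob_algebraD[OF q] by (simp add: sets_law cong: measurable_cong_sets)
  have "(\<integral>\<^sup>+z. f (fst z) \<partial>law q \<pi> p (Suc k)) = (\<integral>\<^sup>+x. f x \<partial>distr (law q \<pi> p (Suc k)) borel fst)"
    by (simp add: nn_integral_distr)
  also have "\<dots> = (\<integral>\<^sup>+z. \<integral>\<^sup>+y. f y \<partial>q z \<partial>law q \<pi> p k)"
    unfolding distr_fst_law_Suc by (rule nn_integral_bind[OF f q'])
  finally show ?thesis .
qed

text \<open>For a fixed action, dropping the action leaves an event about the state alone, to which
  the bound on transitions applies. Summing over actions charges \<open>\<nu>\<close> once per
  element of \<open>A'\<close>, hence the finiteness.\<close>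

lemma emeasure_occupation_majorized:
  assumes n: "0 < n" and A': "finite A'" and [measurable]: "V \<in> sets borel" "E \<in> sets borel"
    and le: "\<And>B x a. B \<in> sets borel \<Longrightarrow> (x, a) \<in> graph A \<Longrightarrow> emeasure (q (x, a)) (V \<inter> B) \<le> emeasure \<nu> B"
  shows "emeasure (occupation q \<pi> p n) ((V \<times> A') \<inter> E) \<le> (\<Sum>a\<in>A'. emeasure \<nu> ((\<lambda>x. (x, a)) -` E))"
proof -
  have mp: "(\<lambda>x. (x, a)) \<in> borel \<rightarrow>\<^sub>M (borel :: ('x \<times> 'a) measure)" for a
    by (simp add: measurable_cong_sets[OF refl sets_borel_state_action])
  have [measurable]: "(\<lambda>x. (x, a)) -` E \<in> sets borel" for a
    using measurable_sets[OF mp, of E] by simp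
  have [measurable]: "V \<times> A' \<in> sets borel"
    unfolding sets_borel_state_action using borel_open[OF discrete_topology_class.open_discrete[of A']]
    by (intro pair_measureI) auto
  have "(\<integral>\<^sup>+z. indicator ((V \<times> A') \<inter> E) z \<partial>occupation q \<pi> p n) \<le> (\<Sum>a\<in>A'. emeasure \<nu> ((\<lambda>x. (x, a)) -` E))"
  proof (rule nn_integral_occupation_le[OF _ n])
    fix k :: nat assume "0 < k"
    \<comment> \<open>A positive time has a predecessor, and the state at time \<open>k\<close> is
      drawn from \<open>q\<close> at the admissible pair of time \<open>j\<close>.\<close>
    then obtain j where k: "k = Suc j" by (cases k) auto
    let ?B = "\<lambda>a. V \<inter> (\<lambda>x. (x, a)) -` E"
    have [measurable]: "fst \<in> (borel :: ('x \<times> 'a) measure) \<rightarrow>\<^sub>M borel"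
      by (intro borel_measurable_continuous_onI continuous_on_fst continuous_on_id)
    have "(\<integral>\<^sup>+z. indicator ((V \<times> A') \<inter> E) z \<partial>law q \<pi> p k) \<le> (\<integral>\<^sup>+z. (\<Sum>a\<in>A'. indicator (?B a) (fst z)) \<partial>law q \<pi> p k)"
    proof (rule nn_integral_mono)
      fix z :: "'x \<times> 'a"
      show "indicator ((V \<times> A') \<inter> E) z \<le> (\<Sum>a\<in>A'. indicator (?B a) (fst z) :: ennreal)"
      proof (cases "z \<in> (V \<times> A') \<inter> E")
        case True
        then have "snd z \<in> A'" "indicator (?B (snd z)) (fst z) = (1::ennreal)" by auto
        with member_le_sum[of "snd z" A' "\<lambda>a. indicator (?B a) (fst z) :: ennreal"] A' True show ?thesis
          by simp
      qed simp
    qed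
    also have "\<dots> = (\<Sum>a\<in>A'. \<integral>\<^sup>+z. indicator (?B a) (fst z) \<partial>law q \<pi> p k)"
      by (rule nn_integral_sum) measurable
    also have "\<dots> \<le> (\<Sum>a\<in>A'. emeasure \<nu> ((\<lambda>x. (x, a)) -` E))"
    proof (rule sum_mono)
      fix a
      have AE: "AE z in law q \<pi> p j. z \<in> graph A"
        using emeasure_law_graph[of j] prob_space.AE_in_set_eq_1[OF prob_space_law, of "graph A" j]
        by (simp add: sets_law measure_def)
      have "(\<integral>\<^sup>+z. indicator (?B a) (fst z) \<partial>law q \<pi> p k) = (\<integral>\<^sup>+z. \<integral>\<^sup>+y. indicator (?B a) y \<partial>q z \<partial>law q \<pi> p j)"
        unfolding k by (rule nn_integral_law_Suc_fst) measurable
      also have "\<dots> \<le> (\<integral>\<^sup>+z. emeasure \<nu> ((\<lambda>x. (x, a)) -` E) \<partial>law q \<pi> p j)"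
      proof (rule nn_integral_mono_AE, use AE in eventually_elim)
        fix z assume z: "z \<in> graph A"
        have "sets (q z) = sets borel"
          using measurable_space[OF q, of z] by (simp add: space_prob_algebra)
        then have "(\<integral>\<^sup>+y. indicator (?B a) y \<partial>q z) = emeasure (q z) (?B a)"
          by simp
        also have "\<dots> \<le> emeasure \<nu> ((\<lambda>x. (x, a)) -` E)"
          using le[of "(\<lambda>x. (x, a)) -` E" "fst z" "snd z"] z by simp
        finally show "(\<integral>\<^sup>+y. indicator (?B a) y \<partial>q z) \<le> emeasure \<nu> ((\<lambda>x. (x, a)) -` E)" .
      qed
      also have "\<dots> = emeasure \<nu> ((\<lambda>x. (x, a)) -` E)"
        using prob_space.emeasure_space_1[OF prob_space_law] by simp
      finally show "(\<integral>\<^sup>+z. indicator (?B a) (fst z) \<partial>law q \<pi> p k) \<le> emeasure \<nu> ((\<lambda>x. (x, a)) -` E)" .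
    qed
    finally show "(\<integral>\<^sup>+z. indicator ((V \<times> A') \<inter> E) z \<partial>law q \<pi> p k) \<le> (\<Sum>a\<in>A'. emeasure \<nu> ((\<lambda>x. (x, a)) -` E))" .
  qed measurable
  then show ?thesis by (simp add: sets_occupation)
qed

text \<open>By the recursion for laws, one side averages the transition integrals over the times
  \<open>0\<close> to \<open>n - 1\<close>, the other over \<open>1\<close> to \<open>n\<close>.
  They differ by one term at each end, each at most \<open>B\<close>. Two inequalities replace an
  absolute difference because subtraction in \<open>ennreal\<close> is truncated.\<close>

lemma nn_integral_occupation_shift:
  assumes f[measurable]: "f \<in> borel_measurable borel" and B: "\<And>x. f x \<le> ennreal B" and n: "0 < n"
  shows "(\<integral>\<^sup>+z. f (fst z) \<partial>occupation q \<pi> p n) \<le> (\<integral>\<^sup>+z. \<integral>\<^sup>+y. f y \<partial>q z \<partial>occupation q \<pi> p n) + ennreal B / of_nat n"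
    "(\<integral>\<^sup>+z. \<integral>\<^sup>+y. f y \<partial>q z \<partial>occupation q \<pi> p n) \<le> (\<integral>\<^sup>+z. f (fst z) \<partial>occupation q \<pi> p n) + ennreal B / of_nat n"
proof -
  have [measurable]: "fst \<in> (borel :: ('x \<times> 'a) measure) \<rightarrow>\<^sub>M borel"
    by (intro borel_measurable_continuous_onI continuous_on_fst continuous_on_id)
  have m: "(\<lambda>z. \<integral>\<^sup>+y. f y \<partial>q z) \<in> borel_measurable borel"
    using measurable_compose[OF measurable_prob_algebraD[OF q] nn_integral_measurable_subprob_algebra[OF f]] by simp
  let ?b = "\<lambda>k. \<integral>\<^sup>+z. \<integral>\<^sup>+y. f y \<partial>q z \<partial>law q \<pi> p k"
  have b_le: "?b k \<le> ennreal B" for k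
  proof -
    have "(\<integral>\<^sup>+y. f y \<partial>q z) \<le> ennreal B" for z
    proof -
      have "prob_space (q z)" using measurable_space[OF q, of z] by (simp add: space_prob_algebra)
      then have "(\<integral>\<^sup>+y. ennreal B \<partial>q z) = ennreal B" by (simp add: prob_space.emeasure_space_1)
      with nn_integral_mono[of "q z" f "\<lambda>_. ennreal B"] B show ?thesis by simp
    qed
    then have "?b k \<le> (\<integral>\<^sup>+z. ennreal B \<partial>law q \<pi> p k)" by (intro nn_integral_mono) auto
    then show ?thesis using prob_space.emeasure_space_1[OF prob_space_law] by simp
  qed
  have "(\<Sum>k\<in>{1..n}. \<integral>\<^sup>+z. f (fst z) \<partial>law q \<pi> p k) = (\<Sum>k<n. \<integral>\<^sup>+z. f (fst z) \<partial>law q \<pi> p (Suc k))"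
    by (rule sum.reindex_bij_witness[of _ Suc "\<lambda>k. k - 1"]) auto
  also have "\<dots> = (\<Sum>k<n. ?b k)"
    by (simp add: nn_integral_law_Suc_fst)
  finally have 1: "(\<integral>\<^sup>+z. f (fst z) \<partial>occupation q \<pi> p n) = (\<Sum>k<n. ?b k) / of_nat n"
    by (subst nn_integral_occupation[OF _ n]) auto
  have 2: "(\<integral>\<^sup>+z. \<integral>\<^sup>+y. f y \<partial>q z \<partial>occupation q \<pi> p n) = (\<Sum>k\<in>{1..n}. ?b k) / of_nat n"
    by (rule nn_integral_occupation[OF m n])
  have le1: "(\<Sum>k<n. ?b k) \<le> (\<Sum>k\<in>{1..n}. ?b k) + ennreal B"
  proof -
    have "(\<Sum>k<n. ?b k) \<le> (\<Sum>k\<in>insert 0 {1..n}. ?b k)" by (intro sum_mono2) auto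
    also have "\<dots> = ?b 0 + (\<Sum>k\<in>{1..n}. ?b k)" by simp
    also have "\<dots> \<le> (\<Sum>k\<in>{1..n}. ?b k) + ennreal B" using b_le[of 0] by (subst add.commute) (intro add_left_mono)
    finally show ?thesis .
  qed
  have le2: "(\<Sum>k\<in>{1..n}. ?b k) \<le> (\<Sum>k<n. ?b k) + ennreal B"
  proof -
    have "(\<Sum>k\<in>{1..n}. ?b k) \<le> (\<Sum>k\<in>insert n {..<n}. ?b k)" by (intro sum_mono2) auto
    also have "\<dots> = ?b n + (\<Sum>k<n. ?b k)" by simp
    also have "\<dots> \<le> (\<Sum>k<n. ?b k) + ennreal B" using b_le[of n] by (subst add.commute) (intro add_left_mono)
    finally show ?thesis .
  qed
  show "(\<integral>\<^sup>+z. f (fst z) \<partial>occupation q \<pi> p n) \<le> (\<integral>\<^sup>+z. \<integral>\<^sup>+y. f y \<partial>q z \<partial>occupation q \<pi> p n) + ennreal B / of_nat n"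
    unfolding 1 2 add_divide_distrib_ennreal[symmetric] by (intro divide_right_mono_ennreal le1)
  show "(\<integral>\<^sup>+z. \<integral>\<^sup>+y. f y \<partial>q z \<partial>occupation q \<pi> p n) \<le> (\<integral>\<^sup>+z. f (fst z) \<partial>occupation q \<pi> p n) + ennreal B / of_nat n"
    unfolding 1 2 add_divide_distrib_ennreal[symmetric] by (intro divide_right_mono_ennreal le2)
qed

text \<open>The times \<open>1\<close> to \<open>n\<close> are among the first \<open>Suc n\<close>
  stages, and the cost at time 0 is nonnegative. The divisor stays \<open>n\<close>;
  \<open>near_optimal_occupation\<close> pays for the mismatch with \<open>Suc n\<close>.\<close>

lemma nn_integral_occupation_cost:
  assumes f[measurable]: "f \<in> borel_measurable borel" and n: "0 < n"
  shows "(\<integral>\<^sup>+z. f z \<partial>occupation q \<pi> p n) \<le> (\<integral>\<^sup>+\<omega>. (\<Sum>k<Suc n. f (\<omega> k)) \<partial>process q \<pi> p) / of_nat n"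
proof -
  have "(\<Sum>k\<in>{1..n}. \<integral>\<^sup>+z. f z \<partial>law q \<pi> p k) \<le> (\<Sum>k<Suc n. \<integral>\<^sup>+z. f z \<partial>law q \<pi> p k)"
    by (intro sum_mono2) auto
  then show ?thesis
    unfolding nn_integral_occupation[OF f n] nn_integral_process[OF f] by (rule divide_right_mono_ennreal)
qed

end

section \<open>Disintegration over a countable action space\<close>

lemma sets_borel_discrete: "sets (borel :: 'a::discrete_topology measure) = UNIV"
  using borel_open[OF discrete_topology_class.open_discrete] by auto

lemma measurable_case_prod_count_space:
  fixes g :: "'a::countable \<Rightarrow> 'x \<Rightarrow> 'b"
  assumes "\<And>a. g a \<in> M \<rightarrow>\<^sub>M K"
  shows "(\<lambda>(x, a). g a x) \<in> M \<Otimes>\<^sub>M count_space UNIV \<rightarrow>\<^sub>M K"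
  unfolding case_prod_beta
  using measurable_compose[OF measurable_fst assms]
  by (rule measurable_compose_countable[where f = "\<lambda>a z. g a (fst z)" and g = snd]) simp

lemma countable_kernel:
  fixes w :: "'a::{countable,discrete_topology} \<Rightarrow> 'x::topological_space \<Rightarrow> ennreal"
  assumes w[measurable]: "\<And>a. w a \<in> borel_measurable borel"
    and total: "\<And>x. (\<integral>\<^sup>+a. w a x \<partial>count_space UNIV) = 1"
  defines "\<mu> \<equiv> \<lambda>x. density (count_space UNIV) (\<lambda>a. w a x)"
  shows "\<mu> \<in> borel \<rightarrow>\<^sub>M prob_algebra borel"
    "\<And>x f. (\<integral>\<^sup>+a. f a \<partial>\<mu> x) = (\<integral>\<^sup>+a. w a x * f a \<partial>count_space UNIV)"
proof -
  have sets: "sets (\<mu> x) = sets (borel :: 'a measure)" for x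
    by (simp add: \<mu>_def sets_borel_discrete)
  show int: "(\<integral>\<^sup>+a. f a \<partial>\<mu> x) = (\<integral>\<^sup>+a. w a x * f a \<partial>count_space UNIV)" for f :: "'a \<Rightarrow> ennreal" and x
    unfolding \<mu>_def by (rule nn_integral_density) auto
  have em: "emeasure (\<mu> x) X = (\<integral>\<^sup>+a. w a x * indicator X a \<partial>count_space UNIV)" for x and X :: "'a set"
    unfolding \<mu>_def by (rule emeasure_density) auto
  interpret C: sigma_finite_measure "count_space (UNIV :: 'a set)"
    by (rule sigma_finite_measure_count_space)
  have joint: "(\<lambda>(x, a). w a x * indicator X a) \<in> borel_measurable (borel \<Otimes>\<^sub>M count_space UNIV)" for X :: "'a set"
    by (rule measurable_case_prod_count_space) auto
  show "\<mu> \<in> borel \<rightarrow>\<^sub>M prob_algebra borel"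
  proof (rule measurable_prob_algebraI)
    show "prob_space (\<mu> x)" for x
      using total[of x] by (intro prob_spaceI) (simp add: em \<mu>_def[symmetric], simp add: \<mu>_def)
    then have sub: "subprob_space (\<mu> x)" for x by (rule prob_space_imp_subprob_space)
    show "\<mu> \<in> borel \<rightarrow>\<^sub>M subprob_algebra borel"
    proof (rule measurable_subprob_algebra)
      show "(\<lambda>x. emeasure (\<mu> x) X) \<in> borel_measurable borel" if "X \<in> sets borel" for X :: "'a set"
        unfolding em using C.borel_measurable_nn_integral[of "\<lambda>x a. w a x * indicator X a" borel] joint[of X] by simp
    qed (use sub sets in auto)
  qed
qed

text \<open>Over countably many actions the conditional probabilities are Radon-Nikodym derivatives,
  one per action, of the slices of \<open>\<gamma>\<close> with respect to its state marginal. They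
  sum to 1 and respect \<open>A\<close> only almost everywhere, whereas a policy has to be
  admissible at every state; on the exceptional set a measurable selector takes over.\<close>

lemma disintegration:
  fixes A :: "'x::topological_space \<Rightarrow> 'a::{countable,discrete_topology} set"
  assumes \<gamma>: "prob_space \<gamma>" "sets \<gamma> = sets borel" and A: "\<And>x. A x \<noteq> {}" "graph A \<in> sets borel"
    and full: "AE z in \<gamma>. z \<in> graph A"
  obtains \<mu> where "\<mu> \<in> borel \<rightarrow>\<^sub>M prob_algebra borel" "\<And>x. emeasure (\<mu> x) (A x) = 1"
    "\<gamma> = distr \<gamma> borel fst \<bind> (\<lambda>x. distr (\<mu> x) borel (Pair x))"
proof -
  interpret \<gamma>: prob_space \<gamma> by (rule \<gamma>)
  note \<gamma>(2)[measurable_cong]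
  have space_\<gamma>[simp]: "space \<gamma> = UNIV" using sets_eq_imp_space_eq[OF \<gamma>(2)] by simp
  have fst[measurable]: "fst \<in> (borel :: ('x \<times> 'a) measure) \<rightarrow>\<^sub>M borel"
    by (intro borel_measurable_continuous_onI continuous_on_fst continuous_on_id)
  have slice_meas: "(\<lambda>x. (x, a)) \<in> borel \<rightarrow>\<^sub>M (borel :: ('x \<times> 'a) measure)" for a
    by (simp add: measurable_cong_sets[OF refl sets_borel_state_action])
  have slice: "{x. (x, a) \<in> E} \<in> sets borel" if "E \<in> sets borel" for a and E :: "('x \<times> 'a) set"
    using measurable_sets[OF slice_meas that] by (simp add: vimage_def)
  have rect: "B \<times> {a} \<in> sets (borel :: ('x \<times> 'a) measure)" if "B \<in> sets borel" for B a
    unfolding sets_borel_state_action using that by (intro pair_measureI) (simp_all add: sets_borel_discrete)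
  have A_meas[measurable]: "{x. a \<in> A x} \<in> sets borel" for a
    using slice[OF A(2), of a] by (simp add: graph_def)
  define p where "p = distr \<gamma> borel fst"
  have p_sets[measurable_cong]: "sets p = sets borel" by (simp add: p_def)
  have p_space[simp]: "space p = UNIV" by (simp add: p_def)
  interpret p: prob_space p unfolding p_def by (rule \<gamma>.prob_space_distr) measurable
  have p_em: "emeasure p B = emeasure \<gamma> (B \<times> UNIV)" if "B \<in> sets borel" for B
  proof -
    have "fst -` B = B \<times> (UNIV :: 'a set)" by auto
    then show ?thesis using that by (simp add: p_def emeasure_distr)
  qed
  \<comment> \<open>The part of \<open>\<gamma>\<close> with action \<open>a\<close>, projected to
    the states.\<close>
  define \<nu> where "\<nu> a = distr (density \<gamma> (indicator (UNIV \<times> {a}))) borel fst" for a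
  have \<nu>_em: "emeasure (\<nu> a) B = emeasure \<gamma> (B \<times> {a})" if [measurable]: "B \<in> sets borel" for a B
  proof -
    have [measurable]: "UNIV \<times> {a} \<in> sets (borel :: ('x \<times> 'a) measure)" by (rule rect) simp
    have "emeasure (\<nu> a) B = emeasure (density \<gamma> (indicator (UNIV \<times> {a}))) (fst -` B)"
      unfolding \<nu>_def by (subst emeasure_distr) auto
    also have "\<dots> = (\<integral>\<^sup>+z. indicator (UNIV \<times> {a}) z * indicator (fst -` B) z \<partial>\<gamma>)"
      using measurable_sets[OF fst that] by (intro emeasure_density) (auto simp: \<gamma>(2))
    also have "\<dots> = (\<integral>\<^sup>+z. indicator (B \<times> {a}) z \<partial>\<gamma>)"
      by (intro nn_integral_cong) (auto split: split_indicator)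
    also have "\<dots> = emeasure \<gamma> (B \<times> {a})"
      using rect[OF that] by (simp add: \<gamma>(2))
    finally show ?thesis .
  qed
  define f where "f a = RN_deriv p (\<nu> a)" for a
  have f_meas[measurable]: "f a \<in> borel_measurable borel" for a
    using borel_measurable_RN_deriv[of p "\<nu> a"] by (simp add: f_def p_sets cong: measurable_cong_sets)
  have f_dens: "density p (f a) = \<nu> a" for a
    unfolding f_def
  proof (rule p.density_RN_deriv)
    show "absolutely_continuous p (\<nu> a)"
      unfolding absolutely_continuous_def
    proof safe
      fix B assume "B \<in> null_sets p"
      then have B: "B \<in> sets borel" "emeasure p B = 0" by (auto simp: null_sets_def p_sets)
      have "emeasure \<gamma> (B \<times> {a}) \<le> emeasure \<gamma> (B \<times> UNIV)"
      proof (rule emeasure_mono)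
        have "fst -` B = B \<times> (UNIV :: 'a set)" by auto
        then show "B \<times> UNIV \<in> sets \<gamma>"
          using measurable_sets[OF fst B(1)] by (simp add: \<gamma>(2))
      qed auto
      then show "B \<in> null_sets (\<nu> a)"
        using B p_em[OF B(1)] \<nu>_em[OF B(1)] by (simp add: null_sets_def \<nu>_def)
    qed
  qed (simp add: \<nu>_def p_sets)
  have f_int: "(\<integral>\<^sup>+x. f a x * indicator B x \<partial>p) = emeasure \<gamma> (B \<times> {a})" if "B \<in> sets borel" for a B
    using f_dens[of a] \<nu>_em[OF that, of a] emeasure_density[of "f a" p B] that by (simp add: p_sets)
  interpret C: sigma_finite_measure "count_space (UNIV :: 'a set)"
    by (rule sigma_finite_measure_count_space)
  interpret pC: pair_sigma_finite p "count_space (UNIV :: 'a set)" ..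
  have pair_meas: "(\<lambda>(x, a). g a x) \<in> borel_measurable (borel \<Otimes>\<^sub>M count_space UNIV)"
    if "\<And>a. g a \<in> borel_measurable borel" for g :: "'a \<Rightarrow> 'x \<Rightarrow> ennreal"
    using that by (rule measurable_case_prod_count_space)
  have swap: "(\<integral>\<^sup>+x. \<integral>\<^sup>+a. g a x \<partial>count_space UNIV \<partial>p) = (\<integral>\<^sup>+a. \<integral>\<^sup>+x. g a x \<partial>p \<partial>count_space UNIV)"
    if "\<And>a. g a \<in> borel_measurable borel" for g :: "'a \<Rightarrow> 'x \<Rightarrow> ennreal"
    using pC.Fubini'[of "\<lambda>x a. g a x"] pair_meas[OF that] by (simp cong: measurable_cong_sets)
  have slices: "(\<integral>\<^sup>+a. emeasure \<gamma> ({x. (x, a) \<in> E} \<times> {a}) \<partial>count_space UNIV) = emeasure \<gamma> E" if "E \<in> sets borel" for E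
  proof -
    have "emeasure \<gamma> (\<Union>a. {x. (x, a) \<in> E} \<times> {a}) = (\<integral>\<^sup>+a. emeasure \<gamma> ({x. (x, a) \<in> E} \<times> {a}) \<partial>count_space UNIV)"
      by (rule emeasure_UN_countable) (auto simp: \<gamma>(2) rect slice that disjoint_family_on_def)
    moreover have "(\<Union>a. {x. (x, a) \<in> E} \<times> {a}) = E" by auto
    ultimately show ?thesis by simp
  qed
  define s where "s x = (\<integral>\<^sup>+a. f a x \<partial>count_space UNIV)" for x
  have s_meas[measurable]: "s \<in> borel_measurable borel"
    unfolding s_def by (rule C.borel_measurable_nn_integral[OF pair_meas[OF f_meas]])
  \<comment> \<open>Summing the slices over all actions gives back the state marginal, so uniqueness
    of densities yields \<open>s = 1\<close> almost everywhere.\<close>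
  have "density p s = density p (\<lambda>_. 1)"
  proof (rule measure_eqI)
    fix B assume "B \<in> sets (density p s)"
    then have B[measurable]: "B \<in> sets borel" by (simp add: p_sets)
    have BU: "B \<times> UNIV \<in> sets (borel :: ('x \<times> 'a) measure)"
    proof -
      have "fst -` B = B \<times> (UNIV :: 'a set)" by auto
      then show ?thesis using measurable_sets[OF fst B] by simp
    qed
    have "emeasure (density p s) B = (\<integral>\<^sup>+x. \<integral>\<^sup>+a. f a x * indicator B x \<partial>count_space UNIV \<partial>p)"
      by (simp add: emeasure_density s_def nn_integral_multc)
    also have "\<dots> = (\<integral>\<^sup>+a. emeasure \<gamma> ({x. (x, a) \<in> B \<times> UNIV} \<times> {a}) \<partial>count_space UNIV)"
      by (subst swap) (auto simp: f_int)
    also have "\<dots> = emeasure p B"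
      by (subst slices[OF BU]) (simp add: p_em)
    finally show "emeasure (density p s) B = emeasure (density p (\<lambda>_. 1)) B"
      by (simp add: density_1)
  qed simp
  then have s_1: "AE x in p. s x = 1"
    by (subst (asm) p.density_unique_iff) auto
  have f_0: "AE x in p. \<forall>a. a \<notin> A x \<longrightarrow> f a x = 0"
    unfolding AE_all_countable
  proof
    fix a
    have [measurable]: "{x. a \<notin> A x} \<in> sets borel"
      using sets.compl_sets[OF A_meas[of a]] by (simp add: Collect_neg_eq Compl_eq_Diff_UNIV)
    have "emeasure \<gamma> ({x. a \<notin> A x} \<times> {a}) = 0"
    proof -
      have "AE z in \<gamma>. z \<notin> {x. a \<notin> A x} \<times> {a}"
        using full by eventually_elim (auto simp: graph_def)
      then show ?thesis
        using rect[of "{x. a \<notin> A x}" a] by (subst (asm) AE_iff_measurable[OF _ refl]) (auto simp: \<gamma>(2))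
    qed
    then have "(\<integral>\<^sup>+x. f a x * indicator {x. a \<notin> A x} x \<partial>p) = 0"
      by (subst f_int) auto
    then have "AE x in p. f a x * indicator {x. a \<notin> A x} x = 0"
      by (subst (asm) nn_integral_0_iff_AE) auto
    then show "AE x in p. a \<notin> A x \<longrightarrow> f a x = 0"
      by eventually_elim (auto split: split_indicator_asm)
  qed
  define good where "good x \<longleftrightarrow> s x = 1 \<and> (\<forall>a. a \<notin> A x \<longrightarrow> f a x = 0)" for x
  have eq_pred: "Measurable.pred borel (\<lambda>x. g x = c)" if "g \<in> borel_measurable borel" for g :: "'x \<Rightarrow> ennreal" and c
    unfolding pred_def using measurable_sets[OF that, of "{c}"] by (simp add: vimage_def)
  have [measurable]: "Measurable.pred borel (\<lambda>x. a \<in> A x)" for a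
    unfolding pred_def using A_meas[of a] by simp
  have [measurable]: "Measurable.pred borel good"
    unfolding good_def by (intro pred_intros_logic pred_intros_countable eq_pred s_meas f_meas) measurable
  \<comment> \<open>The admissible action of least code. It exists at every state because
    \<open>A x\<close> is nonempty, and it is a measurable choice because only countably many
    memberships are compared.\<close>
  define first where "first a x \<longleftrightarrow> a \<in> A x \<and> (\<forall>b. to_nat b < to_nat a \<longrightarrow> b \<notin> A x)" for a x
  have [measurable]: "Measurable.pred borel (first a)" for a
    unfolding first_def by measurable
  define w where "w a x = (if good x then f a x else if first a x then 1 else 0)" for a x
  have w_meas[measurable]: "w a \<in> borel_measurable borel" for a
    unfolding w_def by measurable
  have w_total: "(\<integral>\<^sup>+a. w a x \<partial>count_space UNIV) = 1" for x
  proof (cases "good x")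
    case True
    then show ?thesis by (simp add: w_def good_def s_def)
  next
    case False
    obtain a where a: "a \<in> A x" "\<And>b. b \<in> A x \<Longrightarrow> to_nat a \<le> to_nat b"
      using ex_has_least_nat[of "\<lambda>a. a \<in> A x" _ to_nat] A(1)[of x] by (metis ex_in_conv)
    have "first b x \<longleftrightarrow> b = a" for b
    proof
      assume b: "first b x"
      then have "to_nat b \<le> to_nat a"
        using a(1) unfolding first_def by (meson not_less)
      moreover have "to_nat a \<le> to_nat b"
        using a(2) b by (simp add: first_def)
      ultimately show "b = a" by simp
    next
      assume "b = a"
      then show "first b x"
        using a(1,2) leD unfolding first_def by blast
    qed
    then have "(\<integral>\<^sup>+b. w b x \<partial>count_space UNIV) = (\<integral>\<^sup>+b. indicator {a} b \<partial>count_space UNIV)"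
      using False by (intro nn_integral_cong) (auto simp: w_def)
    then show ?thesis by simp
  qed
  define \<mu> where "\<mu> x = density (count_space UNIV) (\<lambda>a. w a x)" for x
  note \<mu> = countable_kernel[OF w_meas w_total, folded \<mu>_def]
  have \<mu>_sets: "sets (\<mu> x) = UNIV" for x by (simp add: \<mu>_def)
  show thesis
  proof (rule that[of \<mu>])
    show \<mu>_m: "\<mu> \<in> borel \<rightarrow>\<^sub>M prob_algebra borel" using \<mu>(1) by (simp add: \<mu>_def[abs_def])
    have \<mu>_int: "(\<integral>\<^sup>+a. g a \<partial>\<mu> x) = (\<integral>\<^sup>+a. w a x * g a \<partial>count_space UNIV)" for g x
      unfolding \<mu>_def using countable_kernel(2)[OF w_meas w_total] by simp
    show "emeasure (\<mu> x) (A x) = 1" for x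
    proof -
      have "emeasure (\<mu> x) (A x) = (\<integral>\<^sup>+a. indicator (A x) a \<partial>\<mu> x)"
        by (simp add: \<mu>_sets)
      also have "\<dots> = (\<integral>\<^sup>+a. w a x * indicator (A x) a \<partial>count_space UNIV)"
        by (rule \<mu>_int)
      also have "\<dots> = (\<integral>\<^sup>+a. w a x \<partial>count_space UNIV)"
        by (intro nn_integral_cong) (auto simp: w_def good_def first_def split: split_indicator)
      finally show ?thesis by (simp add: w_total)
    qed
    show "\<gamma> = distr \<gamma> borel fst \<bind> (\<lambda>x. distr (\<mu> x) borel (Pair x))"
      unfolding p_def[symmetric]
    proof (rule measure_eqI)
      have "(\<lambda>x. distr (\<mu> x) borel (Pair x)) \<in> p \<rightarrow>\<^sub>M subprob_algebra (borel :: ('x \<times> 'a) measure)"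
        using measurable_prob_algebraD[OF measurable_distr_Pair[OF \<mu>_m]] by (simp add: p_sets cong: measurable_cong_sets)
      then have sb: "sets (p \<bind> (\<lambda>x. distr (\<mu> x) borel (Pair x))) = sets (borel :: ('x \<times> 'a) measure)"
        by (intro sets_bind[OF sets_kernel]) auto
      then show "sets \<gamma> = sets (p \<bind> (\<lambda>x. distr (\<mu> x) borel (Pair x)))" by (simp add: \<gamma>(2))
      fix E assume "E \<in> sets \<gamma>"
      then have E[measurable]: "E \<in> sets borel" by (simp add: \<gamma>(2))
      have "emeasure (p \<bind> (\<lambda>x. distr (\<mu> x) borel (Pair x))) E = (\<integral>\<^sup>+z. indicator E z \<partial>(p \<bind> (\<lambda>x. distr (\<mu> x) borel (Pair x))))"
        using sb E by simp
      also have "\<dots> = (\<integral>\<^sup>+x. \<integral>\<^sup>+a. indicator E (x, a) \<partial>\<mu> x \<partial>p)"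
        by (rule nn_integral_bind_distr_Pair[OF \<mu>_m p_sets]) simp
      also have "\<dots> = (\<integral>\<^sup>+x. \<integral>\<^sup>+a. f a x * indicator {x. (x, a) \<in> E} x \<partial>count_space UNIV \<partial>p)"
        unfolding \<mu>_int
        by (intro nn_integral_cong_AE, use s_1 f_0 in eventually_elim)
          (auto intro!: nn_integral_cong simp: w_def good_def indicator_def)
      also have "\<dots> = (\<integral>\<^sup>+a. emeasure \<gamma> ({x. (x, a) \<in> E} \<times> {a}) \<partial>count_space UNIV)"
        using slice[OF E] by (subst swap) (auto simp: f_int)
      also have "\<dots> = emeasure \<gamma> E" by (rule slices[OF E])
      finally show "emeasure \<gamma> E = emeasure (p \<bind> (\<lambda>x. distr (\<mu> x) borel (Pair x))) E" by simp
    qed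
  qed
qed

section \<open>Existence of a minimum pair\<close>

text \<open>The type \<open>'a\<close> has only a discrete topology. Its copy
  \<open>'a discrete\<close> carries the metric structure that the compactness argument asks
  for.\<close>

lemma homeomorphism_state_action:
  fixes f :: "'x::topological_space \<Rightarrow> 'y::topological_space"
  assumes hom: "homeomorphism UNIV S f g"
  shows "homeomorphism UNIV (S \<times> UNIV)
    (\<lambda>z. (f (fst z), discrete (snd z :: 'a::discrete_topology))) (\<lambda>w. (g (fst w), of_discrete (snd w)))"
proof (rule homeomorphismI)
  have f: "continuous_on UNIV f" and g: "continuous_on S g"
    using hom by (auto simp: homeomorphism_def)
  have c: "continuous_on UNIV (discrete :: 'a \<Rightarrow> 'a discrete)" "continuous_on UNIV (of_discrete :: 'a discrete \<Rightarrow> 'a)"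
    by (simp_all add: continuous_on_open_vimage discrete_topology_class.open_discrete open_discrete)
  show "continuous_on UNIV (\<lambda>z. (f (fst z), discrete (snd z :: 'a)))"
    by (intro continuous_on_Pair continuous_on_compose2[OF f] continuous_on_compose2[OF c(1)]
        continuous_on_fst continuous_on_snd continuous_on_id) auto
  show "continuous_on (S \<times> UNIV) (\<lambda>w. (g (fst w), of_discrete (snd w) :: 'a))"
    by (intro continuous_on_Pair continuous_on_compose2[OF g] continuous_on_compose2[OF c(2)]
        continuous_on_fst continuous_on_snd continuous_on_id) auto
qed (use hom in \<open>auto simp: homeomorphism_def discrete_inverse of_discrete_inverse\<close>)

text \<open>The sets required here are preimages of generators of \<open>weak_conv_topology\<close>;
  that \<open>q\<close> takes values in \<open>prob_measures\<close> on \<open>D\<close> follows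
  from the topological space underlying the continuous map.\<close>

lemma continuous_map_weak_conv_integral:
  fixes q :: "'z::topological_space \<Rightarrow> 'x::topological_space measure" and f :: "'x \<Rightarrow> real"
  assumes q: "continuous_map (top_of_set D) weak_conv_topology q"
    and f: "continuous_on UNIV f" "bounded (range f)"
  shows "continuous_on D (\<lambda>z. \<integral>x. f x \<partial>q z)"
  unfolding continuous_on_open_invariant
proof (intro allI impI)
  fix V :: "real set" assume V: "open V"
  have "openin weak_conv_topology {p \<in> prob_measures. (\<integral>x. f x \<partial>p) \<in> V}"
    unfolding weak_conv_topology_def using f V by (intro topology_generated_by_Basis) auto
  from openin_continuous_map_preimage[OF q this]
  have "openin (top_of_set D) {z \<in> D. q z \<in> prob_measures \<and> (\<integral>x. f x \<partial>q z) \<in> V}"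
    by simp
  moreover have "q z \<in> prob_measures" if "z \<in> D" for z
  proof -
    have "topspace weak_conv_topology \<subseteq> (prob_measures :: 'x measure set)"
      unfolding weak_conv_topology_def topology_generated_by_topspace by auto
    then show ?thesis using continuous_map_image_subset_topspace[OF q] that by auto
  qed
  ultimately have "openin (top_of_set D) {z \<in> D. (\<integral>x. f x \<partial>q z) \<in> V}"
    by (smt (verit) Collect_cong)
  then obtain W where "open W" "{z \<in> D. (\<integral>x. f x \<partial>q z) \<in> V} = D \<inter> W"
    by (auto simp: openin_open)
  then show "\<exists>W. open W \<and> W \<inter> D = (\<lambda>z. \<integral>x. f x \<partial>q z) -` V \<inter> D"
    by (intro exI[of _ W]) auto
qed

section \<open>Auxiliary facts on costs, compact sets and uniform smallness\<close>

lemma ext_cost_measurable: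
  fixes c :: "'x::topological_space \<times> 'a::topological_space \<Rightarrow> ennreal"
  assumes "c \<in> borel_measurable (restrict_space borel (graph A))" "graph A \<in> sets borel"
  shows "ext_cost A c \<in> borel_measurable borel"
  unfolding ext_cost_def[abs_def] using assms
  by (subst measurable_If_restrict_space_iff) auto

text \<open>Continuity from above of a finite measure on finitely many slices. No policy occurs in
  the sum, so smallness obtained from it is uniform along the sequence of occupation
  measures.\<close>

lemma decseq_sum_emeasure_small:
  fixes E :: "nat \<Rightarrow> ('x::topological_space \<times> 'a::{countable,discrete_topology}) set"
  assumes \<nu>: "finite_measure \<nu>" "sets \<nu> = sets borel" and A': "finite A'"
    and E: "range E \<subseteq> sets borel" "decseq E" "(\<Inter>i. E i) = {}" and e: "0 < (e::real)"
  shows "\<exists>k. (\<Sum>a\<in>A'. emeasure \<nu> ((\<lambda>x. (x, a)) -` E k)) \<le> ennreal e"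
proof -
  interpret \<nu>: finite_measure \<nu> by fact
  have mp: "(\<lambda>x. (x, a)) \<in> borel \<rightarrow>\<^sub>M (borel :: ('x \<times> 'a) measure)" for a
    by (simp add: measurable_cong_sets[OF refl sets_borel_state_action])
  have "(\<lambda>k. \<Sum>a\<in>A'. emeasure \<nu> ((\<lambda>x. (x, a)) -` E k)) \<longlonglongrightarrow> (\<Sum>a\<in>A'. emeasure \<nu> {})"
  proof (rule tendsto_sum)
    fix a
    have "(\<lambda>k. emeasure \<nu> ((\<lambda>x. (x, a)) -` E k)) \<longlonglongrightarrow> emeasure \<nu> (\<Inter>k. (\<lambda>x. (x, a)) -` E k)"
    proof (rule Lim_emeasure_decseq)
      show "range (\<lambda>k. (\<lambda>x. (x, a)) -` E k) \<subseteq> sets \<nu>"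
        using measurable_sets[OF mp] E(1) by (auto simp: \<nu>(2))
      show "decseq (\<lambda>k. (\<lambda>x. (x, a)) -` E k)"
        using E(2) by (auto simp: decseq_def)
    qed (simp add: \<nu>.emeasure_finite)
    moreover have "(\<Inter>k. (\<lambda>x. (x, a)) -` E k) = {}"
      using E(3) by auto
    ultimately show "(\<lambda>k. emeasure \<nu> ((\<lambda>x. (x, a)) -` E k)) \<longlonglongrightarrow> emeasure \<nu> {}"
      by simp
  qed
  then have "(\<lambda>k. \<Sum>a\<in>A'. emeasure \<nu> ((\<lambda>x. (x, a)) -` E k)) \<longlonglongrightarrow> 0" by simp
  from order_tendstoD(2)[OF this, of "ennreal e"] e show ?thesis
    by (auto simp: eventually_sequentially intro: less_imp_le)
qed

lemma finite_compact_discrete: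
  fixes S :: "'a::discrete_topology set"
  assumes "compact S"
  shows "finite S"
proof -
  obtain F where "F \<subseteq> S" "finite F" "S \<subseteq> (\<Union>a\<in>F. {a})"
    using compactE_image[OF assms, of S "\<lambda>a. {a}"] discrete_topology_class.open_discrete by blast
  then show ?thesis by (auto intro: finite_subset)
qed

text \<open>The type \<open>'x\<close> is not declared Hausdorff; a compact set is closed because it
  is the preimage of its compact image in \<open>'y\<close>.\<close>

lemma compact_imp_borel_homeomorphic:
  fixes f :: "'x::topological_space \<Rightarrow> 'y::t2_space" and K :: "'x set"
  assumes hom: "homeomorphism UNIV S f g" and K: "compact K"
  shows "K \<in> sets borel"
proof -
  have f: "continuous_on UNIV f" "\<And>x. g (f x) = x" using hom by (auto simp: homeomorphism_def)
  have "compact (f ` K)"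
    using K continuous_on_subset[OF f(1)] by (intro compact_continuous_image) auto
  then have "closed (f -` (f ` K))"
    using f(1) by (intro closed_vimage) (auto intro: compact_imp_closed)
  moreover have "f -` (f ` K) = K"
    using f(2) by (metis inj_on_inverseI inj_vimage_image_eq)
  ultimately show ?thesis by simp
qed

text \<open>Markov's inequality: the function is at least \<open>C / e\<close> outside
  \<open>S\<close>, while its integral is at most \<open>C\<close>.\<close>

lemma (in prob_space) measure_ge_of_nn_integral_le:
  assumes f: "f \<in> borel_measurable M" "(\<integral>\<^sup>+z. f z \<partial>M) \<le> ennreal C" "0 < C"
    and S: "S \<in> sets M" "\<And>z. z \<in> space M \<Longrightarrow> z \<notin> S \<Longrightarrow> ennreal (C / e) \<le> f z" and e: "0 < e"
  shows "1 - e \<le> prob S"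
proof -
  have [measurable]: "S \<in> sets M" by fact
  have "ennreal (C / e) * ennreal (prob (space M - S)) = (\<integral>\<^sup>+z. ennreal (C / e) * indicator (space M - S) z \<partial>M)"
    by (simp add: nn_integral_cmult_indicator emeasure_eq_measure)
  also have "\<dots> \<le> (\<integral>\<^sup>+z. f z \<partial>M)"
    using S(2) by (intro nn_integral_mono) (auto split: split_indicator)
  also have "\<dots> \<le> ennreal C" by (rule f(2))
  finally have "C / e * prob (space M - S) \<le> C"
    using f(3) e by (simp add: ennreal_mult[symmetric])
  then have "prob (space M - S) \<le> e"
    using f(3) e by (simp add: field_simps)
  then show ?thesis by (simp add: prob_compl)
qed

text \<open>The summand \<open>1 / Suc j\<close> is the slack in near-optimality, which turns the
  upper limit into a strict bound on all late averages. The factor \<open>1 + 1 / Suc j\<close>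
  bounds \<open>Suc n / n\<close> for \<open>n > j\<close> and pays for leaving out time 0.\<close>

lemma near_optimal_occupation:
  assumes q: "q \<in> borel \<rightarrow>\<^sub>M prob_algebra borel" and graph: "graph A \<in> sets borel"
    and c: "ext_cost A c \<in> borel_measurable borel"
    and r: "(INF p\<in>prob_measures. INF \<pi>\<in>policies A. avg_cost A c q \<pi> p) = ennreal r" "0 \<le> r"
  shows "\<exists>\<pi> p n. controlled_process A q \<pi> p \<and> j < n \<and>
    (\<integral>\<^sup>+z. ext_cost A c z \<partial>occupation q \<pi> p n) \<le> ennreal ((r + 1 / Suc j) * (1 + 1 / Suc j))"
proof -
  define b where "b = r + 1 / Suc j"
  have b: "r < b" "0 < b" using r(2) by (auto simp: b_def intro: add_nonneg_pos)
  have "(INF p\<in>prob_measures. INF \<pi>\<in>policies A. avg_cost A c q \<pi> p) < ennreal b"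
    using b r by (simp add: ennreal_lessI)
  then obtain p \<pi> where p: "p \<in> prob_measures" and \<pi>: "\<pi> \<in> policies A" and less: "avg_cost A c q \<pi> p < ennreal b"
    by (auto simp: INF_less_iff)
  interpret controlled_process A q \<pi> p
    by standard (rule q \<pi> p graph)+
  let ?X = "\<lambda>n. \<integral>\<^sup>+\<omega>. (\<Sum>k<n. ext_cost A c (\<omega> k)) \<partial>process q \<pi> p"
  have "\<forall>\<^sub>F n in sequentially. ?X n / of_nat n < ennreal b"
    using less unfolding avg_cost_def by (rule Limsup_lessD)
  then obtain n0 where n0: "\<And>n. n \<ge> n0 \<Longrightarrow> ?X n / of_nat n < ennreal b"
    by (auto simp: eventually_sequentially)
  define n where "n = max n0 (Suc j)"
  have n: "j < n" "0 < n" "n0 \<le> Suc n" by (auto simp: n_def)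
  have div_mult: "y = y / of_nat (Suc n) * of_nat (Suc n)" for y :: ennreal
    by (simp add: ennreal_divide_times ennreal_of_nat_eq_real_of_nat divide_ennreal del: of_nat_Suc)
  have "?X (Suc n) = ?X (Suc n) / of_nat (Suc n) * of_nat (Suc n)"
    using div_mult .
  also have "\<dots> \<le> ennreal b * of_nat (Suc n)"
    using n0[OF n(3)] by (intro mult_right_mono) auto
  also have "\<dots> = ennreal (b * Suc n)"
    using b by (simp add: ennreal_of_nat_eq_real_of_nat ennreal_mult del: of_nat_Suc)
  finally have X: "?X (Suc n) \<le> ennreal (b * Suc n)" .
  have "(\<integral>\<^sup>+z. ext_cost A c z \<partial>occupation q \<pi> p n) \<le> ?X (Suc n) / of_nat n"
    by (rule nn_integral_occupation_cost[OF c n(2)])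
  also have "\<dots> \<le> ennreal (b * Suc n) / of_nat n"
    by (rule divide_right_mono_ennreal[OF X])
  also have "\<dots> = ennreal (b * Suc n / n)"
    using b n by (simp add: ennreal_of_nat_eq_real_of_nat divide_ennreal del: of_nat_Suc)
  also have "\<dots> \<le> ennreal (b * (1 + 1 / Suc j))"
  proof (rule ennreal_leI)
    have "real (Suc n) / n = 1 + 1 / n" using n by (simp add: field_simps)
    also have "\<dots> \<le> 1 + 1 / Suc j" using n by (simp add: frac_le)
    finally show "b * Suc n / n \<le> b * (1 + 1 / Suc j)"
      using b(2) by (metis less_imp_le mult_left_mono times_divide_eq_right)
  qed
  finally show ?thesis
    using n(1) controlled_process_axioms unfolding b_def by blast
qed

lemma stationary_in_policies:
  fixes A :: "'x::topological_space \<Rightarrow> 'a::{countable,discrete_topology} set"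
  assumes "\<mu> \<in> borel \<rightarrow>\<^sub>M prob_algebra borel" "\<And>x. emeasure (\<mu> x) (A x) = 1"
  shows "stationary \<mu> \<in> policies A"
proof -
  have "(\<lambda>(h, x). \<mu> x) \<in> (histories k :: (nat \<Rightarrow> 'x \<times> 'a) measure) \<Otimes>\<^sub>M borel \<rightarrow>\<^sub>M prob_algebra borel" for k
    unfolding case_prod_beta' by (rule measurable_compose[OF measurable_snd assms(1)])
  then show ?thesis
    using assms(2) by (simp add: policies_def stationary_def)
qed

text \<open>The law of the pair is the same at all times, so the averages are constant from
  \<open>n = 1\<close> on.\<close>

lemma avg_cost_stationary:
  assumes cp: "controlled_process A q (stationary \<mu>) p" and inv: "invariant_measure q \<mu> p"
    and c: "ext_cost A c \<in> borel_measurable borel"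
  shows "avg_cost A c q (stationary \<mu>) p = (\<integral>\<^sup>+z. ext_cost A c z \<partial>(p \<bind> (\<lambda>x. distr (\<mu> x) borel (Pair x))))"
proof -
  interpret controlled_process A q "stationary \<mu>" p by fact
  let ?I = "\<integral>\<^sup>+z. ext_cost A c z \<partial>(p \<bind> (\<lambda>x. distr (\<mu> x) borel (Pair x)))"
  have "(\<integral>\<^sup>+\<omega>. (\<Sum>k<n. ext_cost A c (\<omega> k)) \<partial>process q (stationary \<mu>) p) / of_nat n = ?I" if "0 < n" for n
    using that unfolding nn_integral_process[OF c] stationary_law[OF cp inv]
    by (simp add: mult.commute[of "of_nat n"] ennreal_mult_divide_eq)
  then have "(\<lambda>n. (\<integral>\<^sup>+\<omega>. (\<Sum>k<n. ext_cost A c (\<omega> k)) \<partial>process q (stationary \<mu>) p) / of_nat n) \<longlonglongrightarrow> ?I"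
    by (intro tendsto_eventually eventually_sequentiallyI[of 1]) auto
  then show ?thesis
    unfolding avg_cost_def by (intro lim_imp_Limsup) auto
qed

theorem theorem4p1:
  fixes S :: "'y::polish_space set"
    and A :: "'x::topological_space \<Rightarrow> 'a::{countable,discrete_topology} set"
    and c :: "'x \<times> 'a \<Rightarrow> ennreal"
    and q :: "'x \<times> 'a \<Rightarrow> 'x measure"
    and K :: "nat \<Rightarrow> 'x set"
    and A' :: "nat \<Rightarrow> 'a set"
  assumes borel_space: "S \<in> sets borel" "(UNIV :: 'x set) homeomorphic S"
    and actions: "\<And>x. A x \<noteq> {}" "graph A \<in> sets borel"
    and cost: "c \<in> borel_measurable (restrict_space borel (graph A))"
    and kernel: "q \<in> borel \<rightarrow>\<^sub>M prob_algebra borel"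
    and G: "\<exists>\<pi>\<in>policies A. \<exists>x. avg_cost A c q \<pi> (return borel x) < \<infinity>"
    and SU: "incseq K" "incseq A'" "\<And>n. compact (K n)" "\<And>n. compact (A' n)"
      "(\<lambda>n. INF z\<in>- (K n \<times> A' n). ext_cost A c z) \<longlonglongrightarrow> \<infinity>"
    and M: "\<And>n. \<exists>U \<nu> D.
      open U \<and> K n \<subseteq> U \<and>
      finite_measure \<nu> \<and> sets \<nu> = sets borel \<and>
      closed D \<and>
      continuous_map (top_of_set (D \<times> UNIV)) weak_conv_topology q \<and>
      lsc_on (D \<times> UNIV) (ext_cost A c) \<and>
      (\<forall>B\<in>sets borel. \<forall>(x, a)\<in>graph A. emeasure (q (x, a)) ((U - D) \<inter> B) \<le> emeasure \<nu> B)"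
  shows "\<exists>\<mu> p.
      stationary \<mu> \<in> policies A \<and>
      p \<in> prob_measures \<and>
      avg_cost A c q (stationary \<mu>) p =
        (INF p'\<in>prob_measures. INF \<pi>\<in>policies A. avg_cost A c q \<pi> p') \<and>
      invariant_measure q \<mu> p"
proof -
  let ?c = "ext_cost A c"
  define \<rho> where "\<rho> = (INF p'\<in>prob_measures. INF \<pi>\<in>policies A. avg_cost A c q \<pi> p')"
  have c_meas[measurable]: "?c \<in> borel_measurable borel"
    using cost actions(2) by (rule ext_cost_measurable)
  have fst_meas[measurable]: "fst \<in> (borel :: ('x \<times> 'a) measure) \<rightarrow>\<^sub>M borel"
    by (intro borel_measurable_continuous_onI continuous_on_fst continuous_on_id)
  obtain f g where hom: "homeomorphism (UNIV :: 'x set) S f g"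
    using borel_space(2) by (auto simp: homeomorphic_def)
  \<comment> \<open>Condition (G), with a point mass as initial distribution. A finite infimum can
    be approached from above at finite cost, and finite cost is what yields tightness and
    admissibility of the limit.\<close>
  have "\<rho> < \<infinity>"
  proof -
    from G obtain \<pi> x where "\<pi> \<in> policies A" "avg_cost A c q \<pi> (return borel x) < \<infinity>" by auto
    moreover have "return borel x \<in> prob_measures"
      by (auto simp: prob_measures_def space_prob_algebra intro: prob_space_return)
    ultimately show ?thesis unfolding \<rho>_def by (auto simp: INF_less_iff)
  qed
  then obtain r where r: "\<rho> = ennreal r" "0 \<le> r"
    by (cases \<rho>) auto
  let ?b = "\<lambda>j. (r + 1 / Suc j) * (1 + 1 / Suc j)"
  have "\<forall>j. \<exists>\<pi> p n. controlled_process A q \<pi> p \<and> j < n \<and> (\<integral>\<^sup>+z. ?c z \<partial>occupation q \<pi> p n) \<le> ennreal (?b j)"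
    using near_optimal_occupation[OF kernel actions(2) c_meas r(1)[unfolded \<rho>_def] r(2)] by blast
  then obtain \<pi> p n where cp: "\<And>j. controlled_process A q (\<pi> j) (p j)" and n: "\<And>j. j < n j"
    and cost_le: "\<And>j. (\<integral>\<^sup>+z. ?c z \<partial>occupation q (\<pi> j) (p j) (n j)) \<le> ennreal (?b j)"
    by metis
  have n_pos: "0 < n j" for j using n[of j] by simp
  define \<gamma> where "\<gamma> j = occupation q (\<pi> j) (p j) (n j)" for j
  have \<gamma>_prob: "prob_space (\<gamma> j)" for j
    unfolding \<gamma>_def by (rule controlled_process.prob_space_occupation[OF cp n_pos])
  have \<gamma>_sets[measurable_cong]: "sets (\<gamma> j) = sets borel" for j
    unfolding \<gamma>_def by (rule controlled_process.sets_occupation[OF cp])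
  have \<gamma>_space: "space (\<gamma> j) = UNIV" for j
    using sets_eq_imp_space_eq[OF \<gamma>_sets] by simp
  have hom': "homeomorphism UNIV (S \<times> UNIV)
      (\<lambda>z. (f (fst z), discrete (snd z :: 'a))) (\<lambda>w. (g (fst w), of_discrete (snd w)))"
    by (rule homeomorphism_state_action[OF hom])
  have KA_compact: "compact (K m \<times> A' m)" for m
    using SU(3,4) by (rule compact_Times)
  have KA_meas: "K m \<times> A' m \<in> sets borel" for m
    by (rule compact_imp_borel_homeomorphic[OF hom' KA_compact])
  have KA_inc: "incseq (\<lambda>m. K m \<times> A' m)"
    using SU(1,2) by (fastforce simp: incseq_def)
  have tight: "\<exists>m. \<forall>j. 1 - e \<le> measure (\<gamma> j) (K m \<times> A' m)" if e: "0 < e" for e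
  proof -
    \<comment> \<open>The value of \<open>?b\<close> at 0, which dominates all others. By (SU) the
      cost exceeds \<open>?C / e\<close> outside some \<open>K m \<times> A' m\<close>, so Markov's
      inequality applies to all \<open>\<gamma> j\<close> with the same \<open>m\<close>.\<close>
    let ?C = "(r + 1) * 2"
    have b_le: "?b j \<le> ?C" for j
      using r(2) by (intro mult_mono add_mono) auto
    have "\<forall>\<^sub>F m in sequentially. ennreal (?C / e) < (INF z\<in>- (K m \<times> A' m). ?c z)"
      by (rule order_tendstoD(1)[OF SU(5)]) simp
    then obtain m where m: "ennreal (?C / e) < (INF z\<in>- (K m \<times> A' m). ?c z)"
      by (auto simp: eventually_sequentially)
    have "1 - e \<le> measure (\<gamma> j) (K m \<times> A' m)" for j
    proof (rule prob_space.measure_ge_of_nn_integral_le[OF \<gamma>_prob, of ?c _ ?C])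
      show "(\<integral>\<^sup>+z. ?c z \<partial>\<gamma> j) \<le> ennreal ?C"
        using cost_le[of j] ennreal_leI[OF b_le[of j]] unfolding \<gamma>_def by (rule order_trans)
      show "ennreal (?C / e) \<le> ?c z" if "z \<notin> K m \<times> A' m" for z
        using m that by (intro less_imp_le[OF less_le_trans[OF m]] INF_lower) auto
    qed (use r(2) e KA_meas \<gamma>_sets in auto)
    then show ?thesis by auto
  qed
  obtain U \<nu> D where U: "\<And>m. open (U m)" "\<And>m. K m \<subseteq> U m"
    and \<nu>: "\<And>m. finite_measure (\<nu> m)" "\<And>m. sets (\<nu> m) = sets borel" and D: "\<And>m. closed (D m)"
    and q_cont: "\<And>m. continuous_map (top_of_set (D m \<times> UNIV)) weak_conv_topology q"
    and c_lsc: "\<And>m. lsc_on (D m \<times> UNIV) ?c"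
    and major: "\<And>m B x a. B \<in> sets borel \<Longrightarrow> (x, a) \<in> graph A \<Longrightarrow> emeasure (q (x, a)) ((U m - D m) \<inter> B) \<le> emeasure (\<nu> m) B"
  proof -
    have "\<forall>m. \<exists>z. open (fst z) \<and> K m \<subseteq> fst z \<and> finite_measure (fst (snd z)) \<and> sets (fst (snd z)) = sets borel \<and>
      closed (snd (snd z)) \<and> continuous_map (top_of_set (snd (snd z) \<times> UNIV)) weak_conv_topology q \<and>
      lsc_on (snd (snd z) \<times> UNIV) ?c \<and>
      (\<forall>B\<in>sets borel. \<forall>(x, a)\<in>graph A. emeasure (q (x, a)) ((fst z - snd (snd z)) \<inter> B) \<le> emeasure (fst (snd z)) B)"
      using M by simp
    from choice[OF this] obtain z where "\<forall>m. open (fst (z m)) \<and> K m \<subseteq> fst (z m) \<and> finite_measure (fst (snd (z m))) \<and> sets (fst (snd (z m))) = sets borel \<and>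
      closed (snd (snd (z m))) \<and> continuous_map (top_of_set (snd (snd (z m)) \<times> UNIV)) weak_conv_topology q \<and>
      lsc_on (snd (snd (z m)) \<times> UNIV) ?c \<and>
      (\<forall>B\<in>sets borel. \<forall>(x, a)\<in>graph A. emeasure (q (x, a)) ((fst (z m) - snd (snd (z m))) \<inter> B) \<le> emeasure (fst (snd (z m))) B)"
      by blast
    then show thesis
      by (intro that[of "\<lambda>m. fst (z m)" "\<lambda>m. fst (snd (z m))" "\<lambda>m. snd (snd (z m))"]) auto
  qed
  \<comment> \<open>Uniform countable additivity away from \<open>D m\<close>. The index
    \<open>k\<close> is chosen from \<open>\<nu> m\<close> alone, before any \<open>j\<close> is
    fixed.\<close>
  have small: "\<exists>k::nat. \<forall>j. measure (\<gamma> j) ((U m \<times> A' m - D m \<times> UNIV) \<inter> E k) \<le> e"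
    if E: "range E \<subseteq> sets borel" "decseq E" "(\<Inter>i. E i) = {}" "0 < e" for m E e
  proof -
    have A'_fin: "finite (A' m)" by (rule finite_compact_discrete[OF SU(4)])
    obtain k where k: "(\<Sum>a\<in>A' m. emeasure (\<nu> m) ((\<lambda>x. (x, a)) -` E k)) \<le> ennreal e"
      using decseq_sum_emeasure_small[OF \<nu> A'_fin E] by blast
    have "measure (\<gamma> j) ((U m \<times> A' m - D m \<times> UNIV) \<inter> E k) \<le> e" for j
    proof -
      interpret \<gamma>: prob_space "\<gamma> j" by (rule \<gamma>_prob)
      have eq: "(U m \<times> A' m - D m \<times> UNIV) \<inter> E k = ((U m - D m) \<times> A' m) \<inter> E k" by auto
      have "emeasure (\<gamma> j) (((U m - D m) \<times> A' m) \<inter> E k) \<le> (\<Sum>a\<in>A' m. emeasure (\<nu> m) ((\<lambda>x. (x, a)) -` E k))"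
        unfolding \<gamma>_def
      proof (rule controlled_process.emeasure_occupation_majorized[OF cp n_pos A'_fin])
        show "U m - D m \<in> sets borel" using U(1)[of m] D[of m] by auto
        show "E k \<in> sets borel" using E(1) by auto
      qed (rule major)
      from this k have "emeasure (\<gamma> j) ((U m \<times> A' m - D m \<times> UNIV) \<inter> E k) \<le> ennreal e"
        unfolding eq by (rule order_trans)
      then show ?thesis using E(4) by (simp add: \<gamma>.emeasure_eq_measure)
    qed
    then show ?thesis by blast
  qed
  have "S \<times> (UNIV :: 'a discrete set) \<in> sets borel"
    using borel_space(1) by (intro borel_Times) auto
  then obtain s \<gamma>' where s: "strict_mono s" and \<gamma>': "prob_space \<gamma>'" "sets \<gamma>' = sets borel"
    and lim: "\<And>h. h \<in> borel_measurable borel \<Longrightarrow> (\<And>m. lsc_on (D m \<times> UNIV) h) \<Longrightarrow>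
      (\<integral>\<^sup>+z. h z \<partial>\<gamma>') \<le> liminf (\<lambda>j. \<integral>\<^sup>+z. h z \<partial>\<gamma> (s j))"
  proof (rule tight_subsequence_liminf[OF hom' _ \<gamma>_prob \<gamma>_sets KA_inc KA_compact,
      where U = "\<lambda>m. U m \<times> A' m" and D = "\<lambda>m. D m \<times> UNIV"])
    show "\<exists>m. \<forall>j. 1 - e \<le> measure (\<gamma> j) (K m \<times> A' m)" if "0 < e" for e
      using that by (rule tight)
    show "open (U m \<times> A' m)" for m
      by (intro open_Times U discrete_topology_class.open_discrete)
    show "K m \<times> A' m \<subseteq> U m \<times> A' m" for m
      using U(2)[of m] by auto
    show "closed (D m \<times> (UNIV :: 'a set))" for m
      by (intro closed_Times D closed_UNIV)
    show "\<exists>k. \<forall>j. measure (\<gamma> j) ((U m \<times> A' m - D m \<times> UNIV) \<inter> E k) \<le> e"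
      if "range E \<subseteq> sets borel" "decseq E" "(\<Inter>i. E i) = {}" "0 < e" for m E e
      using that by (rule small)
    fix s \<gamma>'
    assume "strict_mono s" "prob_space \<gamma>'" "sets \<gamma>' = sets borel" and
      *: "\<And>h. h \<in> borel_measurable borel \<Longrightarrow> (\<And>m. lsc_on (D m \<times> UNIV) h) \<Longrightarrow>
        (\<integral>\<^sup>+z. h z \<partial>\<gamma>') \<le> liminf (\<lambda>j. \<integral>\<^sup>+z. h z \<partial>\<gamma> (s j))"
    then show thesis by (intro that[of s \<gamma>'] *)
  qed
  interpret \<gamma>': prob_space \<gamma>' by (rule \<gamma>'(1))
  note \<gamma>'(2)[measurable_cong]
  have cost_\<gamma>': "(\<integral>\<^sup>+z. ?c z \<partial>\<gamma>') \<le> \<rho>"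
  proof -
    have "(\<integral>\<^sup>+z. ?c z \<partial>\<gamma>') \<le> liminf (\<lambda>j. \<integral>\<^sup>+z. ?c z \<partial>\<gamma> (s j))"
      by (rule lim[OF c_meas c_lsc])
    also have "\<dots> \<le> liminf (\<lambda>j. ennreal (?b (s j)))"
      using cost_le by (intro Liminf_mono always_eventually) (simp add: \<gamma>_def)
    also have "(\<lambda>j. ennreal (?b (s j))) \<longlonglongrightarrow> ennreal ((r + 0) * (1 + 0))"
      using s by (intro tendsto_ennrealI tendsto_intros LIMSEQ_subseq_LIMSEQ[OF LIMSEQ_Suc[OF lim_1_over_n], unfolded comp_def])
    then have "liminf (\<lambda>j. ennreal (?b (s j))) = ennreal r"
      by (intro lim_imp_Liminf) auto
    finally show ?thesis by (simp add: r)
  qed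
  \<comment> \<open>Admissibility of the limit comes from its finite cost: the extended cost is
    infinite outside the graph.\<close>
  have "AE z in \<gamma>'. ?c z \<noteq> \<infinity>"
    using cost_\<gamma>' \<open>\<rho> < \<infinity>\<close> by (intro nn_integral_noteq_infinite) auto
  then have full: "AE z in \<gamma>'. z \<in> graph A"
    by eventually_elim (auto simp: ext_cost_def split: if_splits)
  obtain \<mu> where \<mu>: "\<mu> \<in> borel \<rightarrow>\<^sub>M prob_algebra borel" "\<And>x. emeasure (\<mu> x) (A x) = 1"
    "\<gamma>' = distr \<gamma>' borel fst \<bind> (\<lambda>x. distr (\<mu> x) borel (Pair x))"
    using disintegration[OF \<gamma>' actions full] by blast
  define P where "P = distr \<gamma>' borel fst"
  have P_prob: "prob_space P" unfolding P_def by (rule \<gamma>'.prob_space_distr) measurable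
  have P_sets[measurable_cong]: "sets P = sets borel" by (simp add: P_def)
  have q_sub: "q \<in> \<gamma>' \<rightarrow>\<^sub>M subprob_algebra borel"
    using measurable_prob_algebraD[OF kernel] by (simp add: \<gamma>'(2) cong: measurable_cong_sets)
  have q_prob: "prob_space (q z)" and q_sets: "sets (q z) = sets borel" for z
    using measurable_space[OF kernel, of z] by (auto simp: space_prob_algebra)
  have bind_sets: "sets (\<gamma>' \<bind> q) = sets borel"
    by (rule sets_bind[OF sets_kernel[OF q_sub] \<gamma>'.not_empty])
  \<comment> \<open>This is invariance before disintegration. For each test function, integrating it
    over the state and over the next state gives nearly the same value under
    \<open>\<gamma> j\<close>, and both integrals converge along \<open>s\<close>.\<close>
  have P_eq: "P = \<gamma>' \<bind> q"
  proof (rule measure_eqI_continuous[OF hom P_sets bind_sets])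
    show "finite_measure P" using P_prob by (rule prob_space.finite_measure)
    fix u :: "'x \<Rightarrow> real" assume u: "continuous_on UNIV u" "\<And>x. 0 \<le> u x" "\<And>x. u x \<le> 1"
    have u_meas[measurable]: "u \<in> borel_measurable borel"
      using u(1) by (rule borel_measurable_continuous_onI)
    \<comment> \<open>By (M) the expected value of \<open>u\<close> after one transition is
      continuous on each \<open>D m \<times> UNIV\<close>. Elsewhere it is merely Borel, as
      \<open>lim\<close> allows.\<close>
    define v where "v z = (\<integral>y. u y \<partial>q z)" for z
    have v_nn: "(\<integral>\<^sup>+y. u y \<partial>q z) = ennreal (v z)" for z
    proof -
      interpret qz: prob_space "q z" by (rule q_prob)
      show ?thesis
        unfolding v_def using u q_sets[of z]
        by (intro nn_integral_eq_integral qz.integrable_const_bound[where B = 1]) (auto cong: measurable_cong_sets)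
    qed
    have v_nonneg: "0 \<le> v z" for z unfolding v_def using u(2) by (intro Bochner_Integration.integral_nonneg) auto
    have v_le: "v z \<le> 1" for z
    proof -
      have "(\<integral>\<^sup>+y. u y \<partial>q z) \<le> (\<integral>\<^sup>+y. 1 \<partial>q z)"
        using u(3) by (intro nn_integral_mono) (simp flip: ennreal_1 add: ennreal_leI)
      then have "ennreal (v z) \<le> 1"
        using prob_space.emeasure_space_1[OF q_prob, of z] by (simp add: v_nn)
      then show ?thesis by (simp add: ennreal_le_1)
    qed
    have v_meas[measurable]: "v \<in> borel_measurable borel"
    proof -
      have "(\<lambda>z. \<integral>\<^sup>+y. u y \<partial>q z) \<in> borel_measurable borel"
        using measurable_compose[OF measurable_prob_algebraD[OF kernel] nn_integral_measurable_subprob_algebra[of "\<lambda>y. ennreal (u y)" borel]]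
        by simp
      then have "(\<lambda>z. enn2real (ennreal (v z))) \<in> borel_measurable borel"
        unfolding v_nn by measurable
      then show ?thesis using v_nonneg by simp
    qed
    have v_cont: "continuous_on (D m \<times> UNIV) v" for m
      unfolding v_def using u by (intro continuous_map_weak_conv_integral[OF q_cont]) (auto simp: bounded_iff intro!: exI[of _ 1])
    have u_cont: "continuous_on (D m \<times> UNIV) (\<lambda>z. u (fst z))" for m
      by (intro continuous_on_compose2[OF u(1)] continuous_on_fst continuous_on_id) auto
    have conv_v: "(\<lambda>j. \<integral>z. v z \<partial>\<gamma> (s j)) \<longlonglongrightarrow> (\<integral>z. v z \<partial>\<gamma>')"
      by (rule tendsto_integral_of_liminf[OF \<gamma>_prob \<gamma>'(1) \<gamma>_sets \<gamma>'(2) lim v_meas v_nonneg v_le v_cont])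
    have uf_meas: "(\<lambda>z. u (fst z)) \<in> borel_measurable (borel :: ('x \<times> 'a) measure)" by measurable
    have conv_u: "(\<lambda>j. \<integral>z. u (fst z) \<partial>\<gamma> (s j)) \<longlonglongrightarrow> (\<integral>z. u (fst z) \<partial>\<gamma>')"
      by (rule tendsto_integral_of_liminf[OF \<gamma>_prob \<gamma>'(1) \<gamma>_sets \<gamma>'(2) lim uf_meas u(2) u(3) u_cont])
    have nn: "(\<integral>\<^sup>+z. ennreal (w z) \<partial>Q) = ennreal (\<integral>z. w z \<partial>Q)"
      if "prob_space Q" "sets Q = sets borel" "w \<in> borel_measurable borel" "\<And>z. 0 \<le> w z" "\<And>z. w z \<le> 1"
      for w and Q :: "('x \<times> 'a) measure"
    proof -
      interpret Q: prob_space Q by fact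
      show ?thesis
        using that by (intro nn_integral_eq_integral Q.integrable_const_bound[where B = 1]) (auto cong: measurable_cong_sets)
    qed
    \<comment> \<open>The boundary terms of the time shift, with bound 1 for \<open>u\<close>, weigh
      at most \<open>1 / n j\<close>.\<close>
    have diff: "\<bar>(\<integral>z. u (fst z) \<partial>\<gamma> j) - (\<integral>z. v z \<partial>\<gamma> j)\<bar> \<le> 1 / n j" for j
    proof -
      have I: "0 \<le> (\<integral>z. u (fst z) \<partial>\<gamma> j)" "0 \<le> (\<integral>z. v z \<partial>\<gamma> j)"
        using u(2) v_nonneg by (auto intro: Bochner_Integration.integral_nonneg)
      have d: "ennreal 1 / of_nat (n j) = ennreal (1 / n j)"
        using n_pos[of j] by (simp only: ennreal_of_nat_eq_real_of_nat) (subst divide_ennreal, auto)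
      have "(\<lambda>x. ennreal (u x)) \<in> borel_measurable borel" by measurable
      moreover have "ennreal (u x) \<le> ennreal 1" for x using u(3) by (rule ennreal_leI)
      ultimately have shift: "(\<integral>\<^sup>+z. ennreal (u (fst z)) \<partial>\<gamma> j) \<le> (\<integral>\<^sup>+z. ennreal (v z) \<partial>\<gamma> j) + ennreal (1 / n j)"
        "(\<integral>\<^sup>+z. ennreal (v z) \<partial>\<gamma> j) \<le> (\<integral>\<^sup>+z. ennreal (u (fst z)) \<partial>\<gamma> j) + ennreal (1 / n j)"
        using controlled_process.nn_integral_occupation_shift[OF cp _ _ n_pos, of "\<lambda>x. ennreal (u x)" 1 j j]
        unfolding \<gamma>_def v_nn d by blast+
      have "ennreal (\<integral>z. u (fst z) \<partial>\<gamma> j) \<le> ennreal ((\<integral>z. v z \<partial>\<gamma> j) + 1 / n j)"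
        using shift(1) I unfolding nn[OF \<gamma>_prob \<gamma>_sets uf_meas u(2) u(3)] nn[OF \<gamma>_prob \<gamma>_sets v_meas v_nonneg v_le]
        by (simp add: ennreal_plus)
      moreover have "ennreal (\<integral>z. v z \<partial>\<gamma> j) \<le> ennreal ((\<integral>z. u (fst z) \<partial>\<gamma> j) + 1 / n j)"
        using shift(2) I unfolding nn[OF \<gamma>_prob \<gamma>_sets uf_meas u(2) u(3)] nn[OF \<gamma>_prob \<gamma>_sets v_meas v_nonneg v_le]
        by (simp add: ennreal_plus)
      ultimately show ?thesis
        using I unfolding ennreal_le_iff[OF add_nonneg_nonneg[OF I(2) zero_le_divide_1_iff[THEN iffD2, OF of_nat_0_le_iff]]]
          ennreal_le_iff[OF add_nonneg_nonneg[OF I(1) zero_le_divide_1_iff[THEN iffD2, OF of_nat_0_le_iff]]]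
        by linarith
    qed
    have "(\<lambda>j. (\<integral>z. u (fst z) \<partial>\<gamma> (s j)) - (\<integral>z. v z \<partial>\<gamma> (s j))) \<longlonglongrightarrow> 0"
    proof (rule Lim_null_comparison)
      show "(\<lambda>j. 1 / real (Suc j)) \<longlonglongrightarrow> 0" by (rule LIMSEQ_Suc[OF lim_1_over_n])
      show "\<forall>\<^sub>F j in sequentially. norm ((\<integral>z. u (fst z) \<partial>\<gamma> (s j)) - (\<integral>z. v z \<partial>\<gamma> (s j))) \<le> 1 / real (Suc j)"
      proof (intro always_eventually allI)
        fix j
        \<comment> \<open>Both \<open>j \<le> s j\<close> and \<open>s j < n (s j)\<close> enter, so
          the window lengths tend to infinity along the subsequence as well.\<close>
        have "Suc j \<le> n (s j)" using n[of "s j"] strict_mono_imp_increasing[OF s, of j] by simp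
        then have "1 / real (n (s j)) \<le> 1 / real (Suc j)" by (intro divide_left_mono) auto
        with diff[of "s j"] show "norm ((\<integral>z. u (fst z) \<partial>\<gamma> (s j)) - (\<integral>z. v z \<partial>\<gamma> (s j))) \<le> 1 / real (Suc j)"
          by simp
      qed
    qed
    with tendsto_diff[OF conv_u conv_v] have "(\<integral>z. u (fst z) \<partial>\<gamma>') = (\<integral>z. v z \<partial>\<gamma>')"
      using LIMSEQ_unique by fastforce
    then have "(\<integral>\<^sup>+z. u (fst z) \<partial>\<gamma>') = (\<integral>\<^sup>+z. \<integral>\<^sup>+y. u y \<partial>q z \<partial>\<gamma>')"
      unfolding v_nn nn[OF \<gamma>' uf_meas u(2) u(3)] nn[OF \<gamma>' v_meas v_nonneg v_le] by simp
    then show "(\<integral>\<^sup>+x. ennreal (u x) \<partial>P) = (\<integral>\<^sup>+x. ennreal (u x) \<partial>(\<gamma>' \<bind> q))"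
      unfolding P_def by (subst nn_integral_bind[OF _ q_sub]) (auto simp: nn_integral_distr)
  qed
  have stat: "stationary \<mu> \<in> policies A"
    using \<mu>(1,2) by (rule stationary_in_policies)
  have P_pm: "P \<in> prob_measures"
    using P_prob P_sets by (simp add: prob_measures_def space_prob_algebra)
  have \<gamma>'_eq: "P \<bind> (\<lambda>x. distr (\<mu> x) borel (Pair x)) = \<gamma>'"
    using \<mu>(3) by (simp add: P_def)
  have inv: "invariant_measure q \<mu> P"
    unfolding invariant_measure_def
  proof (intro conjI ballI P_pm)
    fix B :: "'x set" assume B: "B \<in> sets borel"
    have "emeasure P B = emeasure (\<gamma>' \<bind> q) B" by (simp flip: P_eq)
    also have "\<dots> = (\<integral>\<^sup>+z. emeasure (q z) B \<partial>\<gamma>')"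
      by (rule emeasure_bind[OF \<gamma>'.not_empty q_sub B])
    also have "\<dots> = (\<integral>\<^sup>+z. emeasure (q z) B \<partial>(P \<bind> (\<lambda>x. distr (\<mu> x) borel (Pair x))))"
      by (simp only: \<gamma>'_eq)
    also have "\<dots> = (\<integral>\<^sup>+x. \<integral>\<^sup>+a. emeasure (q (x, a)) B \<partial>\<mu> x \<partial>P)"
      by (rule nn_integral_bind_distr_Pair[OF \<mu>(1) P_sets])
        (rule measurable_compose[OF measurable_prob_algebraD[OF kernel] measurable_emeasure_subprob_algebra[OF B]])
    finally show "emeasure P B = (\<integral>\<^sup>+x. \<integral>\<^sup>+a. emeasure (q (x, a)) B \<partial>\<mu> x \<partial>P)" .
  qed
  have "controlled_process A q (stationary \<mu>) P"
    by standard (rule kernel stat P_pm actions(2))+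
  from avg_cost_stationary[OF this inv c_meas]
  have "avg_cost A c q (stationary \<mu>) P \<le> \<rho>"
    using cost_\<gamma>' by (simp add: \<gamma>'_eq)
  moreover have "\<rho> \<le> avg_cost A c q (stationary \<mu>) P"
    unfolding \<rho>_def using stat P_pm by (intro INF_lower2[OF P_pm] INF_lower)
  ultimately show ?thesis
    using stat P_pm inv unfolding \<rho>_def by (intro exI[of _ \<mu>] exI[of _ P]) auto
qed

end
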